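(* Let $\mathbf{k}\in\mathbb{N}^d$ and suppose that the mixed multiplicity $e(M;\mathbf{k})$ of $M$ of the type $\mathbf{k}$ is defined. The following are equivalent: (i) $e(M;\mathbf{k})>0$. (ii) $\dim\mathrm{Supp}_{++}(M/\mathbf{x}M)=0$ for any mixed multiplicity system $\mathbf{x}$ of $M$ of the type $\mathbf{k}$. (iii) $\dim\mathrm{Supp}_{++}(M/\mathbf{x}M)=0$ for any $S_{++}$-filter-regular sequence $\mathbf{x}$ with respect to $M$ of the type $\mathbf{k}$. (iv) There exists an $S_{++}$-filter-regular sequence $\mathbf{x}$ with respect to $M$ of the type $\mathbf{k}$ such that $\dim\mathrm{Supp}_{++}(M/\mathbf{x}M)=0$.
   Context: $\mathbb{N}$ denotes the nonnegative integers and $d\ge 1$ is an integer. $(A,\mathfrak{m})$ is an Artinian local ring with infinite residue field; $S=\bigoplus_{\mathbf{n}\in\mathbb{N}^d}S_{\mathbf{n}}$ is a finitely generated standard $\mathbb{N}^d$-graded (commutative) algebra over $A$, i.e. $S$ is generated over $A$ by elements of total degree $1$; $M=\bigoplus_{\mathbf{n}\in\mathbb{N}^d}M_{\mathbf{n}}$ is a finitely generated $\mathbb{N}^d$-graded $S$-module. On $\mathbb{N}^d$, $\le$ is componentwise, and $\mathbf{h}>\mathbf{k}$ means $\mathbf{h}\ge\mathbf{k}$ and $\mathbf{h}\ne\mathbf{k}$. "For all large $\mathbf{n}$" means for all $\mathbf{n}$ with every component sufficiently large. Let $\mathbf{e}_i$ be the $i$-th unit vector of $\mathbb{N}^d$,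 $S_i=S_{\mathbf{e}_i}$, and $S_{++}=\bigoplus_{\mathbf{n}\ge(1,\ldots,1)}S_{\mathbf{n}}$. $\mathrm{Proj}\,S$ is the set of homogeneous prime ideals of $S$ not containing $S_{++}$; $\mathrm{Supp}_{++}M=\{P\in\mathrm{Proj}\,S: M_P\ne0\}$; its dimension is the supremum of lengths of chains of primes in it, with $\dim\emptyset=-\infty$. Mixed multiplicities: $\ell_A$ denotes length. For all large $\mathbf{n}$, $\ell_A[M_{\mathbf{n}}]$ equals a polynomial $P_M(\mathbf{n})$ (the Hilbert polynomial), written uniquely as $P_M(\mathbf{n})=\sum_{\mathbf{k}\in\mathbb{N}^d}e(M;\mathbf{k})\binom{\mathbf{n}+\mathbf{k}}{\mathbf{k}}$ with $e(M;\mathbf{k})\in\mathbb{Z}$, where $\binom{\mathbf{n}+\mathbf{k}}{\mathbf{k}}=\prod_{i=1}^d\binom{n_i+k_i}{k_i}$. The mixed multiplicity (of maximal degree) of $M$ of the type $\mathbf{k}$ is defined if $e(M;\mathbf{h})=0$ for all $\mathbf{h}>\mathbf{k}$, and is then the number $e(M;\mathbf{k})$. A sequence of elements of $\bigcup_{j=1}^dS_j$ consisting of $k_1$ elements of $S_1$, ..., $k_d$ elements of $S_d$ (in any order) is said to be of the type $\mathbf{k}=(k_1,\ldots,k_d)$. A sequence $\mathbf{x}$ of the type $\mathbf{k}$ is a mixed multiplicity system of $M$ of the type $\mathbf{k}$ if $\dim\mathrm{Supp}_{++}(M/\mathbf{x}M)\le0$. A homogeneous element $a\in S$ is $S_{++}$-filter-regular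 with respect to $M$ if $(0_M:a)_{\mathbf{n}}=0$ for all large $\mathbf{n}$, where $0_M:a=\{m\in M: am=0\}$; a sequence $x_1,\ldots,x_t$ of homogeneous elements is an $S_{++}$-filter-regular sequence with respect to $M$ if each $x_i$ is $S_{++}$-filter-regular with respect to $M/(x_1,\ldots,x_{i-1})M$. *)

theory Defs
  imports "HOL-Algebra.QuotRing" "HOL-Algebra.Module" "HOL-Algebra.Generated_Rings"
    "HOL-Library.Extended_Real"
begin

definition chain_lengths :: "'a set set \<Rightarrow> nat set" where
  "chain_lengths \<C> = {n. \<exists>P :: nat \<Rightarrow> 'a set. (\<forall>i\<le>n. P i \<in> \<C>) \<and> (\<forall>i<n. P i \<subset> P (Suc i))}"

definition module_length :: "('a, 'c) ring_scheme \<Rightarrow> ('a, 'b, 'e) module_scheme \<Rightarrow> enat" where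
  "module_length R M = Sup (enat ` chain_lengths {N. submodule N R M})"

text \<open>A chain with \<open>n + 1\<close> members has length \<open>n\<close>, so the empty set has no chain lengths and
  its dimension is the supremum \<open>-\<infinity>\<close> of the empty set in the extended reals.\<close>

definition chain_dim :: "'a set set \<Rightarrow> ereal" where
  "chain_dim \<C> = Sup ((\<lambda>n. ereal (real n)) ` chain_lengths \<C>)"

definition artinian :: "('a, 'c) ring_scheme \<Rightarrow> bool" where
  "artinian R \<longleftrightarrow> (\<forall>I :: nat \<Rightarrow> 'a set. (\<forall>n. ideal (I n) R \<and> I (Suc n) \<subseteq> I n) \<longrightarrow>
     (\<exists>n. \<forall>m\<ge>n. I m = I n))"

locale artinian_local_ring = cring A for A (structure) and \<mm> +
  assumes artinian: "artinian A"
    and maximal: "maximalideal \<mm> A"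
    and unique_maximal: "maximalideal J A \<Longrightarrow> J = \<mm>"

text \<open>The finite type \<open>'d\<close> indexes the coordinates, so \<open>\<nat>\<^sup>d\<close> is the type \<open>'d \<Rightarrow> nat\<close> with
  \<open>d = CARD('d) \<ge> 1\<close>. Its library order \<open>\<le>\<close> is componentwise, and \<open>k < h\<close> means
  \<open>k \<le> h\<close> and \<open>k \<noteq> h\<close>.\<close>

definition unit_vec :: "'d \<Rightarrow> 'd \<Rightarrow> nat" where
  "unit_vec i = (\<lambda>j. if j = i then 1 else 0)"

definition for_large :: "(('d \<Rightarrow> nat) \<Rightarrow> bool) \<Rightarrow> bool" where
  "for_large Q \<longleftrightarrow> (\<exists>N. \<forall>n\<ge>N. Q n)"

definition decomposition ::
    "('a, 'c) ring_scheme \<Rightarrow> (('d \<Rightarrow> nat) \<Rightarrow> 'a set) \<Rightarrow> 'a \<Rightarrow> (('d \<Rightarrow> nat) \<Rightarrow> 'a) \<Rightarrow> bool" where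
  "decomposition G \<G> x f \<longleftrightarrow> (\<forall>n. f n \<in> \<G> n) \<and> finite {n. f n \<noteq> \<zero>\<^bsub>G\<^esub>} \<and>
     x = (\<Oplus>\<^bsub>G\<^esub>n\<in>{n. f n \<noteq> \<zero>\<^bsub>G\<^esub>}. f n)"

definition direct_sum :: "('a, 'c) ring_scheme \<Rightarrow> (('d \<Rightarrow> nat) \<Rightarrow> 'a set) \<Rightarrow> bool" where
  "direct_sum G \<G> \<longleftrightarrow> (\<forall>n. additive_subgroup (\<G> n) G) \<and>
     (\<forall>x\<in>carrier G. \<exists>!f. decomposition G \<G> x f)"

definition scalars :: "('a, 'c) ring_scheme \<Rightarrow> ('a, 's, 'e) module_scheme \<Rightarrow> 's set" where
  "scalars A S = (\<lambda>a. a \<odot>\<^bsub>S\<^esub> \<one>\<^bsub>S\<^esub>) ` carrier A"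

locale standard_graded_algebra = algebra A S
  for A :: "('a, 'c) ring_scheme" and S :: "('a, 's, 'e) module_scheme"
    and SG :: "('d::finite \<Rightarrow> nat) \<Rightarrow> 's set" +
  assumes S_direct_sum: "direct_sum S SG"
    and S_submodule: "submodule (SG n) A S"
    and S_mult: "x \<in> SG m \<Longrightarrow> y \<in> SG n \<Longrightarrow> x \<otimes>\<^bsub>S\<^esub> y \<in> SG (\<lambda>i. m i + n i)"
    and S_finitely_generated:
      "\<exists>T. finite T \<and> T \<subseteq> carrier S \<and> generate_ring S (scalars A S \<union> T) = carrier S"
    and S_standard:
      "generate_ring S (scalars A S \<union> (\<Union>i. SG (unit_vec i))) = carrier S"

definition span :: "('s, 'c) ring_scheme \<Rightarrow> ('s, 'm, 'e) module_scheme \<Rightarrow> 'm set \<Rightarrow> 'm set" where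
  "span S M T = (\<lambda>N. submodule N S M) hull T"

locale fg_graded_module = module S M
  for S :: "('s, 'c) ring_scheme" and SG :: "('d::finite \<Rightarrow> nat) \<Rightarrow> 's set"
    and M :: "('s, 'm, 'e) module_scheme" and MG :: "('d \<Rightarrow> nat) \<Rightarrow> 'm set" +
  assumes M_direct_sum: "direct_sum M MG"
    and M_smult: "s \<in> SG k \<Longrightarrow> x \<in> MG n \<Longrightarrow> s \<odot>\<^bsub>M\<^esub> x \<in> MG (\<lambda>i. k i + n i)"
    and M_finitely_generated: "\<exists>T. finite T \<and> T \<subseteq> carrier M \<and> span S M T = carrier M"

text \<open>The ring multiplication and unit that \<^typ>\<open>('s, 'm) module\<close> inherits from rings play no role
  for modules.\<close>

definition quotient_module ::
    "('s, 'm, 'e) module_scheme \<Rightarrow> 'm set \<Rightarrow> ('s, 'm set) module" where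
  "quotient_module M N =
     \<lparr>carrier = a_rcosets\<^bsub>M\<^esub> N, mult = undefined, one = undefined, zero = N, add = set_add M,
      smult = (\<lambda>s T. \<Union>x\<in>T. N +>\<^bsub>M\<^esub> (s \<odot>\<^bsub>M\<^esub> x))\<rparr>"

text \<open>Used only for a homogeneous submodule \<open>N\<close>, where the degree \<open>n\<close> piece of \<open>M / N\<close> is the image
  of \<open>M\<^sub>n\<close>.\<close>

definition quotient_grading ::
    "('s, 'm, 'e) module_scheme \<Rightarrow> 'm set \<Rightarrow> (('d \<Rightarrow> nat) \<Rightarrow> 'm set) \<Rightarrow> ('d \<Rightarrow> nat) \<Rightarrow> 'm set set" where
  "quotient_grading M N MG n = (\<lambda>x. N +>\<^bsub>M\<^esub> x) ` MG n"

definition seq_submodule ::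
    "('s, 'c) ring_scheme \<Rightarrow> ('s, 'm, 'e) module_scheme \<Rightarrow> 's list \<Rightarrow> 'm set" where
  "seq_submodule S M xs = span S M {x \<odot>\<^bsub>M\<^esub> m | x m. x \<in> set xs \<and> m \<in> carrier M}"

abbreviation quotient_by_seq ::
    "('s, 'c) ring_scheme \<Rightarrow> ('s, 'm, 'e) module_scheme \<Rightarrow> 's list \<Rightarrow> ('s, 'm set) module" where
  "quotient_by_seq S M xs \<equiv> quotient_module M (seq_submodule S M xs)"

definition fraction_rel ::
    "('s, 'c) ring_scheme \<Rightarrow> ('s, 'm, 'e) module_scheme \<Rightarrow> 's set \<Rightarrow> (('m \<times> 's) \<times> ('m \<times> 's)) set" where
  "fraction_rel S M P = {((m, s), (m', s')).
     m \<in> carrier M \<and> m' \<in> carrier M \<and> s \<in> carrier S - P \<and> s' \<in> carrier S - P \<and>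
     (\<exists>u\<in>carrier S - P. u \<odot>\<^bsub>M\<^esub> (s' \<odot>\<^bsub>M\<^esub> m) = u \<odot>\<^bsub>M\<^esub> (s \<odot>\<^bsub>M\<^esub> m'))}"

text \<open>The localization \<open>M\<^sub>P\<close> at a prime ideal \<open>P\<close>, regarded as an \<open>S\<close>-module: classes of fractions
  \<open>m / s\<close> with \<open>s \<notin> P\<close>.\<close>

definition localized_module ::
    "('s, 'c) ring_scheme \<Rightarrow> ('s, 'm, 'e) module_scheme \<Rightarrow> 's set \<Rightarrow> ('s, ('m \<times> 's) set) module" where
  "localized_module S M P =
     \<lparr>carrier = (carrier M \<times> (carrier S - P)) // fraction_rel S M P,
      mult = undefined, one = undefined,
      zero = fraction_rel S M P `` {(\<zero>\<^bsub>M\<^esub>, \<one>\<^bsub>S\<^esub>)},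
      add = (\<lambda>T U. fraction_rel S M P ``
        {(t \<odot>\<^bsub>M\<^esub> x \<oplus>\<^bsub>M\<^esub> s \<odot>\<^bsub>M\<^esub> y, s \<otimes>\<^bsub>S\<^esub> t) | x s y t. (x, s) \<in> T \<and> (y, t) \<in> U}),
      smult = (\<lambda>a T. fraction_rel S M P `` {(a \<odot>\<^bsub>M\<^esub> x, s) | x s. (x, s) \<in> T})\<rparr>"

definition homogeneous_ideal ::
    "('s, 'c) ring_scheme \<Rightarrow> (('d \<Rightarrow> nat) \<Rightarrow> 's set) \<Rightarrow> 's set \<Rightarrow> bool" where
  "homogeneous_ideal S SG I \<longleftrightarrow> ideal I S \<and>
     (\<forall>x\<in>I. \<forall>f. decomposition S SG x f \<longrightarrow> (\<forall>n. f n \<in> I))"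

text \<open>The ideal \<open>S\<^sub>+\<^sub>+\<close>: all nonzero components lie in degrees \<open>n \<ge> (1, \<dots>, 1)\<close>.\<close>

definition irrelevant :: "('s, 'c) ring_scheme \<Rightarrow> (('d \<Rightarrow> nat) \<Rightarrow> 's set) \<Rightarrow> 's set" where
  "irrelevant S SG = {x \<in> carrier S. \<exists>f. decomposition S SG x f \<and>
     (\<forall>n. f n \<noteq> \<zero>\<^bsub>S\<^esub> \<longrightarrow> (\<lambda>_. 1) \<le> n)}"

definition multi_proj :: "('s, 'c) ring_scheme \<Rightarrow> (('d \<Rightarrow> nat) \<Rightarrow> 's set) \<Rightarrow> 's set set" where
  "multi_proj S SG =
     {P. primeideal P S \<and> homogeneous_ideal S SG P \<and> \<not> irrelevant S SG \<subseteq> P}"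

definition supp_pp ::
    "('s, 'c) ring_scheme \<Rightarrow> (('d \<Rightarrow> nat) \<Rightarrow> 's set) \<Rightarrow> ('s, 'm, 'e) module_scheme \<Rightarrow> 's set set" where
  "supp_pp S SG M = {P \<in> multi_proj S SG.
     carrier (localized_module S M P) \<noteq> {\<zero>\<^bsub>localized_module S M P\<^esub>}}"

definition dim_supp ::
    "('s, 'c) ring_scheme \<Rightarrow> (('d \<Rightarrow> nat) \<Rightarrow> 's set) \<Rightarrow> ('s, 'm, 'e) module_scheme \<Rightarrow> ereal" where
  "dim_supp S SG M = chain_dim (supp_pp S SG M)"

text \<open>A graded piece \<open>H\<close> of \<open>M\<close> as an \<open>A\<close>-module, \<open>A\<close> acting through the structure map
  \<open>a \<mapsto> a \<cdot> 1\<^sub>S\<close>.\<close>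

definition scalar_restriction ::
    "('a, 's, 'e) module_scheme \<Rightarrow> ('s, 'm, 'f) module_scheme \<Rightarrow> 'm set \<Rightarrow> ('a, 'm) module" where
  "scalar_restriction S M H =
     \<lparr>carrier = H, mult = mult M, one = one M, zero = zero M, add = add M,
      smult = (\<lambda>a x. (a \<odot>\<^bsub>S\<^esub> \<one>\<^bsub>S\<^esub>) \<odot>\<^bsub>M\<^esub> x)\<rparr>"

definition hilbert_fun ::
    "('a, 'c) ring_scheme \<Rightarrow> ('a, 's, 'e) module_scheme \<Rightarrow> ('s, 'm, 'f) module_scheme \<Rightarrow>
     (('d \<Rightarrow> nat) \<Rightarrow> 'm set) \<Rightarrow> ('d \<Rightarrow> nat) \<Rightarrow> enat" where
  "hilbert_fun A S M MG n = module_length A (scalar_restriction S M (MG n))"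

definition binomial_poly :: "(('d::finite \<Rightarrow> nat) \<Rightarrow> int) \<Rightarrow> ('d \<Rightarrow> nat) \<Rightarrow> int" where
  "binomial_poly e n = (\<Sum>k | e k \<noteq> 0. e k * (\<Prod>i\<in>UNIV. int ((n i + k i) choose (k i))))"

definition is_hilbert_coeffs ::
    "('a, 'c) ring_scheme \<Rightarrow> ('a, 's, 'e) module_scheme \<Rightarrow> ('s, 'm, 'f) module_scheme \<Rightarrow>
     (('d::finite \<Rightarrow> nat) \<Rightarrow> 'm set) \<Rightarrow> (('d \<Rightarrow> nat) \<Rightarrow> int) \<Rightarrow> bool" where
  "is_hilbert_coeffs A S M MG e \<longleftrightarrow> finite {k. e k \<noteq> 0} \<and>
     for_large (\<lambda>n. \<exists>l. hilbert_fun A S M MG n = enat l \<and> int l = binomial_poly e n)"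

text \<open>The coefficients \<open>e(M; k)\<close> of the Hilbert polynomial in the binomial basis. They are determined by
  the values at all large \<open>n\<close>, since the basis polynomials are linearly independent.\<close>

definition hilbert_coeff ::
    "('a, 'c) ring_scheme \<Rightarrow> ('a, 's, 'e) module_scheme \<Rightarrow> ('s, 'm, 'f) module_scheme \<Rightarrow>
     (('d::finite \<Rightarrow> nat) \<Rightarrow> 'm set) \<Rightarrow> ('d \<Rightarrow> nat) \<Rightarrow> int" where
  "hilbert_coeff A S M MG = (THE e. is_hilbert_coeffs A S M MG e)"

definition mixed_mult_defined ::
    "('a, 'c) ring_scheme \<Rightarrow> ('a, 's, 'e) module_scheme \<Rightarrow> ('s, 'm, 'f) module_scheme \<Rightarrow>
     (('d::finite \<Rightarrow> nat) \<Rightarrow> 'm set) \<Rightarrow> ('d \<Rightarrow> nat) \<Rightarrow> bool" where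
  "mixed_mult_defined A S M MG k \<longleftrightarrow> (\<forall>h. h > k \<longrightarrow> hilbert_coeff A S M MG h = 0)"

text \<open>The witness \<open>js\<close> assigns to each member of the sequence a degree \<open>\<e>\<^sub>j\<close> in which it is homogeneous;
  it is determined by the sequence except at zero members, which lie in every degree.\<close>

definition of_type :: "(('d \<Rightarrow> nat) \<Rightarrow> 's set) \<Rightarrow> ('d \<Rightarrow> nat) \<Rightarrow> 's list \<Rightarrow> bool" where
  "of_type SG k xs \<longleftrightarrow> (\<exists>js. list_all2 (\<lambda>x j. x \<in> SG (unit_vec j)) xs js \<and>
     (\<forall>j. count_list js j = k j))"

definition mixed_mult_system ::
    "('s, 'c) ring_scheme \<Rightarrow> (('d \<Rightarrow> nat) \<Rightarrow> 's set) \<Rightarrow> ('s, 'm, 'e) module_scheme \<Rightarrow>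
     ('d \<Rightarrow> nat) \<Rightarrow> 's list \<Rightarrow> bool" where
  "mixed_mult_system S SG M k xs \<longleftrightarrow>
     of_type SG k xs \<and> dim_supp S SG (quotient_by_seq S M xs) \<le> 0"

definition filter_regular ::
    "(('d \<Rightarrow> nat) \<Rightarrow> 's set) \<Rightarrow> ('s, 'm, 'e) module_scheme \<Rightarrow> (('d \<Rightarrow> nat) \<Rightarrow> 'm set) \<Rightarrow>
     's \<Rightarrow> bool" where
  "filter_regular SG M MG a \<longleftrightarrow> (\<exists>n. a \<in> SG n) \<and>
     for_large (\<lambda>n. {m \<in> carrier M. a \<odot>\<^bsub>M\<^esub> m = \<zero>\<^bsub>M\<^esub>} \<inter> MG n = {\<zero>\<^bsub>M\<^esub>})"

definition filter_regular_seq ::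
    "('s, 'c) ring_scheme \<Rightarrow> (('d \<Rightarrow> nat) \<Rightarrow> 's set) \<Rightarrow> ('s, 'm, 'e) module_scheme \<Rightarrow>
     (('d \<Rightarrow> nat) \<Rightarrow> 'm set) \<Rightarrow> 's list \<Rightarrow> bool" where
  "filter_regular_seq S SG M MG xs \<longleftrightarrow> (\<forall>i<length xs.
     filter_regular SG (quotient_by_seq S M (take i xs))
       (quotient_grading M (seq_submodule S M (take i xs)) MG) (xs ! i))"

end

theory Submission
  imports Defs "HOL-Library.Function_Algebras" "HOL-Computational_Algebra.Primes"
begin

text \<open>
  All four conditions say \<open>e(M; k) > 0\<close>. For a filter-regular \<open>x \<in> S\<^sub>j\<close> the sequence
  \<open>0 \<rightarrow> M(-e\<^sub>j) \<rightarrow> M \<rightarrow> M/xM \<rightarrow> 0\<close> is exact in large degrees, so the Hilbert polynomial of \<open>M/xM\<close> is the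
  difference of that of \<open>M\<close> in direction \<open>j\<close>, and in the binomial basis differencing is a shift of the
  coefficients (\<open>filter_reg_has_coeffs\<close>). If \<open>x\<close> is a filter-regular sequence of type \<open>k\<close> and \<open>e(M; h) = 0\<close>
  for all \<open>h > k\<close>, the Hilbert polynomial of \<open>M/xM\<close> is therefore the constant \<open>e(M; k)\<close>. A bounded
  Hilbert function leaves no room for two primes \<open>P \<subset> Q\<close> in the support (\<open>bounded_imp_no_chain\<close>), and
  the support is empty exactly if the pieces vanish in all large degrees. So the dimension of the support
  is at most \<open>0\<close>, with equality exactly if \<open>e(M; k) > 0\<close>. Filter-regular sequences of every type exist by
  prime avoidance, because the residue field is infinite (\<open>filter_reg_exists\<close>).

  For a mixed multiplicity system \<open>x\<close> the only alternative to dimension \<open>0\<close> is an empty support. By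
  Nakayama's lemma no relevant prime of the support of \<open>M\<close> then contains \<open>x\<close>. Induction along \<open>x\<close>, applied
  both to the cokernel and to the kernel of multiplication by its first element, shows that the difference
  of type \<open>k\<close> of the Hilbert polynomial vanishes (\<open>shift_coeffs_zero\<close>); this is the Euler characteristic of
  Koszul homology, computed one element at a time. Hence \<open>e(M; k) = 0\<close>.

  The Hilbert polynomial itself comes from devissage: a homogeneous submodule grows to any larger one by
  steps isomorphic to shifts of \<open>S/P\<close> with \<open>P\<close> prime. If \<open>P\<close> contains no \<open>S\<^sub>j\<close>, multiplication by an element of
  \<open>S\<^sub>j - P\<close> shows, by noetherian induction on \<open>P\<close>, that each partial difference of the Hilbert function of
  \<open>S/P\<close> is eventually polynomial, and a function with this property is eventually polynomial
  (\<open>eventually_polynomial_if_differences\<close>).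

  Throughout, a subquotient \<open>N/N'\<close> is represented by the pair \<open>N' \<subseteq> N\<close> of submodules of one fixed module,
  and the length of its degree \<open>n\<close> piece by chains of subgroups between \<open>N' \<inter> M\<^sub>n\<close> and \<open>N \<inter> M\<^sub>n\<close> that are
  stable under the coefficient ring. Finite length of the coefficient ring and the basis theorem supply
  the chain conditions.
\<close>

section \<open>Lengths of intervals of stable subgroups\<close>

lemma chain_lengths_image:
  assumes "\<And>H K. H \<in> \<C> \<Longrightarrow> K \<in> \<C> \<Longrightarrow> H \<subset> K \<Longrightarrow> \<phi> H \<subset> \<phi> K"
    and "\<And>H. H \<in> \<C> \<Longrightarrow> \<phi> H \<in> \<D>"
  shows "chain_lengths \<C> \<subseteq> chain_lengths \<D>"
proof
  fix n assume "n \<in> chain_lengths \<C>"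
  then obtain P :: "nat \<Rightarrow> _" where P: "\<forall>i\<le>n. P i \<in> \<C>" "\<forall>i<n. P i \<subset> P (Suc i)"
    by (auto simp: chain_lengths_def)
  then have "(\<forall>i\<le>n. \<phi> (P i) \<in> \<D>) \<and> (\<forall>i<n. \<phi> (P i) \<subset> \<phi> (P (Suc i)))"
    using assms by (metis Suc_leI less_imp_le_nat)
  then show "n \<in> chain_lengths \<D>"
    unfolding chain_lengths_def by (intro CollectI exI[of _ "\<lambda>i. \<phi> (P i)"])
qed

text \<open>Dropping the repetitions of a weakly increasing chain leaves a strict chain.\<close>

lemma chain_of_weak_chain:
  fixes H :: "nat \<Rightarrow> 'a set"
  assumes "\<And>i. i \<le> n \<Longrightarrow> H i \<in> \<C>" "\<And>i. i < n \<Longrightarrow> H i \<subseteq> H (Suc i)"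
  shows "card {i. i < n \<and> H i \<noteq> H (Suc i)} \<in> chain_lengths \<C>"
proof -
  have "\<exists>P :: nat \<Rightarrow> 'a set. (\<forall>i\<le>card {i. i < n \<and> H i \<noteq> H (Suc i)}. P i \<in> \<C>) \<and>
      (\<forall>i<card {i. i < n \<and> H i \<noteq> H (Suc i)}. P i \<subset> P (Suc i)) \<and>
      P (card {i. i < n \<and> H i \<noteq> H (Suc i)}) = H n"
    using assms
  proof (induction n)
    case 0
    then show ?case by (intro exI[of _ "\<lambda>_. H 0"]) auto
  next
    case (Suc n)
    let ?c = "card {i. i < n \<and> H i \<noteq> H (Suc i)}"
    obtain P :: "nat \<Rightarrow> 'a set" where P: "\<forall>i\<le>?c. P i \<in> \<C>" "\<forall>i<?c. P i \<subset> P (Suc i)" "P ?c = H n"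
    proof -
      have "\<exists>P :: nat \<Rightarrow> 'a set. (\<forall>i\<le>?c. P i \<in> \<C>) \<and> (\<forall>i<?c. P i \<subset> P (Suc i)) \<and> P ?c = H n"
        by (rule Suc.IH) (use Suc.prems in auto)
      then show ?thesis using that by blast
    qed
    show ?case
    proof (cases "H n = H (Suc n)")
      case True
      then have "{i. i < Suc n \<and> H i \<noteq> H (Suc i)} = {i. i < n \<and> H i \<noteq> H (Suc i)}"
        by (auto simp: less_Suc_eq)
      then show ?thesis using P True by auto
    next
      case False
      then have "{i. i < Suc n \<and> H i \<noteq> H (Suc i)} = insert n {i. i < n \<and> H i \<noteq> H (Suc i)}"
        by (auto simp: less_Suc_eq)
      then have c: "card {i. i < Suc n \<and> H i \<noteq> H (Suc i)} = Suc ?c" by simp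
      have "H n \<subset> H (Suc n)" using False Suc.prems(2)[of n] by auto
      moreover have "H (Suc n) \<in> \<C>" using Suc.prems(1) by simp
      ultimately show ?thesis
        unfolding c using P
        by (intro exI[of _ "\<lambda>i. if i \<le> ?c then P i else H (Suc n)"])
          (auto simp: less_Suc_eq le_Suc_eq)
    qed
  qed
  then show ?thesis unfolding chain_lengths_def by blast
qed

text \<open>For \<open>X = carrier R\<close> these are the \<open>R\<close>-submodules. With \<open>X\<close> the image of a ring \<open>A\<close> in \<open>R\<close>
  they are the \<open>A\<close>-submodules, so one notion serves for chains over both rings.\<close>

definition stable :: "('a, 'm, 'e) module_scheme \<Rightarrow> 'a set \<Rightarrow> 'm set \<Rightarrow> bool" where
  "stable M X N \<longleftrightarrow> additive_subgroup N M \<and> (\<forall>x\<in>X. \<forall>m\<in>N. x \<odot>\<^bsub>M\<^esub> m \<in> N)"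

definition between :: "('a, 'm, 'e) module_scheme \<Rightarrow> 'a set \<Rightarrow> 'm set \<Rightarrow> 'm set \<Rightarrow> 'm set set" where
  "between M X a b = {H. stable M X H \<and> a \<subseteq> H \<and> H \<subseteq> b}"

definition fin_len :: "('a, 'm, 'e) module_scheme \<Rightarrow> 'a set \<Rightarrow> 'm set \<Rightarrow> 'm set \<Rightarrow> bool" where
  "fin_len M X a b \<longleftrightarrow> finite (chain_lengths (between M X a b))"

text \<open>The length of \<open>b / a\<close> as a module over the operators \<open>X\<close>. It is meaningful only under
  \<open>fin_len\<close>, since the maximum of an infinite set is unspecified.\<close>

definition len :: "('a, 'm, 'e) module_scheme \<Rightarrow> 'a set \<Rightarrow> 'm set \<Rightarrow> 'm set \<Rightarrow> nat" where
  "len M X a b = Max (chain_lengths (between M X a b))"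

definition acc :: "('a, 'm, 'e) module_scheme \<Rightarrow> 'a set \<Rightarrow> 'm set \<Rightarrow> bool" where
  "acc M X E \<longleftrightarrow> (\<forall>f :: nat \<Rightarrow> 'm set.
     (\<forall>n. stable M X (f n) \<and> f n \<subseteq> E \<and> f n \<subseteq> f (Suc n)) \<longrightarrow> (\<exists>n. \<forall>m\<ge>n. f m = f n))"

lemma accD:
  assumes "acc M X E" "\<And>n. stable M X (f n)" "\<And>n. f n \<subseteq> E" "\<And>n. f n \<subseteq> f (Suc n)"
  shows "\<exists>n::nat. \<forall>m\<ge>n. f m = f n"
  using assms unfolding acc_def by simp

lemma zero_in_chain_lengths: "H \<in> \<C> \<Longrightarrow> 0 \<in> chain_lengths \<C>"
  by (auto simp: chain_lengths_def)

text \<open>Lengths of subquotients, also over different operators, are compared through strictly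
  monotone maps between their lattices of stable subgroups.\<close>

lemma fin_len_map:
  assumes "fin_len M' X' a' b'"
    and "\<And>H. H \<in> between M X a b \<Longrightarrow> \<phi> H \<in> between M' X' a' b'"
    and "\<And>H K. H \<in> between M X a b \<Longrightarrow> K \<in> between M X a b \<Longrightarrow> H \<subset> K \<Longrightarrow> \<phi> H \<subset> \<phi> K"
  shows "fin_len M X a b"
  using chain_lengths_image[of "between M X a b" \<phi>, OF assms(3,2)] assms(1) finite_subset
  unfolding fin_len_def by blast

lemma len_map_le:
  assumes "fin_len M' X' a' b'" "stable M X a" "a \<subseteq> b"
    and "\<And>H. H \<in> between M X a b \<Longrightarrow> \<phi> H \<in> between M' X' a' b'"
    and "\<And>H K. H \<in> between M X a b \<Longrightarrow> K \<in> between M X a b \<Longrightarrow> H \<subset> K \<Longrightarrow> \<phi> H \<subset> \<phi> K"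
  shows "len M X a b \<le> len M' X' a' b'"
proof -
  have "chain_lengths (between M X a b) \<subseteq> chain_lengths (between M' X' a' b')"
    by (rule chain_lengths_image[of "between M X a b" \<phi>, OF assms(5,4)])
  moreover have "a \<in> between M X a b" using assms by (auto simp: between_def)
  ultimately show ?thesis
    unfolding len_def using assms(1) zero_in_chain_lengths
    by (intro Max_mono) (auto simp: fin_len_def)
qed

lemma fin_len_subinterval:
  "fin_len M X a b \<Longrightarrow> a \<subseteq> a' \<Longrightarrow> b' \<subseteq> b \<Longrightarrow> fin_len M X a' b'"
  by (rule fin_len_map[of M X a b M X a' b' id]) (auto simp: between_def)

lemma len_self: "stable M X a \<Longrightarrow> len M X a a = 0"
  and fin_len_self: "stable M X a \<Longrightarrow> fin_len M X a a"
proof -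
  assume a: "stable M X a"
  have *: "between M X a a = {a}" using a by (auto simp: between_def)
  have "chain_lengths (between M X a a) = {0}"
  proof (intro equalityI subsetI)
    fix n assume "n \<in> chain_lengths (between M X a a)"
    then obtain P where P: "\<forall>i\<le>n. P i = a" "\<forall>i<n. P i \<subset> P (Suc i)"
      by (auto simp: chain_lengths_def *)
    have "\<not> 0 < n"
    proof
      assume "0 < n"
      then have "P 0 \<subset> P 1" "P 0 = a" "P 1 = a" using P by auto
      then show False by simp
    qed
    then show "n \<in> {0}" by simp
  qed (use zero_in_chain_lengths[of a] * in auto)
  then show "len M X a a = 0" "fin_len M X a a" by (auto simp: len_def fin_len_def)
qed

lemma len_pos:
  assumes "fin_len M X a b" "stable M X a" "stable M X b" "a \<subset> b"
  shows "len M X a b > 0"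
proof -
  have "1 \<in> chain_lengths (between M X a b)"
    using assms unfolding chain_lengths_def between_def
    by (intro CollectI exI[of _ "\<lambda>i. if i = 0 then a else b"]) (simp add: psubset_imp_subset)
  then show ?thesis unfolding len_def using assms(1)
    by (metis Max_ge fin_len_def less_numeral_extra(1) order_less_le_trans)
qed

lemma set_add_iff: "y \<in> H <+>\<^bsub>M\<^esub> K \<longleftrightarrow> (\<exists>h\<in>H. \<exists>k\<in>K. y = h \<oplus>\<^bsub>M\<^esub> k)"
  by (auto simp: set_add_def')

context module
begin

lemma stableD:
  assumes "stable M X N"
  shows "N \<subseteq> carrier M" "\<zero>\<^bsub>M\<^esub> \<in> N" "x \<in> N \<Longrightarrow> x \<in> carrier M"
    "x \<in> N \<Longrightarrow> y \<in> N \<Longrightarrow> x \<oplus>\<^bsub>M\<^esub> y \<in> N" "x \<in> N \<Longrightarrow> \<ominus>\<^bsub>M\<^esub> x \<in> N"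
    "x \<in> N \<Longrightarrow> y \<in> N \<Longrightarrow> x \<ominus>\<^bsub>M\<^esub> y \<in> N" "a \<in> X \<Longrightarrow> x \<in> N \<Longrightarrow> a \<odot>\<^bsub>M\<^esub> x \<in> N"
proof -
  interpret N: additive_subgroup N M using assms by (simp add: stable_def)
  show "N \<subseteq> carrier M" "\<zero>\<^bsub>M\<^esub> \<in> N" "x \<in> N \<Longrightarrow> x \<in> carrier M"
    "x \<in> N \<Longrightarrow> y \<in> N \<Longrightarrow> x \<oplus>\<^bsub>M\<^esub> y \<in> N" "x \<in> N \<Longrightarrow> \<ominus>\<^bsub>M\<^esub> x \<in> N"
    "x \<in> N \<Longrightarrow> y \<in> N \<Longrightarrow> x \<ominus>\<^bsub>M\<^esub> y \<in> N"
    using N.a_subset by (auto simp: M.minus_eq)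
  show "a \<in> X \<Longrightarrow> x \<in> N \<Longrightarrow> a \<odot>\<^bsub>M\<^esub> x \<in> N" using assms by (auto simp: stable_def)
qed

lemma stableI:
  assumes "N \<subseteq> carrier M" "\<zero>\<^bsub>M\<^esub> \<in> N"
    "\<And>x y. x \<in> N \<Longrightarrow> y \<in> N \<Longrightarrow> x \<oplus>\<^bsub>M\<^esub> y \<in> N" "\<And>x. x \<in> N \<Longrightarrow> \<ominus>\<^bsub>M\<^esub> x \<in> N"
    "\<And>a x. a \<in> X \<Longrightarrow> x \<in> N \<Longrightarrow> a \<odot>\<^bsub>M\<^esub> x \<in> N"
  shows "stable M X N"
  unfolding stable_def
proof (intro conjI additive_subgroupI ballI)
  show "subgroup N (add_monoid M)"
    using assms by (intro subgroup.intro) (auto simp: a_inv_def)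
qed (use assms in auto)

lemma stable_zero: "X \<subseteq> carrier R \<Longrightarrow> stable M X {\<zero>\<^bsub>M\<^esub>}"
  by (rule stableI) auto

lemma stable_carrier: "X \<subseteq> carrier R \<Longrightarrow> stable M X (carrier M)"
  by (rule stableI) auto

lemma stable_mono: "stable M X N \<Longrightarrow> Y \<subseteq> X \<Longrightarrow> stable M Y N"
  by (auto simp: stable_def)

lemma stable_Int:
  assumes "stable M X N" "stable M X K" shows "stable M X (N \<inter> K)"
  using stableD[OF assms(1)] stableD[OF assms(2)] by (intro stableI) auto

lemma stable_add:
  assumes X: "X \<subseteq> carrier R" and N: "stable M X N" and K: "stable M X K"
  shows "stable M X (N <+>\<^bsub>M\<^esub> K)"
proof (rule stableI)
  note n = stableD[OF N] and k = stableD[OF K]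
  show "N <+>\<^bsub>M\<^esub> K \<subseteq> carrier M" using n(3) k(3) by (auto simp: set_add_iff)
  show "\<zero>\<^bsub>M\<^esub> \<in> N <+>\<^bsub>M\<^esub> K" 
    unfolding set_add_iff using n(2) k(2) M.l_zero[OF M.zero_closed] by metis
  fix x assume "x \<in> N <+>\<^bsub>M\<^esub> K"
  then obtain a b where ab: "a \<in> N" "b \<in> K" "x = a \<oplus>\<^bsub>M\<^esub> b" by (auto simp: set_add_iff)
  have "\<ominus>\<^bsub>M\<^esub> x = \<ominus>\<^bsub>M\<^esub> a \<oplus>\<^bsub>M\<^esub> \<ominus>\<^bsub>M\<^esub> b" using ab n(3) k(3) by (simp add: M.minus_add)
  then show "\<ominus>\<^bsub>M\<^esub> x \<in> N <+>\<^bsub>M\<^esub> K"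
    unfolding set_add_iff using n(5)[OF ab(1)] k(5)[OF ab(2)] by blast
  show "c \<odot>\<^bsub>M\<^esub> x \<in> N <+>\<^bsub>M\<^esub> K" if c: "c \<in> X" for c
  proof -
    have "c \<odot>\<^bsub>M\<^esub> x = c \<odot>\<^bsub>M\<^esub> a \<oplus>\<^bsub>M\<^esub> c \<odot>\<^bsub>M\<^esub> b"
      using ab n(3) k(3) X c by (auto simp: smult_r_distr)
    then show ?thesis unfolding set_add_iff using n(7)[OF c ab(1)] k(7)[OF c ab(2)] by blast
  qed
  fix y assume "y \<in> N <+>\<^bsub>M\<^esub> K"
  then obtain c d where cd: "c \<in> N" "d \<in> K" "y = c \<oplus>\<^bsub>M\<^esub> d" by (auto simp: set_add_iff)
  have "x \<oplus>\<^bsub>M\<^esub> y = (a \<oplus>\<^bsub>M\<^esub> c) \<oplus>\<^bsub>M\<^esub> (b \<oplus>\<^bsub>M\<^esub> d)"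
    using ab cd n(3) k(3) by (simp add: M.a_ac)
  then show "x \<oplus>\<^bsub>M\<^esub> y \<in> N <+>\<^bsub>M\<^esub> K"
    unfolding set_add_iff using n(4)[OF ab(1) cd(1)] k(4)[OF ab(2) cd(2)] by blast
qed

lemma set_add_le:
  assumes "stable M X L" "N \<subseteq> L" "K \<subseteq> L" shows "N <+>\<^bsub>M\<^esub> K \<subseteq> L"
  using assms(2,3) stableD(4)[OF assms(1)] by (auto simp: set_add_iff subset_iff)

lemma set_add_ge1:
  assumes "stable M X N" "stable M Y K" shows "N \<subseteq> N <+>\<^bsub>M\<^esub> K"
proof
  fix x assume x: "x \<in> N"
  then have "x = x \<oplus>\<^bsub>M\<^esub> \<zero>\<^bsub>M\<^esub>" using stableD[OF assms(1)] by simp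
  then show "x \<in> N <+>\<^bsub>M\<^esub> K" using x stableD(2)[OF assms(2)] by (auto simp: set_add_iff)
qed

lemma set_add_ge2:
  assumes "stable M X N" "stable M Y K" shows "K \<subseteq> N <+>\<^bsub>M\<^esub> K"
proof
  fix x assume x: "x \<in> K"
  then have "x = \<zero>\<^bsub>M\<^esub> \<oplus>\<^bsub>M\<^esub> x" using stableD[OF assms(2)] by simp
  then show "x \<in> N <+>\<^bsub>M\<^esub> K" using x stableD(2)[OF assms(1)] by (auto simp: set_add_iff)
qed

lemma chain_lengths_concat:
  assumes "stable M X b" "p \<in> chain_lengths (between M X a b)" "q \<in> chain_lengths (between M X b c)"
    "a \<subseteq> b" "b \<subseteq> c"
  shows "p + q \<in> chain_lengths (between M X a c)"
proof -
  obtain P :: "nat \<Rightarrow> 'c set"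
    where P: "\<forall>i\<le>p. P i \<in> between M X a b" "\<forall>i<p. P i \<subset> P (Suc i)"
    using assms(2) by (auto simp: chain_lengths_def)
  obtain Q :: "nat \<Rightarrow> 'c set"
    where Q: "\<forall>i\<le>q. Q i \<in> between M X b c" "\<forall>i<q. Q i \<subset> Q (Suc i)"
    using assms(3) by (auto simp: chain_lengths_def)
  \<comment> \<open>The last member of the first chain and the first member of the second are both replaced
    by \<open>b\<close>, which keeps every inclusion strict.\<close>
  define W where "W = (\<lambda>i. if i < p then P i else if i = p then b else Q (i - p))"
  have "W i \<in> between M X a c" if "i \<le> p + q" for i
  proof -
    have "P i \<in> between M X a c" if "i < p"
    proof -
      have "P i \<in> between M X a b" using P(1) that by auto
      then show ?thesis using assms(5) by (auto simp: between_def)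
    qed
    moreover have "Q (i - p) \<in> between M X a c" if "p < i"
    proof -
      have "Q (i - p) \<in> between M X b c" using Q(1) \<open>i \<le> p + q\<close> by auto
      then show ?thesis using assms(4) by (auto simp: between_def)
    qed
    moreover have "b \<in> between M X a c" using assms by (auto simp: between_def)
    ultimately show ?thesis by (auto simp: W_def)
  qed
  moreover have "W i \<subset> W (Suc i)" if "i < p + q" for i
  proof -
    consider "Suc i < p" | "Suc i = p" | "i = p" | "i > p" by linarith
    then show ?thesis
    proof cases
      case 1 then show ?thesis using P by (auto simp: W_def)
    next
      case 2
      then have "P i \<subset> P p" using P(2) by auto
      moreover have "P p \<subseteq> b" using P(1) by (auto simp: between_def)
      ultimately show ?thesis using 2 by (auto simp: W_def)
    next
      case 3
      then have "Q 0 \<subset> Q 1" using Q(2) that by auto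
      moreover have "b \<subseteq> Q 0" using Q(1) by (auto simp: between_def)
      ultimately show ?thesis using 3 by (auto simp: W_def)
    next
      case 4
      then have "Q (i - p) \<subset> Q (Suc (i - p))" using Q(2) that by auto
      moreover have "Suc (i - p) = Suc i - p" using 4 by auto
      ultimately show ?thesis using 4 by (auto simp: W_def)
    qed
  qed
  ultimately show ?thesis unfolding chain_lengths_def by blast
qed

text \<open>By the modular law a strict inclusion of stable subgroups stays strict either after
  intersecting with \<open>b\<close> or after adding \<open>b\<close>.\<close>

lemma chain_lengths_split:
  assumes X: "X \<subseteq> carrier R" and b: "stable M X b" "a \<subseteq> b" "b \<subseteq> c"
    and n: "n \<in> chain_lengths (between M X a c)" and c: "stable M X c"
  shows "\<exists>p\<in>chain_lengths (between M X a b). \<exists>q\<in>chain_lengths (between M X b c). n \<le> p + q"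
proof -
  obtain P :: "nat \<Rightarrow> 'c set"
    where P: "\<forall>i\<le>n. P i \<in> between M X a c" "\<forall>i<n. P i \<subset> P (Suc i)"
    using n by (auto simp: chain_lengths_def)
  have PX: "stable M X (P i)" "a \<subseteq> P i" "P i \<subseteq> c" if "i \<le> n" for i
    using P(1) that by (auto simp: between_def)
  let ?A = "{i. i < n \<and> P i \<inter> b \<noteq> P (Suc i) \<inter> b}"
  let ?B = "{i. i < n \<and> P i <+>\<^bsub>M\<^esub> b \<noteq> P (Suc i) <+>\<^bsub>M\<^esub> b}"
  have "card ?A \<in> chain_lengths (between M X a b)"
    using PX P(2) b by (intro chain_of_weak_chain) (auto simp: between_def intro: stable_Int)
  moreover have "card ?B \<in> chain_lengths (between M X b c)"
  proof (rule chain_of_weak_chain)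
    fix i assume "i \<le> n"
    then show "P i <+>\<^bsub>M\<^esub> b \<in> between M X b c"
      using stable_add[OF X PX(1) b(1)] set_add_ge2[OF PX(1) b(1)] set_add_le[OF c PX(3) b(3)]
      by (auto simp: between_def)
  next
    fix i assume "i < n"
    then show "P i <+>\<^bsub>M\<^esub> b \<subseteq> P (Suc i) <+>\<^bsub>M\<^esub> b"
      using P(2) by (fastforce simp: set_add_iff)
  qed
  moreover have "n \<le> card ?A + card ?B"
  proof -
    have "{..<n} \<subseteq> ?A \<union> ?B"
    proof
      fix i assume i: "i \<in> {..<n}"
      show "i \<in> ?A \<union> ?B"
      proof (rule ccontr)
        assume no: "i \<notin> ?A \<union> ?B"
        have "P (Suc i) \<subseteq> P i"
        proof
          fix y assume y: "y \<in> P (Suc i)"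
          have s1: "stable M X (P i)" and s2: "stable M X (P (Suc i))" using PX i by auto
          have "y \<in> P i <+>\<^bsub>M\<^esub> b" using no i y set_add_ge1[OF s2 b(1)] by auto
          then obtain h \<beta> where h: "h \<in> P i" "\<beta> \<in> b" "y = h \<oplus>\<^bsub>M\<^esub> \<beta>" by (auto simp: set_add_iff)
          have "h \<in> P (Suc i)" using P(2) i h by auto
          then have "y \<ominus>\<^bsub>M\<^esub> h \<in> P (Suc i)" using stableD(6)[OF s2] y by blast
          moreover have "y \<ominus>\<^bsub>M\<^esub> h = \<beta>"
            using h stableD(3)[OF s1] stableD(3)[OF b(1)]
            by (simp add: M.minus_eq M.a_comm[of h] M.a_assoc M.r_neg)
          ultimately have "\<beta> \<in> P i" using no i h by auto
          then show "y \<in> P i" using h stableD(4)[OF s1] by auto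
        qed
        then show False using P(2) i by auto
      qed
    qed
    then have "n \<le> card (?A \<union> ?B)" using card_mono[of "?A \<union> ?B" "{..<n}"] by auto
    then show ?thesis using card_Un_le[of ?A ?B] by linarith
  qed
  ultimately show ?thesis by blast
qed

lemma fin_len_trans:
  assumes X: "X \<subseteq> carrier R" and b: "stable M X b" "a \<subseteq> b" "b \<subseteq> c" and c: "stable M X c"
    and f: "fin_len M X a b" "fin_len M X b c"
  shows "fin_len M X a c"
proof -
  have "n \<le> Max (chain_lengths (between M X a b)) + Max (chain_lengths (between M X b c))"
    if n: "n \<in> chain_lengths (between M X a c)" for n
  proof -
    obtain p q where pq: "p \<in> chain_lengths (between M X a b)" "q \<in> chain_lengths (between M X b c)"
      "n \<le> p + q"
      using chain_lengths_split[OF X b n c] by blast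
    then show ?thesis
      using f Max_ge[OF _ pq(1)] Max_ge[OF _ pq(2)] unfolding fin_len_def by linarith
  qed
  then show ?thesis unfolding fin_len_def using finite_nat_set_iff_bounded_le by blast
qed

lemma len_add:
  assumes X: "X \<subseteq> carrier R" and st: "stable M X a" "stable M X b" "stable M X c"
    and le: "a \<subseteq> b" "b \<subseteq> c" and f: "fin_len M X a c"
  shows "len M X a c = len M X a b + len M X b c"
proof -
  let ?L = "\<lambda>a b. chain_lengths (between M X a b)"
  have fin: "finite (?L a b)" "finite (?L b c)" "finite (?L a c)"
    using f le fin_len_subinterval[of M X a c] unfolding fin_len_def by auto
  have ne: "?L a b \<noteq> {}" "?L b c \<noteq> {}" "?L a c \<noteq> {}"
    using st le zero_in_chain_lengths[of a "between M X a b"]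
      zero_in_chain_lengths[of b "between M X b c"] zero_in_chain_lengths[of a "between M X a c"]
    by (auto simp: between_def)
  have "Max (?L a b) + Max (?L b c) \<in> ?L a c"
    using chain_lengths_concat[OF st(2) Max_in Max_in le] fin ne by blast
  then have "Max (?L a b) + Max (?L b c) \<le> Max (?L a c)" using fin by simp
  moreover have "Max (?L a c) \<le> Max (?L a b) + Max (?L b c)"
  proof -
    obtain p q where pq: "p \<in> ?L a b" "q \<in> ?L b c" "Max (?L a c) \<le> p + q"
      using chain_lengths_split[OF X st(2) le Max_in[OF fin(3) ne(3)] st(3)] by blast
    then show ?thesis using Max_ge[OF fin(1) pq(1)] Max_ge[OF fin(2) pq(2)] by linarith
  qed
  ultimately show ?thesis by (simp add: len_def)
qed

lemma len_eq_0_iff: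
  assumes "fin_len M X a b" "stable M X a" "stable M X b" "a \<subseteq> b"
  shows "len M X a b = 0 \<longleftrightarrow> a = b"
  using len_pos[OF assms(1-3)] len_self[OF assms(2)] assms(4) by (metis less_irrefl psubsetI)

lemma fin_len_imp_acc:
  assumes "fin_len M X {\<zero>\<^bsub>M\<^esub>} E"
  shows "acc M X E"
  unfolding acc_def
proof (intro allI impI)
  fix f :: "nat \<Rightarrow> 'c set"
  assume f: "\<forall>n. stable M X (f n) \<and> f n \<subseteq> E \<and> f n \<subseteq> f (Suc n)"
  let ?J = "{i. f i \<noteq> f (Suc i)}"
  have "finite ?J"
  proof (rule ccontr)
    assume inf: "infinite ?J"
    have "finite (chain_lengths (between M X {\<zero>\<^bsub>M\<^esub>} E))" using assms by (simp add: fin_len_def)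
    then obtain L where L: "\<forall>n\<in>chain_lengths (between M X {\<zero>\<^bsub>M\<^esub>} E). n \<le> L"
      unfolding finite_nat_set_iff_bounded_le by blast
    obtain T where T: "finite T" "card T = Suc L" "T \<subseteq> ?J" using infinite_arbitrarily_large[OF inf, of "Suc L"] by auto
    obtain n where n: "T \<subseteq> {..<n}" using T(1) unfolding finite_nat_iff_bounded by blast
    have "card {i. i < n \<and> f i \<noteq> f (Suc i)} \<in> chain_lengths (between M X {\<zero>\<^bsub>M\<^esub>} E)"
    proof (rule chain_of_weak_chain)
      fix i
      have "stable M X (f i)" "f i \<subseteq> E" using f by auto
      then show "f i \<in> between M X {\<zero>\<^bsub>M\<^esub>} E" using stableD(2) by (auto simp: between_def)
    qed (use f in auto)
    moreover have "card T \<le> card {i. i < n \<and> f i \<noteq> f (Suc i)}"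
      using T n by (intro card_mono) auto
    ultimately show False using L T(2) by fastforce
  qed
  then obtain n where n: "?J \<subseteq> {..<n}" unfolding finite_nat_iff_bounded by blast
  have "f m = f n" if "m \<ge> n" for m
    using that
  proof (induction m rule: dec_induct)
    case (step m)
    then have "m \<notin> ?J" using n by (meson lessThan_iff not_le subsetD)
    then have "f m = f (Suc m)" by blast
    then show ?case using step(3) by simp
  qed simp
  then show "\<exists>n. \<forall>m\<ge>n. f m = f n" by blast
qed

end

section \<open>The basis theorem\<close>

context module
begin

lemma stable_smult_image:
  assumes X: "X \<subseteq> carrier R" and x: "x \<in> carrier R" and F: "stable M X F"
  shows "stable M X ((\<lambda>m. x \<odot>\<^bsub>M\<^esub> m) ` F)"
proof (rule stableI)
  note f = stableD[OF F]
  show "(\<lambda>m. x \<odot>\<^bsub>M\<^esub> m) ` F \<subseteq> carrier M" using f(3) x by auto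
  show "\<zero>\<^bsub>M\<^esub> \<in> (\<lambda>m. x \<odot>\<^bsub>M\<^esub> m) ` F" using f(2) x smult_r_null by (metis image_eqI)
  fix a assume "a \<in> (\<lambda>m. x \<odot>\<^bsub>M\<^esub> m) ` F"
  then obtain a' where a: "a' \<in> F" "a = x \<odot>\<^bsub>M\<^esub> a'" by auto
  have "\<ominus>\<^bsub>M\<^esub> a = x \<odot>\<^bsub>M\<^esub> (\<ominus>\<^bsub>M\<^esub> a')" using a f(3) x by (simp add: smult_r_minus)
  then show "\<ominus>\<^bsub>M\<^esub> a \<in> (\<lambda>m. x \<odot>\<^bsub>M\<^esub> m) ` F" using f(5)[OF a(1)] by blast
  show "c \<odot>\<^bsub>M\<^esub> a \<in> (\<lambda>m. x \<odot>\<^bsub>M\<^esub> m) ` F" if c: "c \<in> X" for c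
  proof -
    have "c \<odot>\<^bsub>M\<^esub> a = x \<odot>\<^bsub>M\<^esub> (c \<odot>\<^bsub>M\<^esub> a')"
      using a f(3)[OF a(1)] x X c by (metis R.m_comm smult_assoc1 subsetD)
    then show ?thesis using f(7)[OF c a(1)] by blast
  qed
  fix b assume "b \<in> (\<lambda>m. x \<odot>\<^bsub>M\<^esub> m) ` F"
  then obtain b' where b: "b' \<in> F" "b = x \<odot>\<^bsub>M\<^esub> b'" by auto
  have "a \<oplus>\<^bsub>M\<^esub> b = x \<odot>\<^bsub>M\<^esub> (a' \<oplus>\<^bsub>M\<^esub> b')" using a b f(3) x by (simp add: smult_r_distr)
  then show "a \<oplus>\<^bsub>M\<^esub> b \<in> (\<lambda>m. x \<odot>\<^bsub>M\<^esub> m) ` F" using f(4)[OF a(1) b(1)] by blast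
qed

definition colon :: "'c set \<Rightarrow> 'a \<Rightarrow> 'c set" where
  "colon N x = {m \<in> carrier M. x \<odot>\<^bsub>M\<^esub> m \<in> N}"

lemma stable_colon:
  assumes x: "x \<in> carrier R" and N: "stable M X N" and X: "X \<subseteq> carrier R"
  shows "stable M X (colon N x)"
proof (rule stableI)
  note n = stableD[OF N]
  show "a \<odot>\<^bsub>M\<^esub> m \<in> colon N x" if "a \<in> X" "m \<in> colon N x" for a m
  proof -
    have ac: "a \<in> carrier R" using that X by auto
    then have "x \<odot>\<^bsub>M\<^esub> (a \<odot>\<^bsub>M\<^esub> m) = a \<odot>\<^bsub>M\<^esub> (x \<odot>\<^bsub>M\<^esub> m)"
      using that x R.m_comm by (simp add: colon_def smult_assoc1[symmetric])
    then show ?thesis using n(7)[OF that(1)] that ac by (simp add: colon_def)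
  qed
qed (use stableD(2,4,5)[OF N] x in \<open>auto simp: colon_def smult_r_distr smult_r_minus\<close>)

lemma stable_ideal_smult:
  assumes I: "ideal I R" and mc: "m \<in> carrier M"
  shows "stable M (carrier R) ((\<lambda>s. s \<odot>\<^bsub>M\<^esub> m) ` I)"
proof (rule stableI)
  interpret I: ideal I R by (rule I)
  have Ic: "s \<in> I \<Longrightarrow> s \<in> carrier R" for s using I.a_subset by blast
  show "(\<lambda>s. s \<odot>\<^bsub>M\<^esub> m) ` I \<subseteq> carrier M" using Ic mc by auto
  show "\<zero>\<^bsub>M\<^esub> \<in> (\<lambda>s. s \<odot>\<^bsub>M\<^esub> m) ` I" using mc I.zero_closed by (metis image_eqI smult_l_null)
  fix x assume "x \<in> (\<lambda>s. s \<odot>\<^bsub>M\<^esub> m) ` I"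
  then obtain s where s: "s \<in> I" "x = s \<odot>\<^bsub>M\<^esub> m" by auto
  show "\<ominus>\<^bsub>M\<^esub> x \<in> (\<lambda>s. s \<odot>\<^bsub>M\<^esub> m) ` I"
    using s Ic mc by (intro image_eqI[of _ _ "\<ominus> s"]) (auto simp: smult_l_minus)
  show "a \<odot>\<^bsub>M\<^esub> x \<in> (\<lambda>s. s \<odot>\<^bsub>M\<^esub> m) ` I" if "a \<in> carrier R" for a
    using s Ic mc that I.I_l_closed by (intro image_eqI[of _ _ "a \<otimes> s"]) (auto simp: smult_assoc1)
  fix y assume "y \<in> (\<lambda>s. s \<odot>\<^bsub>M\<^esub> m) ` I"
  then obtain t where t: "t \<in> I" "y = t \<odot>\<^bsub>M\<^esub> m" by auto
  show "x \<oplus>\<^bsub>M\<^esub> y \<in> (\<lambda>s. s \<odot>\<^bsub>M\<^esub> m) ` I"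
    using s t Ic mc by (intro image_eqI[of _ _ "s \<oplus> t"]) (auto simp: smult_l_distr)
qed

end

text \<open>Hilbert's argument with leading coefficients, for one further operator \<open>x\<close> on the
  multiples of a noetherian \<open>E\<close>. The set \<open>pol n\<close> consists of the elements that have some
  expression \<open>\<Sum>i<n. x\<^sup>i e\<^sub>i\<close> with \<open>e\<^sub>i \<in> E\<close>, and \<open>lead n N\<close> of the coefficients \<open>e\<close> such
  that \<open>N\<close> contains an element \<open>x\<^sup>n e + f\<close> with \<open>f\<close> in \<open>pol n\<close>. Expressions may be
  ambiguous: the argument uses only that they exist.\<close>

locale adjoin_operator = module R M for R (structure) and M (structure) +
  fixes X :: "'a set" and x :: 'a and E :: "'c set"
  assumes X: "X \<subseteq> carrier R" and x: "x \<in> carrier R" and E: "stable M X E" and accE: "acc M X E"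
begin

fun pol :: "nat \<Rightarrow> 'c set" where
  "pol 0 = {\<zero>\<^bsub>M\<^esub>}"
| "pol (Suc n) = pol n <+>\<^bsub>M\<^esub> (\<lambda>e. (x [^] n) \<odot>\<^bsub>M\<^esub> e) ` E"

definition lead :: "nat \<Rightarrow> 'c set \<Rightarrow> 'c set" where
  "lead n N = {e \<in> E. \<exists>f\<in>pol n. f \<oplus>\<^bsub>M\<^esub> (x [^] n) \<odot>\<^bsub>M\<^esub> e \<in> N}"

lemma pow_closed: "x [^] (n::nat) \<in> carrier R" using x by simp

lemma stable_pol: "stable M X (pol n)"
  by (induction n) (auto intro: stable_zero[OF X] stable_add[OF X] stable_smult_image[OF X pow_closed E])

lemma stable_pow: "stable M X ((\<lambda>e. (x [^] (n::nat)) \<odot>\<^bsub>M\<^esub> e) ` E)"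
  by (rule stable_smult_image[OF X pow_closed E])

lemma pol_Suc_mono: "pol n \<subseteq> pol (Suc n)"
  using set_add_ge1[OF stable_pol stable_pow] by simp

lemma pol_mono: "m \<le> n \<Longrightarrow> pol m \<subseteq> pol n"
  using lift_Suc_mono_le[of pol m n] pol_Suc_mono by blast

lemma x_pol: "f \<in> pol n \<Longrightarrow> x \<odot>\<^bsub>M\<^esub> f \<in> pol (Suc n)"
proof (induction n arbitrary: f)
  case 0
  then show ?case using stableD(2)[OF stable_pol[of 1]] x by simp
next
  case (Suc n)
  then obtain g e where g: "g \<in> pol n" "e \<in> E" "f = g \<oplus>\<^bsub>M\<^esub> (x [^] n) \<odot>\<^bsub>M\<^esub> e"
    by (auto simp: set_add_iff)
  have c: "g \<in> carrier M" "e \<in> carrier M" using stableD(3)[OF stable_pol] g stableD(3)[OF E] by auto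
  have "x \<odot>\<^bsub>M\<^esub> f = x \<odot>\<^bsub>M\<^esub> g \<oplus>\<^bsub>M\<^esub> (x [^] Suc n) \<odot>\<^bsub>M\<^esub> e"
    using g c x by (simp add: smult_r_distr smult_assoc1[symmetric] R.m_comm)
  then show ?case
    using Suc.IH[OF g(1)] g(2) unfolding pol.simps(2)[of "Suc n"] set_add_iff by blast
qed

lemma stable_Union_pol: "stable M (insert x X) (\<Union>n. pol n)"
proof (rule stableI)
  show "(\<Union>n. pol n) \<subseteq> carrier M" using stableD(1)[OF stable_pol] by auto
  show "\<zero>\<^bsub>M\<^esub> \<in> (\<Union>n. pol n)" using stableD(2)[OF stable_pol] by auto
  fix a assume "a \<in> (\<Union>n. pol n)"
  then obtain m where m: "a \<in> pol m" by auto
  show "\<ominus>\<^bsub>M\<^esub> a \<in> (\<Union>n. pol n)" using stableD(5)[OF stable_pol m] by auto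
  show "c \<odot>\<^bsub>M\<^esub> a \<in> (\<Union>n. pol n)" if "c \<in> insert x X" for c
    using that x_pol[OF m] stableD(7)[OF stable_pol _ m] by blast
  fix b assume "b \<in> (\<Union>n. pol n)"
  then obtain n where n: "b \<in> pol n" by auto
  have "a \<in> pol (max m n)" "b \<in> pol (max m n)" using m n pol_mono[of m "max m n"] pol_mono[of n "max m n"] by auto
  then show "a \<oplus>\<^bsub>M\<^esub> b \<in> (\<Union>n. pol n)" using stableD(4)[OF stable_pol] by blast
qed

lemma E_le_Union_pol: "E \<subseteq> (\<Union>n. pol n)"
proof
  fix e assume e: "e \<in> E"
  then have "e \<in> pol 1" using stableD(3)[OF E e]
    by (auto simp: set_add_iff image_iff intro!: bexI[of _ e])
  then show "e \<in> (\<Union>n. pol n)" by blast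
qed

lemma stable_lead:
  assumes N: "stable M (insert x X) N" shows "stable M X (lead n N)"
proof (rule stableI)
  let ?y = "x [^] n"
  note nn = stableD[OF N] and ee = stableD[OF E] and pp = stableD[OF stable_pol[of n]]
  show "lead n N \<subseteq> carrier M" using ee(1) by (auto simp: lead_def)
  have "\<zero>\<^bsub>M\<^esub> \<oplus>\<^bsub>M\<^esub> ?y \<odot>\<^bsub>M\<^esub> \<zero>\<^bsub>M\<^esub> = \<zero>\<^bsub>M\<^esub>" using pow_closed by simp
  then show "\<zero>\<^bsub>M\<^esub> \<in> lead n N"
    unfolding lead_def using nn(2) ee(2) pp(2) by (intro CollectI conjI bexI[of _ "\<zero>\<^bsub>M\<^esub>"]) auto
  fix a assume "a \<in> lead n N"
  then obtain f where a: "a \<in> E" "f \<in> pol n" "f \<oplus>\<^bsub>M\<^esub> ?y \<odot>\<^bsub>M\<^esub> a \<in> N" by (auto simp: lead_def)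
  note [simp] = ee(3)[OF a(1)] pp(3)[OF a(2)] pow_closed
  have "\<ominus>\<^bsub>M\<^esub> f \<oplus>\<^bsub>M\<^esub> ?y \<odot>\<^bsub>M\<^esub> (\<ominus>\<^bsub>M\<^esub> a) = \<ominus>\<^bsub>M\<^esub> (f \<oplus>\<^bsub>M\<^esub> ?y \<odot>\<^bsub>M\<^esub> a)"
    by (simp add: smult_r_minus M.minus_add)
  then show "\<ominus>\<^bsub>M\<^esub> a \<in> lead n N"
    unfolding lead_def using nn(5)[OF a(3)] ee(5)[OF a(1)] pp(5)[OF a(2)]
    by (intro CollectI conjI bexI[of _ "\<ominus>\<^bsub>M\<^esub> f"]) simp_all
  show "c \<odot>\<^bsub>M\<^esub> a \<in> lead n N" if c: "c \<in> X" for c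
  proof -
    have cc: "c \<in> carrier R" using c X by auto
    have "c \<odot>\<^bsub>M\<^esub> f \<oplus>\<^bsub>M\<^esub> ?y \<odot>\<^bsub>M\<^esub> (c \<odot>\<^bsub>M\<^esub> a) = c \<odot>\<^bsub>M\<^esub> (f \<oplus>\<^bsub>M\<^esub> ?y \<odot>\<^bsub>M\<^esub> a)"
      using cc by (simp add: smult_r_distr smult_assoc1[symmetric] R.m_comm)
    then show ?thesis
      unfolding lead_def using nn(7)[OF _ a(3)] ee(7)[OF c a(1)] pp(7)[OF c a(2)] c
      by (intro CollectI conjI bexI[of _ "c \<odot>\<^bsub>M\<^esub> f"]) simp_all
  qed
  fix b assume "b \<in> lead n N"
  then obtain g where b: "b \<in> E" "g \<in> pol n" "g \<oplus>\<^bsub>M\<^esub> ?y \<odot>\<^bsub>M\<^esub> b \<in> N" by (auto simp: lead_def)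
  note [simp] = ee(3)[OF b(1)] pp(3)[OF b(2)]
  have "(f \<oplus>\<^bsub>M\<^esub> g) \<oplus>\<^bsub>M\<^esub> ?y \<odot>\<^bsub>M\<^esub> (a \<oplus>\<^bsub>M\<^esub> b) = (f \<oplus>\<^bsub>M\<^esub> ?y \<odot>\<^bsub>M\<^esub> a) \<oplus>\<^bsub>M\<^esub> (g \<oplus>\<^bsub>M\<^esub> ?y \<odot>\<^bsub>M\<^esub> b)"
    by (simp add: smult_r_distr M.a_ac)
  then show "a \<oplus>\<^bsub>M\<^esub> b \<in> lead n N"
    unfolding lead_def using nn(4)[OF a(3) b(3)] ee(4)[OF a(1) b(1)] pp(4)[OF a(2) b(2)]
    by (intro CollectI conjI bexI[of _ "f \<oplus>\<^bsub>M\<^esub> g"]) simp_all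
qed

lemma lead_mono: "N \<subseteq> N' \<Longrightarrow> lead n N \<subseteq> lead n N'"
  by (auto simp: lead_def)

lemma lead_Suc_mono:
  assumes N: "stable M (insert x X) N" shows "lead n N \<subseteq> lead (Suc n) N"
proof
  fix e assume "e \<in> lead n N"
  then obtain f where e: "e \<in> E" "f \<in> pol n" "f \<oplus>\<^bsub>M\<^esub> (x [^] n) \<odot>\<^bsub>M\<^esub> e \<in> N" by (auto simp: lead_def)
  have c: "e \<in> carrier M" "f \<in> carrier M" using stableD(3)[OF E e(1)] stableD(3)[OF stable_pol e(2)] .
  have "x \<odot>\<^bsub>M\<^esub> f \<oplus>\<^bsub>M\<^esub> (x [^] Suc n) \<odot>\<^bsub>M\<^esub> e = x \<odot>\<^bsub>M\<^esub> (f \<oplus>\<^bsub>M\<^esub> (x [^] n) \<odot>\<^bsub>M\<^esub> e)"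
    using c x by (simp add: smult_r_distr smult_assoc1[symmetric] R.m_comm)
  then have "x \<odot>\<^bsub>M\<^esub> f \<oplus>\<^bsub>M\<^esub> (x [^] Suc n) \<odot>\<^bsub>M\<^esub> e \<in> N" using stableD(7)[OF N _ e(3)] by simp
  then show "e \<in> lead (Suc n) N" using e(1) x_pol[OF e(2)] by (auto simp: lead_def)
qed

text \<open>Subtracting an element of \<open>N\<close> with the same leading coefficient moves an element of \<open>N'\<close>
  to a smaller \<open>pol n\<close> without leaving \<open>N'\<close>.\<close>

lemma eq_if_lead_eq:
  assumes N: "stable M (insert x X) N" and N': "stable M (insert x X) N'" and le: "N \<subseteq> N'"
    and N'le: "N' \<subseteq> (\<Union>n. pol n)" and eq: "\<And>n. lead n N = lead n N'"
  shows "N = N'"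
proof
  have "y \<in> N" if "y \<in> N'" "y \<in> pol n" for y n
    using that
  proof (induction n arbitrary: y)
    case 0
    then show ?case using stableD(2)[OF N] by simp
  next
    case (Suc n)
    then obtain f e where y: "f \<in> pol n" "e \<in> E" "y = f \<oplus>\<^bsub>M\<^esub> (x [^] n) \<odot>\<^bsub>M\<^esub> e"
      by (auto simp: set_add_iff)
    then have "e \<in> lead n N" using Suc.prems(1) eq by (auto simp: lead_def)
    then obtain g where g: "g \<in> pol n" "g \<oplus>\<^bsub>M\<^esub> (x [^] n) \<odot>\<^bsub>M\<^esub> e \<in> N" by (auto simp: lead_def)
    let ?z = "g \<oplus>\<^bsub>M\<^esub> (x [^] n) \<odot>\<^bsub>M\<^esub> e"
    note [simp] = stableD(3)[OF E y(2)] stableD(3)[OF stable_pol y(1)] stableD(3)[OF stable_pol g(1)] pow_closed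
    have yz: "y \<ominus>\<^bsub>M\<^esub> ?z = f \<ominus>\<^bsub>M\<^esub> g" "y = (y \<ominus>\<^bsub>M\<^esub> ?z) \<oplus>\<^bsub>M\<^esub> ?z"
      using y(3) by (simp_all add: M.minus_eq M.minus_add M.a_ac M.r_neg M.r_neg1 M.r_neg2 M.l_neg)
    have "?z \<in> N'" using g(2) le by blast
    then have "y \<ominus>\<^bsub>M\<^esub> ?z \<in> N'" using stableD(6)[OF N' Suc.prems(1)] by blast
    moreover have "y \<ominus>\<^bsub>M\<^esub> ?z \<in> pol n" unfolding yz(1) using stableD(6)[OF stable_pol y(1) g(1)] .
    ultimately have "y \<ominus>\<^bsub>M\<^esub> ?z \<in> N" by (rule Suc.IH)
    then show ?case using yz(2) stableD(4)[OF N _ g(2)] by metis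
  qed
  then show "N' \<subseteq> N" using N'le by blast
qed (rule le)

text \<open>The groups \<open>lead n (f m)\<close> increase in both \<open>n\<close> and \<open>m\<close>. Once the diagonal is constant from
  \<open>p\<close> on, so are all of them with \<open>n, m \<ge> p\<close>, and the finitely many rows \<open>n < p\<close> become
  constant separately.\<close>

lemma acc_Union_pol: "acc M (insert x X) (\<Union>n. pol n)"
  unfolding acc_def
proof (intro allI impI)
  fix f :: "nat \<Rightarrow> 'c set"
  assume f: "\<forall>n. stable M (insert x X) (f n) \<and> f n \<subseteq> (\<Union>n. pol n) \<and> f n \<subseteq> f (Suc n)"
  have fs: "stable M (insert x X) (f m)" for m using f by blast
  have f_mono: "f m \<subseteq> f n" if "m \<le> n" for m n using lift_Suc_mono_le[of f m n] f that by blast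
  have stab: "\<exists>q. \<forall>m\<ge>q. g m = g q" if "\<And>n. stable M X (g n)" "\<And>n. g n \<subseteq> E" "\<And>n. g n \<subseteq> g (Suc n)"
    for g :: "nat \<Rightarrow> 'c set"
    using accE that unfolding acc_def by blast
  have lE: "lead n N \<subseteq> E" for n N by (auto simp: lead_def)
  have lmono: "lead m (f p) \<subseteq> lead n (f q)" if "m \<le> n" "p \<le> q" for m n p q
    using lift_Suc_mono_le[of "\<lambda>n. lead n (f p)" m n] lead_Suc_mono[OF fs] lead_mono[OF f_mono[OF that(2)]] that(1)
    by blast
  have "\<exists>q. \<forall>m\<ge>q. lead m (f m) = lead q (f q)"
    by (rule stab) (use stable_lead[OF fs] lE lmono in auto)
  then obtain p where p: "\<And>m. m \<ge> p \<Longrightarrow> lead m (f m) = lead p (f p)" by blast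
  have "\<exists>q. \<forall>m\<ge>q. lead n (f m) = lead n (f q)" for n
    by (rule stab) (use stable_lead[OF fs] lE lmono[OF order_refl le_SucI[OF order_refl]] in auto)
  then obtain q where q: "\<And>n m. m \<ge> q n \<Longrightarrow> lead n (f m) = lead n (f (q n))" by metis
  define b where "b = Max (insert p (q ` {..p}))"
  have bp: "p \<le> b" unfolding b_def by (rule Max_ge) auto
  have bq: "q n \<le> b" if "n \<le> p" for n unfolding b_def using that by (intro Max_ge) auto
  have "f m = f b" if m: "m \<ge> b" for m
  proof (rule eq_if_lead_eq[OF fs fs f_mono[OF m], symmetric])
    show "f m \<subseteq> (\<Union>n. pol n)" using f by blast
    show "lead n (f b) = lead n (f m)" for n
    proof (cases "n \<le> p")
      case True
      then show ?thesis using q[of n b] q[of n m] bq[of n] m by simp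
    next
      case False
      have up: "lead n (f k) = lead p (f p)" if k: "p \<le> k" for k
      proof
        show "lead p (f p) \<subseteq> lead n (f k)" using lmono[of p n p k] False k by simp
        have "lead n (f k) \<subseteq> lead (max n k) (f (max n k))" by (rule lmono) auto
        then show "lead n (f k) \<subseteq> lead p (f p)" using p[of "max n k"] k by auto
      qed
      show ?thesis using up[OF bp] up[of m] bp m by simp
    qed
  qed
  then show "\<exists>n. \<forall>m\<ge>n. f m = f n" by blast
qed

end

context module
begin

lemma acc_adjoin_finite:
  assumes T: "finite T" "T \<subseteq> carrier R" and X: "X \<subseteq> carrier R" and E: "stable M X E" "acc M X E"
  shows "\<exists>G. E \<subseteq> G \<and> stable M (X \<union> T) G \<and> acc M (X \<union> T) G"
  using T
proof (induction T rule: finite_induct)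
  case empty
  then show ?case using E by auto
next
  case (insert x T)
  then obtain G where G: "E \<subseteq> G" "stable M (X \<union> T) G" "acc M (X \<union> T) G" by auto
  have s: "adjoin_operator R M (X \<union> T) x G"
    using G insert.prems X by unfold_locales auto
  show ?case
    using adjoin_operator.stable_Union_pol[OF s] adjoin_operator.acc_Union_pol[OF s]
      adjoin_operator.E_le_Union_pol[OF s] G(1)
    by (intro exI[of _ "\<Union>n. adjoin_operator.pol R M x G n"]) auto
qed

lemma stable_generate_ring:
  assumes X: "X \<subseteq> carrier R" and G: "stable M X G"
  shows "stable M (generate_ring R X) G"
proof (rule stableI)
  note g = stableD[OF G]
  show "G \<subseteq> carrier M" "\<zero>\<^bsub>M\<^esub> \<in> G" "\<And>x. x \<in> G \<Longrightarrow> \<ominus>\<^bsub>M\<^esub> x \<in> G"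
    "\<And>x y. x \<in> G \<Longrightarrow> y \<in> G \<Longrightarrow> x \<oplus>\<^bsub>M\<^esub> y \<in> G" using g(1,2,4,5) by auto
  fix a m assume "a \<in> generate_ring R X" and m: "m \<in> G"
  then have "a \<in> carrier R \<and> (\<forall>m\<in>G. a \<odot>\<^bsub>M\<^esub> m \<in> G)"
  proof (induction rule: generate_ring.induct)
    case one then show ?case using g(3) by auto
  next
    case (incl h) then show ?case using g(7) X by auto
  next
    case (a_inv h) then show ?case using g(3,5) by (auto simp: smult_l_minus)
  next
    case (eng_add h1 h2) then show ?case using g(3,4) by (auto simp: smult_l_distr)
  next
    case (eng_mult h1 h2) then show ?case using g(3) by (auto simp: smult_assoc1)
  qed
  then show "a \<odot>\<^bsub>M\<^esub> m \<in> G" using m by blast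
qed

lemma submodule_iff_stable: "submodule N R M \<longleftrightarrow> stable M (carrier R) N"
  unfolding submodule_def submodule_axioms_def stable_def additive_subgroup_def by auto

text \<open>Adjoining the operators \<open>T\<close> one by one turns \<open>E\<close> into a submodule, which is everything
  because \<open>E\<close> spans.\<close>

lemma acc_of_finitely_generated:
  assumes X: "X \<subseteq> carrier R" and T: "finite T" "T \<subseteq> carrier R"
    and gen: "generate_ring R (X \<union> T) = carrier R"
    and E: "stable M X E" "acc M X E" and span: "span R M E = carrier M"
  shows "acc M (carrier R) (carrier M)"
proof -
  obtain G where G: "E \<subseteq> G" "stable M (X \<union> T) G" "acc M (X \<union> T) G"
    using acc_adjoin_finite[OF T X E] by blast
  have "stable M (carrier R) G" using stable_generate_ring[OF _ G(2)] X T gen by auto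
  then have "span R M E \<subseteq> G"
    unfolding span_def submodule_iff_stable by (intro hull_minimal G(1))
  then have "G = carrier M" using span stableD(1)[OF G(2)] by auto
  then show ?thesis
    using G(3) X T stable_mono unfolding acc_def by (metis Un_subset_iff)
qed

end

section \<open>Artinian rings have finite length\<close>

text \<open>The ring as a module over itself, through which statements about stable subgroups apply to
  ideals.\<close>

definition ring_module :: "('a, 'c) ring_scheme \<Rightarrow> ('a, 'a) module" where
  "ring_module R = \<lparr>carrier = carrier R, monoid.mult = monoid.mult R, one = one R, zero = zero R, add = add R,
     smult = monoid.mult R\<rparr>"

lemma ring_module_simps [simp]:
  "carrier (ring_module R) = carrier R" "zero (ring_module R) = zero R"
  "add (ring_module R) = add R" "smult (ring_module R) = monoid.mult R" "a_inv (ring_module R) = a_inv R"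
  "a_minus (ring_module R) = a_minus R"
  by (auto simp: ring_module_def a_inv_def fun_eq_iff a_minus_def m_inv_def)

lemma (in cring) module_ring_module: "module R (ring_module R)"
  by (rule moduleI[OF is_cring])
    (auto simp: m_assoc l_distr r_distr intro!: abelian_groupI a_assoc a_comm l_neg exI[of _ "\<ominus> _"])

lemma (in cring) ideal_iff_stable: "ideal I R \<longleftrightarrow> stable (ring_module R) (carrier R) I"
proof
  assume "ideal I R"
  then interpret ideal I R .
  show "stable (ring_module R) (carrier R) I"
    by (rule module.stableI[OF module_ring_module]) (use a_subset I_l_closed in auto)
next
  assume s: "stable (ring_module R) (carrier R) I"
  note d = module.stableD[OF module_ring_module s, simplified]
  show "ideal I R"
  proof (intro idealI ring_axioms subgroup.intro)
    show "a \<otimes> x \<in> I" if "a \<in> I" "x \<in> carrier R" for a x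
      using d(3)[OF that(1)] d(7)[OF that(2,1)] that m_comm by simp
  qed (use d in \<open>auto simp: a_inv_def[symmetric]\<close>)
qed

locale artinian_ring = cring R for R (structure) +
  assumes artinian_R: "artinian R"
begin

abbreviation "ideals I \<equiv> stable (ring_module R) (carrier R) I"
abbreviation "finlen I \<equiv> fin_len (ring_module R) (carrier R) {\<zero>} I"

sublocale self: module R "ring_module R"
  by (rule module_ring_module)

lemma dcc:
  assumes "\<And>n. ideals (f n)" "\<And>n. f (Suc n) \<subseteq> f n"
  shows "\<exists>n::nat. f (Suc n) = f n"
proof -
  have "\<forall>n. ideal (f n) R \<and> f (Suc n) \<subseteq> f n" using assms by (simp add: ideal_iff_stable)
  then obtain n where "\<forall>m\<ge>n. f m = f n"
    using artinian_R unfolding artinian_def by meson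
  then show ?thesis by (metis le_SucI order_refl)
qed

text \<open>The ideals \<open>a\<^sup>n R\<close> become stationary, so \<open>a\<^sup>n (1 - a c) = 0\<close> for some \<open>n\<close> and \<open>c\<close>.\<close>

lemma artinian_prime_maximal:
  assumes P: "ideals P" and prime: "\<And>a b. a \<in> carrier R \<Longrightarrow> b \<in> carrier R \<Longrightarrow> a \<otimes> b \<in> P \<Longrightarrow> a \<in> P \<or> b \<in> P"
    and a: "a \<in> carrier R" "a \<notin> P"
  shows "\<exists>c\<in>carrier R. \<one> \<ominus> a \<otimes> c \<in> P"
proof -
  let ?I = "\<lambda>n::nat. (\<lambda>c. (a [^] n) \<otimes> c) ` carrier R"
  note p = self.stableD[OF P, simplified]
  have "ideals (?I n)" for n
    using self.stable_smult_image[OF subset_refl _ self.stable_carrier[OF subset_refl], of "a [^] n"] a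
    by simp
  moreover have "?I (Suc n) \<subseteq> ?I n" for n
    using a by (auto simp: m_assoc intro!: imageI)
  ultimately obtain n where "?I (Suc n) = ?I n"
    using dcc[of ?I] by blast
  moreover have "a [^] n \<in> ?I n" using a by (auto intro!: image_eqI[of _ _ \<one>])
  ultimately obtain c where c: "c \<in> carrier R" "a [^] n = (a [^] Suc n) \<otimes> c" by auto
  have pw: "a [^] (k::nat) \<notin> P" for k
  proof (induction k)
    case 0
    then show ?case using p(7)[of a \<one>] a by auto
  next
    case (Suc k)
    then show ?case using prime[of "a [^] k" a] a by auto
  qed
  have "(a [^] n) \<otimes> (\<one> \<ominus> a \<otimes> c) = (a [^] n) \<ominus> (a [^] Suc n) \<otimes> c"
    using a c(1) by (simp add: minus_eq r_distr r_minus m_assoc)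
  also have "\<dots> = \<zero>" using a c(1) by (subst c(2)) (simp add: minus_eq r_neg)
  finally have "(a [^] n) \<otimes> (\<one> \<ominus> a \<otimes> c) \<in> P" using p(2) by simp
  then show ?thesis using prime[of "a [^] n" "\<one> \<ominus> a \<otimes> c"] pw a c(1) by auto
qed

lemma minimal_infinite_length:
  assumes "\<not> finlen (carrier R)"
  shows "\<exists>I. ideals I \<and> \<not> finlen I \<and> (\<forall>J. ideals J \<longrightarrow> J \<subset> I \<longrightarrow> finlen J)"
proof (rule ccontr)
  assume "\<not> ?thesis"
  then have step: "\<exists>J. (ideals J \<and> \<not> finlen J) \<and> J \<subset> I" if "ideals I \<and> \<not> finlen I" for I
    using that by blast
  have "\<exists>f :: nat \<Rightarrow> 'a set. \<forall>n. (ideals (f n) \<and> \<not> finlen (f n)) \<and> f (Suc n) \<subset> f n"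
    by (rule dependent_nat_choice) (use assms self.stable_carrier step in auto)
  then obtain f :: "nat \<Rightarrow> 'a set" where f: "\<And>n. ideals (f n)" "\<And>n. f (Suc n) \<subset> f n" by blast
  then obtain n where "f (Suc n) = f n" using dcc[of f] by blast
  then show False using f(2)[of n] by simp
qed

text \<open>A minimal ideal \<open>I\<close> of infinite length is either fixed or killed by each ring element: the
  image and the kernel of multiplication by \<open>a\<close> on \<open>I\<close> cannot both be smaller than \<open>I\<close>. So its
  annihilator is prime, hence maximal, and \<open>I\<close> is a vector space whose proper subspaces have finite
  dimension; but a hyperplane of \<open>I\<close> has colength one.\<close>

theorem artinian_finite_length: "finlen (carrier R)"
proof (rule ccontr)
  assume "\<not> finlen (carrier R)"
  then obtain I where I: "ideals I" "\<not> finlen I" and min: "\<And>J. ideals J \<Longrightarrow> J \<subset> I \<Longrightarrow> finlen J"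
    using minimal_infinite_length by blast
  note i = self.stableD[OF I(1), simplified]
  have fix_or_kill: "(\<otimes>) a ` I = I \<or> (\<forall>i\<in>I. a \<otimes> i = \<zero>)" if a: "a \<in> carrier R" for a
  proof (rule ccontr)
    assume no: "\<not> ((\<otimes>) a ` I = I \<or> (\<forall>i\<in>I. a \<otimes> i = \<zero>))"
    have s: "ideals ((\<otimes>) a ` I)"
      using self.stable_smult_image[OF subset_refl a I(1)] by simp
    have "(\<otimes>) a ` I \<subset> I" using no i(7)[OF a] by auto
    then have f1: "finlen ((\<otimes>) a ` I)" by (rule min[OF s])
    define K where "K = {y \<in> I. a \<otimes> y = \<zero>}"
    have sK: "ideals K"
      unfolding K_def using i a
      by (intro self.stableI) (auto simp: r_distr r_minus m_lcomm)
    have "K \<subset> I" using no by (auto simp: K_def)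
    then have f2: "finlen K" by (rule min[OF sK])
    have "fin_len (ring_module R) (carrier R) K I"
    proof (rule fin_len_map[OF f1, of _ _ _ _ "image ((\<otimes>) a)"])
      fix H assume "H \<in> between (ring_module R) (carrier R) K I"
      then have H: "ideals H" "H \<subseteq> I" by (auto simp: between_def)
      show "(\<otimes>) a ` H \<in> between (ring_module R) (carrier R) {\<zero>} ((\<otimes>) a ` I)"
      proof -
        have "ideals ((\<otimes>) a ` H)" using self.stable_smult_image[OF subset_refl a H(1)] by simp
        moreover from this have "\<zero> \<in> (\<otimes>) a ` H" using self.stableD(2) by fastforce
        ultimately show ?thesis using H(2) by (auto simp: between_def)
      qed
    next
      fix H H'
      assume "H \<in> between (ring_module R) (carrier R) K I" "H' \<in> between (ring_module R) (carrier R) K I"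
        and lt: "H \<subset> H'"
      then have H: "ideals H" "K \<subseteq> H" "ideals H'" "H' \<subseteq> I" by (auto simp: between_def)
      note h = self.stableD[OF H(1), simplified]
      obtain y where y: "y \<in> H'" "y \<notin> H" using lt by blast
      have "a \<otimes> y \<notin> (\<otimes>) a ` H"
      proof
        assume "a \<otimes> y \<in> (\<otimes>) a ` H"
        then obtain z where z: "z \<in> H" "a \<otimes> y = a \<otimes> z" by auto
        have c: "y \<in> carrier R" "z \<in> carrier R" using y z H(4) i(3) h(3) by auto
        have "a \<otimes> (y \<ominus> z) = \<zero>" using z(2) c a by (simp add: minus_eq r_distr r_minus r_neg)
        moreover have "y \<ominus> z \<in> I" using i(6) y(1) z(1) H(4) lt by blast
        ultimately have "y \<ominus> z \<in> H" using H(2) by (auto simp: K_def)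
        then have "(y \<ominus> z) \<oplus> z \<in> H" using h(4) z(1) by blast
        then show False using y(2) c by (simp add: minus_eq a_assoc l_neg)
      qed
      then show "(\<otimes>) a ` H \<subset> (\<otimes>) a ` H'" using y(1) lt by blast
    qed
    then have "finlen I"
      using self.fin_len_trans[OF subset_refl sK _ _ I(1) f2] \<open>K \<subset> I\<close> self.stableD(2)[OF sK] by auto
    then show False using I(2) by simp
  qed
  have Inz: "I \<noteq> {\<zero>}" using I(2) fin_len_self[OF I(1)] by auto
  define P where "P = {a \<in> carrier R. \<forall>i\<in>I. a \<otimes> i = \<zero>}"
  have sP: "ideals P"
    unfolding P_def using i(3) by (intro self.stableI) (auto simp: l_distr l_minus m_assoc)
  have prime: "a \<in> P \<or> b \<in> P" if ab: "a \<in> carrier R" "b \<in> carrier R" "a \<otimes> b \<in> P" for a b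
  proof (rule ccontr)
    assume "\<not> (a \<in> P \<or> b \<in> P)"
    then have e: "(\<otimes>) a ` I = I" "(\<otimes>) b ` I = I" using fix_or_kill ab by (auto simp: P_def)
    have "y = \<zero>" if "y \<in> I" for y
    proof -
      obtain u where u: "u \<in> I" "y = a \<otimes> u" using e(1) \<open>y \<in> I\<close> by auto
      obtain v where v: "v \<in> I" "u = b \<otimes> v" using e(2) u(1) by auto
      have "y = (a \<otimes> b) \<otimes> v" using u v ab i(3) by (simp add: m_assoc)
      then show ?thesis using ab(3) v(1) by (simp add: P_def)
    qed
    then show False using Inz i(2) by blast
  qed
  obtain x where x: "x \<in> I" "x \<noteq> \<zero>" using Inz i(2) by blast
  define Z where "Z = {J. ideals J \<and> J \<subseteq> I \<and> x \<notin> J}"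
  \<comment> \<open>The hyperplane is an ideal in \<open>I\<close> that is maximal among those that do not contain the
    nonzero vector \<open>x\<close>.\<close>
  have "\<exists>J\<in>Z. \<forall>H\<in>Z. J \<subseteq> H \<longrightarrow> H = J"
  proof (rule subset_Zorn_nonempty)
    have "{\<zero>} \<in> Z" using self.stable_zero[OF subset_refl] x i(2) by (auto simp: Z_def)
    then show "Z \<noteq> {}" by blast
    fix C assume C: "C \<noteq> {}" "subset.chain Z C"
    then have CZ: "ideals H" "H \<subseteq> I" "x \<notin> H" if "H \<in> C" for H
      using that by (auto simp: Z_def subset.chain_def)
    have tot: "H \<subseteq> K \<or> K \<subseteq> H" if "H \<in> C" "K \<in> C" for H K
      using C(2) that by (auto simp: subset.chain_def)
    have "ideals (\<Union>C)"
    proof (rule self.stableI)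
      show "\<Union>C \<subseteq> carrier (ring_module R)" using CZ(2) i(1) by auto
      show "\<zero>\<^bsub>ring_module R\<^esub> \<in> \<Union>C" using C(1) CZ(1) self.stableD(2) by fastforce
      fix u assume "u \<in> \<Union>C"
      then obtain H where H: "H \<in> C" "u \<in> H" by auto
      show "\<ominus>\<^bsub>ring_module R\<^esub> u \<in> \<Union>C" using self.stableD(5)[OF CZ(1)[OF H(1)] H(2)] H(1) by blast
      show "c \<odot>\<^bsub>ring_module R\<^esub> u \<in> \<Union>C" if "c \<in> carrier R" for c
        using self.stableD(7)[OF CZ(1)[OF H(1)] that H(2)] H(1) by blast
      fix v assume "v \<in> \<Union>C"
      then obtain K where K: "K \<in> C" "v \<in> K" by auto
      then show "u \<oplus>\<^bsub>ring_module R\<^esub> v \<in> \<Union>C"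
        using tot[OF H(1) K(1)] H self.stableD(4)[OF CZ(1)[OF H(1)]] self.stableD(4)[OF CZ(1)[OF K(1)]]
        by blast
    qed
    then show "\<Union>C \<in> Z" using CZ(2,3) by (auto simp: Z_def)
  qed
  then obtain J where J: "ideals J" "J \<subseteq> I" "x \<notin> J" and max: "\<And>H. H \<in> Z \<Longrightarrow> J \<subseteq> H \<Longrightarrow> H = J"
    by (auto simp: Z_def)
  note j = self.stableD[OF J(1), simplified]
  have "finlen J" using min[OF J(1)] J x(1) by blast
  \<comment> \<open>An ideal strictly above \<open>J\<close> contains \<open>x\<close>. Modulo \<open>J\<close>, each \<open>y\<close> outside has a multiple
    equal to \<open>x\<close>, and the multiplier is invertible modulo the annihilator \<open>P\<close>, so \<open>y\<close> is
    a multiple of \<open>x\<close>.\<close>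
  have two: "H = J \<or> H = I" if "H \<in> between (ring_module R) (carrier R) J I" for H
  proof -
    have H: "ideals H" "J \<subseteq> H" "H \<subseteq> I" using that by (auto simp: between_def)
    note h = self.stableD[OF H(1), simplified]
    have "y \<in> H" if y: "y \<in> I" and ne: "H \<noteq> J" for y
    proof (rule ccontr)
      assume yH: "y \<notin> H"
      have xH: "x \<in> H" using max[of H] H ne by (auto simp: Z_def)
      let ?C = "(\<lambda>c. y \<otimes> c) ` carrier R"
      have yc: "y \<in> carrier R" using y i(3) by auto
      have sC: "ideals ?C"
        using self.stable_smult_image[OF subset_refl yc self.stable_carrier[OF subset_refl]] by simp
      let ?L = "J <+>\<^bsub>ring_module R\<^esub> ?C"
      have sL: "ideals ?L" by (rule self.stable_add[OF subset_refl J(1) sC])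
      have JL: "J \<subseteq> ?L" and CL: "?C \<subseteq> ?L" using self.set_add_ge1[OF J(1) sC] self.set_add_ge2[OF J(1) sC] .
      have "y \<in> ?C" using yc by (auto intro!: image_eqI[of _ _ \<one>])
      then have "y \<in> ?L" using CL by blast
      then have "?L \<noteq> J" using yH H(2) by blast
      moreover have "?L \<subseteq> I"
      proof (rule self.set_add_le[OF I(1) J(2)])
        show "?C \<subseteq> I" using i(7)[OF _ y] yc by (auto simp: m_comm[of y])
      qed
      ultimately have "x \<in> ?L" using max[of ?L] sL JL by (auto simp: Z_def)
      then obtain u a where u: "u \<in> J" "a \<in> carrier R" "x = u \<oplus> y \<otimes> a" by (auto simp: set_add_iff)
      have "a \<notin> P"
      proof
        assume "a \<in> P"
        then have "y \<otimes> a = \<zero>" using y m_comm[OF yc u(2)] by (simp add: P_def)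
        then show False using u J(3) j(3) by simp
      qed
      then obtain c where c: "c \<in> carrier R" "\<one> \<ominus> a \<otimes> c \<in> P"
        using artinian_prime_maximal[OF sP prime] u(2) by blast
      have "(\<one> \<ominus> a \<otimes> c) \<otimes> y = \<zero>" using c(2) y by (simp add: P_def)
      moreover have "(\<one> \<ominus> a \<otimes> c) \<otimes> y = y \<ominus> c \<otimes> (y \<otimes> a)"
        using c(1) u(2) yc by (simp add: minus_eq l_distr l_minus m_assoc) (simp add: m_lcomm m_comm)
      ultimately have "y = c \<otimes> (y \<otimes> a)"
        using c(1) u(2) yc by (simp add: minus_eq) (metis m_closed add.inv_equality minus_minus a_inv_closed)
      moreover have "y \<otimes> a = x \<ominus> u"
        using u yc j(3)[OF u(1)] by (simp add: minus_eq a_comm[of u] a_assoc r_neg)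
      ultimately have "y = c \<otimes> (x \<ominus> u)" by simp
      moreover have "x \<ominus> u \<in> H" using h(6) xH u(1) H(2) by blast
      ultimately have "y \<in> H" using h(7)[OF c(1)] by metis
      then show False using yH by simp
    qed
    then show ?thesis using H by blast
  qed
  have "n \<le> 1" if n_in: "n \<in> chain_lengths (between (ring_module R) (carrier R) J I)" for n
  proof (rule ccontr)
    assume n: "\<not> n \<le> 1"
    obtain W :: "nat \<Rightarrow> 'a set" where W: "\<forall>i\<le>n. W i \<in> between (ring_module R) (carrier R) J I" "\<forall>i<n. W i \<subset> W (Suc i)"
      using n_in by (auto simp: chain_lengths_def)
    have "W 0 \<subset> W 1" "W 1 \<subset> W 2" using W(2) n by (auto simp: numeral_2_eq_2)
    moreover have "W 0 = J \<or> W 0 = I" "W 1 = J \<or> W 1 = I" "W 2 = J \<or> W 2 = I" using W(1) n two by auto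
    ultimately show False using J(2) by auto
  qed
  then have "fin_len (ring_module R) (carrier R) J I"
    unfolding fin_len_def finite_nat_set_iff_bounded_le by blast
  then have "finlen I"
    using self.fin_len_trans[OF subset_refl J(1) _ J(2) I(1) \<open>finlen J\<close>] j(2) by auto
  then show False using I(2) by simp
qed

end

text \<open>A prime of an Artinian local ring is the maximal ideal, so it contains no difference of
  representatives of distinct residue classes.\<close>

lemma (in artinian_local_ring) infinite_separated_set:
  assumes inf: "infinite (carrier (A Quot \<mm>))"
  obtains B where "infinite B" "B \<subseteq> carrier A"
    "\<And>P a b. \<lbrakk>ideal P A; \<one> \<notin> P; \<And>a b. \<lbrakk>a \<in> carrier A; b \<in> carrier A; a \<otimes> b \<in> P\<rbrakk> \<Longrightarrow> a \<in> P \<or> b \<in> P;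
      a \<in> B; b \<in> B; a \<noteq> b\<rbrakk> \<Longrightarrow> a \<ominus> b \<notin> P"
proof -
  interpret art: artinian_ring A by unfold_locales (rule artinian)
  interpret m: maximalideal \<mm> A by (rule maximal)
  have "\<exists>a. a \<in> carrier A \<and> T = \<mm> +> a" if "T \<in> carrier (A Quot \<mm>)" for T
    using that by (auto simp: FactRing_def A_RCOSETS_def')
  then obtain r where r: "\<And>T. T \<in> carrier (A Quot \<mm>) \<Longrightarrow> r T \<in> carrier A \<and> T = \<mm> +> r T" by metis
  let ?B = "r ` carrier (A Quot \<mm>)"
  have "inj_on r (carrier (A Quot \<mm>))" using r by (metis inj_onI)
  then have "infinite ?B" using inf finite_imageD by blast
  moreover have "?B \<subseteq> carrier A" using r by auto
  moreover have "a \<ominus> b \<notin> P" if P: "ideal P A" "\<one> \<notin> P"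
    "\<And>a b. \<lbrakk>a \<in> carrier A; b \<in> carrier A; a \<otimes> b \<in> P\<rbrakk> \<Longrightarrow> a \<in> P \<or> b \<in> P"
    and ab: "a \<in> ?B" "b \<in> ?B" "a \<noteq> b" for P a b
  proof -
    interpret P: ideal P A by (rule P(1))
    have "maximalideal P A"
    proof (intro maximalideal.intro maximalideal_axioms.intro P(1))
      show "carrier A \<noteq> P" using P(2) by auto
      fix J assume J: "ideal J A" "P \<subseteq> J" "J \<subseteq> carrier A"
      interpret J: ideal J A by (rule J(1))
      show "J = P \<or> J = carrier A"
      proof (rule ccontr)
        assume no: "\<not> (J = P \<or> J = carrier A)"
        then obtain a where a: "a \<in> J" "a \<notin> P" using J(2) by blast
        then have ac: "a \<in> carrier A" using J(3) by auto
        obtain c where c: "c \<in> carrier A" "\<one> \<ominus> a \<otimes> c \<in> P"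
          using art.artinian_prime_maximal[OF P(1)[unfolded ideal_iff_stable] P(3) ac a(2)] by blast
        have "(\<one> \<ominus> a \<otimes> c) \<oplus> a \<otimes> c \<in> J" using c J(2) J.I_r_closed[OF a(1) c(1)] by auto
        moreover have "(\<one> \<ominus> a \<otimes> c) \<oplus> a \<otimes> c = \<one>" using c(1) ac by (simp add: minus_eq a_assoc l_neg)
        ultimately have "\<one> \<in> J" by simp
        then have "J = carrier A" using J.one_imp_carrier by simp
        then show False using no by simp
      qed
    qed
    then have Pm: "P = \<mm>" by (rule unique_maximal)
    have c: "a \<in> carrier A" "b \<in> carrier A" using ab r by auto
    show ?thesis
    proof
      assume "a \<ominus> b \<in> P"
      then have "a \<ominus> b \<in> \<mm>" using Pm by simp
      then have "\<mm> +> a = \<mm> +> b"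
        using c m.a_rcos_const[of "a \<ominus> b"] a_coset_add_inv1[of \<mm> a b] m.a_subset by (simp add: minus_eq)
      moreover obtain T U where "T \<in> carrier (A Quot \<mm>)" "a = r T" "U \<in> carrier (A Quot \<mm>)" "b = r U" using ab by auto
      ultimately show False using r ab(3) by metis
    qed
  qed
  ultimately show thesis by (rule that)
qed

section \<open>Finite length over the coefficient ring\<close>

context module
begin

lemma stable_cyclic:
  assumes h: "ring_hom_cring A R h" and m: "m \<in> carrier M"
  shows "stable M (h ` carrier A) ((\<lambda>a. h a \<odot>\<^bsub>M\<^esub> m) ` carrier A)"
proof (rule stableI)
  interpret h: ring_hom_cring A R h by (rule h)
  show "(\<lambda>a. h a \<odot>\<^bsub>M\<^esub> m) ` carrier A \<subseteq> carrier M" using m by auto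
  show "\<zero>\<^bsub>M\<^esub> \<in> (\<lambda>a. h a \<odot>\<^bsub>M\<^esub> m) ` carrier A" using m by (auto intro!: image_eqI[of _ _ "\<zero>\<^bsub>A\<^esub>"])
  fix x assume "x \<in> (\<lambda>a. h a \<odot>\<^bsub>M\<^esub> m) ` carrier A"
  then obtain a where a: "a \<in> carrier A" "x = h a \<odot>\<^bsub>M\<^esub> m" by auto
  show "\<ominus>\<^bsub>M\<^esub> x \<in> (\<lambda>a. h a \<odot>\<^bsub>M\<^esub> m) ` carrier A"
    using a m by (auto intro!: image_eqI[of _ _ "\<ominus>\<^bsub>A\<^esub> a"] simp: smult_l_minus)
  show "c \<odot>\<^bsub>M\<^esub> x \<in> (\<lambda>a. h a \<odot>\<^bsub>M\<^esub> m) ` carrier A" if c: "c \<in> h ` carrier A" for c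
  proof -
    obtain b where b: "b \<in> carrier A" "c = h b" using c by auto
    then show ?thesis using a m by (auto intro!: image_eqI[of _ _ "b \<otimes>\<^bsub>A\<^esub> a"] simp: smult_assoc1)
  qed
  fix y assume "y \<in> (\<lambda>a. h a \<odot>\<^bsub>M\<^esub> m) ` carrier A"
  then obtain b where b: "b \<in> carrier A" "y = h b \<odot>\<^bsub>M\<^esub> m" by auto
  show "x \<oplus>\<^bsub>M\<^esub> y \<in> (\<lambda>a. h a \<odot>\<^bsub>M\<^esub> m) ` carrier A"
    using a b m by (auto intro!: image_eqI[of _ _ "a \<oplus>\<^bsub>A\<^esub> b"] simp: smult_l_distr)
qed

text \<open>Pulling stable subgroups above \<open>H\<close> back along \<open>a \<mapsto> h a \<cdot> m\<close> is strictly monotone, so the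
  length over \<open>H\<close> is at most that of the coefficient ring.\<close>

lemma fin_len_adjoin:
  assumes h: "ring_hom_cring A R h" and A: "fin_len (ring_module A) (carrier A) {\<zero>\<^bsub>A\<^esub>} (carrier A)"
    and H: "stable M (h ` carrier A) H" and m: "m \<in> carrier M"
  shows "fin_len M (h ` carrier A) H (H <+>\<^bsub>M\<^esub> (\<lambda>a. h a \<odot>\<^bsub>M\<^esub> m) ` carrier A)"
proof (rule fin_len_map[OF A, of _ _ _ _ "\<lambda>K. {a \<in> carrier A. h a \<odot>\<^bsub>M\<^esub> m \<in> K}"])
  interpret h: ring_hom_cring A R h by (rule h)
  interpret As: module A "ring_module A" by (rule h.R.module_ring_module)
  fix K assume "K \<in> between M (h ` carrier A) H (H <+>\<^bsub>M\<^esub> (\<lambda>a. h a \<odot>\<^bsub>M\<^esub> m) ` carrier A)"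
  then have K: "stable M (h ` carrier A) K" by (auto simp: between_def)
  note k = stableD[OF K]
  have "stable (ring_module A) (carrier A) {a \<in> carrier A. h a \<odot>\<^bsub>M\<^esub> m \<in> K}"
    by (rule As.stableI) (use k m in \<open>auto simp: smult_l_distr smult_l_minus smult_assoc1\<close>)
  then show "{a \<in> carrier A. h a \<odot>\<^bsub>M\<^esub> m \<in> K} \<in> between (ring_module A) (carrier A) {\<zero>\<^bsub>A\<^esub>} (carrier A)"
    using As.stableD(2) by (fastforce simp: between_def)
next
  fix K L assume KL: "K \<in> between M (h ` carrier A) H (H <+>\<^bsub>M\<^esub> (\<lambda>a. h a \<odot>\<^bsub>M\<^esub> m) ` carrier A)"
    "L \<in> between M (h ` carrier A) H (H <+>\<^bsub>M\<^esub> (\<lambda>a. h a \<odot>\<^bsub>M\<^esub> m) ` carrier A)" "K \<subset> L"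
  obtain y where y: "y \<in> L" "y \<notin> K" using KL(3) by blast
  have sK: "stable M (h ` carrier A) K" "H \<subseteq> K" and sL: "stable M (h ` carrier A) L" using KL by (auto simp: between_def)
  have "y \<in> H <+>\<^bsub>M\<^esub> (\<lambda>a. h a \<odot>\<^bsub>M\<^esub> m) ` carrier A" using KL(2) y by (auto simp: between_def)
  then obtain z a where z: "z \<in> H" "a \<in> carrier A" "y = z \<oplus>\<^bsub>M\<^esub> h a \<odot>\<^bsub>M\<^esub> m" by (auto simp: set_add_iff)
  have "h a \<odot>\<^bsub>M\<^esub> m \<notin> K" using y(2) z sK stableD(4)[OF sK(1)] by blast
  moreover have "h a \<odot>\<^bsub>M\<^esub> m \<in> L"
  proof -
    interpret h: ring_hom_cring A R h by (rule h)
    have "z \<in> L" using z(1) sK(2) KL(3) by blast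
    then have "y \<ominus>\<^bsub>M\<^esub> z \<in> L" using stableD(6)[OF sL y(1)] by blast
    moreover have "y \<ominus>\<^bsub>M\<^esub> z = h a \<odot>\<^bsub>M\<^esub> m"
      using z m stableD(3)[OF H z(1)] by (simp add: M.minus_eq M.a_comm[of z] M.a_assoc M.r_neg)
    ultimately show ?thesis by simp
  qed
  ultimately show "{a \<in> carrier A. h a \<odot>\<^bsub>M\<^esub> m \<in> K} \<subset> {a \<in> carrier A. h a \<odot>\<^bsub>M\<^esub> m \<in> L}"
    using z(2) KL(3) by blast
qed

text \<open>The minimality clause keeps the enlarged subgroup inside any given \<open>E\<close> that contains \<open>H\<close>
  and \<open>m\<close>.\<close>

lemma adjoin_element:
  assumes h: "ring_hom_cring A R h" and A: "fin_len (ring_module A) (carrier A) {\<zero>\<^bsub>A\<^esub>} (carrier A)"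
    and H: "stable M (h ` carrier A) H" "fin_len M (h ` carrier A) {\<zero>\<^bsub>M\<^esub>} H" and m: "m \<in> carrier M"
  shows "\<exists>K. stable M (h ` carrier A) K \<and> fin_len M (h ` carrier A) {\<zero>\<^bsub>M\<^esub>} K \<and> H \<subseteq> K \<and> m \<in> K \<and>
    (\<forall>E. stable M (h ` carrier A) E \<longrightarrow> H \<subseteq> E \<longrightarrow> m \<in> E \<longrightarrow> K \<subseteq> E)"
proof -
  interpret h: ring_hom_cring A R h by (rule h)
  have X: "h ` carrier A \<subseteq> carrier R" by auto
  let ?C = "(\<lambda>a. h a \<odot>\<^bsub>M\<^esub> m) ` carrier A"
  have C: "stable M (h ` carrier A) ?C" by (rule stable_cyclic[OF h m])
  let ?K = "H <+>\<^bsub>M\<^esub> ?C"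
  have K: "stable M (h ` carrier A) ?K" by (rule stable_add[OF X H(1) C])
  have le: "H \<subseteq> ?K" "?C \<subseteq> ?K" using set_add_ge1[OF H(1) C] set_add_ge2[OF H(1) C] .
  have "m \<in> ?C" using m by (auto intro!: image_eqI[of _ _ "\<one>\<^bsub>A\<^esub>"])
  then have "m \<in> ?K" using le by blast
  moreover have "fin_len M (h ` carrier A) {\<zero>\<^bsub>M\<^esub>} ?K"
    by (rule fin_len_trans[OF X H(1) _ le(1) K H(2) fin_len_adjoin[OF h A H(1) m]])
      (use stableD(2)[OF H(1)] in auto)
  moreover have "?K \<subseteq> E" if "stable M (h ` carrier A) E" "H \<subseteq> E" "m \<in> E" for E
    by (rule set_add_le[OF that(1,2)]) (use stableD(7)[OF that(1) _ that(3)] in auto)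
  ultimately show ?thesis using K le(1) by blast
qed

lemma fin_len_of_finite:
  assumes h: "ring_hom_cring A R h" and A: "fin_len (ring_module A) (carrier A) {\<zero>\<^bsub>A\<^esub>} (carrier A)"
    and G: "finite G" "G \<subseteq> carrier M"
  shows "\<exists>E. stable M (h ` carrier A) E \<and> fin_len M (h ` carrier A) {\<zero>\<^bsub>M\<^esub>} E \<and> G \<subseteq> E"
  using G
proof (induction G rule: finite_induct)
  case empty
  interpret h: ring_hom_cring A R h by (rule h)
  have "stable M (h ` carrier A) {\<zero>\<^bsub>M\<^esub>}" by (rule stable_zero) auto
  then show ?case using fin_len_self by blast
next
  case (insert m G)
  obtain H where H: "stable M (h ` carrier A) H" "fin_len M (h ` carrier A) {\<zero>\<^bsub>M\<^esub>} H" "G \<subseteq> H"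
    using insert.IH insert.prems by blast
  have "m \<in> carrier M" using insert.prems by simp
  then obtain K where "stable M (h ` carrier A) K" "fin_len M (h ` carrier A) {\<zero>\<^bsub>M\<^esub>} K" "H \<subseteq> K" "m \<in> K"
    using adjoin_element[OF h A H(1,2)] by metis
  then show ?case using H(3) by (intro exI[of _ K]) simp
qed

text \<open>Otherwise adjoining one element at a time would never exhaust \<open>E\<close>.\<close>

lemma fin_len_of_acc:
  assumes h: "ring_hom_cring A R h" and A: "fin_len (ring_module A) (carrier A) {\<zero>\<^bsub>A\<^esub>} (carrier A)"
    and E: "stable M (h ` carrier A) E" "acc M (h ` carrier A) E"
  shows "fin_len M (h ` carrier A) {\<zero>\<^bsub>M\<^esub>} E"
proof (rule ccontr)
  assume no: "\<not> ?thesis"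
  interpret h: ring_hom_cring A R h by (rule h)
  let ?Q = "\<lambda>H. stable M (h ` carrier A) H \<and> fin_len M (h ` carrier A) {\<zero>\<^bsub>M\<^esub>} H \<and> H \<subseteq> E"
  have step: "\<exists>K. ?Q K \<and> H \<subset> K" if Q: "?Q H" for H
  proof -
    have "H \<noteq> E" using Q no by auto
    then obtain m where m: "m \<in> E" "m \<notin> H" using Q by blast
    then have "m \<in> carrier M" using stableD(3)[OF E(1)] by blast
    then obtain K where "stable M (h ` carrier A) K" "fin_len M (h ` carrier A) {\<zero>\<^bsub>M\<^esub>} K" "H \<subseteq> K" "m \<in> K" "K \<subseteq> E"
      using adjoin_element[OF h A, of H m] Q E(1) m by metis
    then show ?thesis using m by blast
  qed
  have z: "stable M (h ` carrier A) {\<zero>\<^bsub>M\<^esub>}" by (rule stable_zero) auto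
  then have "?Q {\<zero>\<^bsub>M\<^esub>}" using fin_len_self[OF z] stableD(2)[OF E(1)] by auto
  then have "\<exists>f :: nat \<Rightarrow> 'c set. \<forall>n. ?Q (f n) \<and> f n \<subset> f (Suc n)"
    by (intro dependent_nat_choice) (use step in blast)+
  then obtain f :: "nat \<Rightarrow> 'c set" where f: "\<forall>n. ?Q (f n) \<and> f n \<subset> f (Suc n)" by blast
  have lt: "f n \<subset> f (Suc n)" for n using f by simp
  then have "f n \<noteq> f (Suc n)" for n by blast
  moreover have "\<exists>n. \<forall>m\<ge>n. f m = f n"
    by (rule accD[OF E(2)]) (use f lt[THEN psubset_imp_subset] in simp_all)
  then obtain n where "f (Suc n) = f n" by (metis le_SucI order_refl)
  ultimately show False by metis
qed

end

section \<open>Gradings by \<open>\<nat>\<^sup>d\<close>\<close>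

text \<open>Unification eta-expands degree variables. The pointwise rules would then rewrite sums and
  differences of degrees underneath the abstraction, and facts about the same degree would
  no longer match.\<close>

declare plus_fun_apply [simp del] zero_fun_apply [simp del] minus_apply [simp del]

lemma deg_add_iff: "(k :: 'd \<Rightarrow> nat) \<le> j \<and> j - k = n \<longleftrightarrow> j = k + n"
  by (auto simp: le_fun_def fun_eq_iff plus_fun_apply minus_apply)
    (metis add_diff_inverse_nat not_le)+

lemma deg_add_diff: "(k :: 'd \<Rightarrow> nat) \<le> j \<Longrightarrow> k + (j - k) = j"
  by (auto simp: le_fun_def fun_eq_iff plus_fun_apply minus_apply)

lemma deg_le_add [simp]: "(k :: 'd \<Rightarrow> nat) \<le> k + n" "(k :: 'd \<Rightarrow> nat) \<le> n + k"
  by (auto simp: le_fun_def plus_fun_apply)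

lemma deg_add_diff_cancel [simp]: "(k :: 'd \<Rightarrow> nat) + n - k = n"
  by (auto simp: fun_eq_iff plus_fun_apply minus_apply)

definition component :: "('a, 'c) ring_scheme \<Rightarrow> (('d \<Rightarrow> nat) \<Rightarrow> 'a set) \<Rightarrow> 'a \<Rightarrow> ('d \<Rightarrow> nat) \<Rightarrow> 'a" where
  "component G \<G> x = (THE f. decomposition G \<G> x f)"

definition graded_subset :: "('a, 'c) ring_scheme \<Rightarrow> (('d \<Rightarrow> nat) \<Rightarrow> 'a set) \<Rightarrow> 'a set \<Rightarrow> bool" where
  "graded_subset G \<G> N \<longleftrightarrow> (\<forall>x\<in>N. \<forall>n. component G \<G> x n \<in> N)"

locale graded_group = abelian_group G for G (structure) +
  fixes \<G> :: "('d \<Rightarrow> nat) \<Rightarrow> 'a set"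
  assumes graded: "direct_sum G \<G>"
begin

abbreviation "cmp \<equiv> component G \<G>"

lemma piece:
  shows "\<G> n \<subseteq> carrier G" "\<zero> \<in> \<G> n" "x \<in> \<G> n \<Longrightarrow> x \<in> carrier G"
    "x \<in> \<G> n \<Longrightarrow> y \<in> \<G> n \<Longrightarrow> x \<oplus> y \<in> \<G> n" "x \<in> \<G> n \<Longrightarrow> \<ominus> x \<in> \<G> n"
    "x \<in> \<G> n \<Longrightarrow> y \<in> \<G> n \<Longrightarrow> x \<ominus> y \<in> \<G> n"
proof -
  interpret additive_subgroup "\<G> n" G using graded by (simp add: direct_sum_def)
  show "\<G> n \<subseteq> carrier G" "\<zero> \<in> \<G> n" "x \<in> \<G> n \<Longrightarrow> x \<in> carrier G"
    "x \<in> \<G> n \<Longrightarrow> y \<in> \<G> n \<Longrightarrow> x \<oplus> y \<in> \<G> n" "x \<in> \<G> n \<Longrightarrow> \<ominus> x \<in> \<G> n"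
    "x \<in> \<G> n \<Longrightarrow> y \<in> \<G> n \<Longrightarrow> x \<ominus> y \<in> \<G> n"
    using a_subset by (auto simp: minus_eq)
qed

lemma decomposition_iff: "x \<in> carrier G \<Longrightarrow> decomposition G \<G> x f \<longleftrightarrow> f = cmp x"
  using graded theI'[of "decomposition G \<G> x"] unfolding direct_sum_def component_def by metis

lemma decomposition_carrier: "decomposition G \<G> x f \<Longrightarrow> x \<in> carrier G"
  unfolding decomposition_def using piece(3) by (auto intro!: finsum_closed)

lemma cmp_in: "x \<in> carrier G \<Longrightarrow> cmp x n \<in> \<G> n"
  using decomposition_iff unfolding decomposition_def by metis

lemma cmp_carrier: "x \<in> carrier G \<Longrightarrow> cmp x n \<in> carrier G"
  using cmp_in piece(3) by metis

lemma finite_support: "x \<in> carrier G \<Longrightarrow> finite {n. cmp x n \<noteq> \<zero>}"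
  using decomposition_iff unfolding decomposition_def by metis

lemma finsum_support:
  assumes "finite F" "\<And>n. f n \<in> carrier G" "\<And>n. n \<notin> F \<Longrightarrow> f n = \<zero>"
  shows "finsum G f {n. f n \<noteq> \<zero>} = finsum G f F"
  by (rule add.finprod_mono_neutral_cong_left) (use assms in auto)

lemma finsum_cmp:
  assumes x: "x \<in> carrier G" and F: "finite F" "{n. cmp x n \<noteq> \<zero>} \<subseteq> F"
  shows "x = (\<Oplus>n\<in>F. cmp x n)"
proof -
  have "decomposition G \<G> x (cmp x)" using decomposition_iff[OF x] by blast
  then have "x = (\<Oplus>n\<in>{n. cmp x n \<noteq> \<zero>}. cmp x n)" unfolding decomposition_def by blast
  also have "\<dots> = (\<Oplus>n\<in>F. cmp x n)"
    using F cmp_carrier[OF x] by (intro finsum_support) auto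
  finally show ?thesis .
qed

lemma cmp_eqI:
  assumes F: "finite F" and f: "\<And>n. f n \<in> \<G> n" "\<And>n. n \<notin> F \<Longrightarrow> f n = \<zero>"
    and x: "x = (\<Oplus>n\<in>F. f n)"
  shows "cmp x = f"
proof -
  have fc: "f n \<in> carrier G" for n using f(1) piece(3) by blast
  have "finite {n. f n \<noteq> \<zero>}" 
    by (rule finite_subset[OF _ F]) (use f(2) in blast)
  then have "decomposition G \<G> x f"
    unfolding decomposition_def using f(1) finsum_support[OF F fc f(2)] x by simp
  then show ?thesis using decomposition_iff decomposition_carrier by metis
qed

lemma cmp_piece:
  assumes x: "x \<in> \<G> n" shows "cmp x = (\<lambda>j. if j = n then x else \<zero>)"
proof (rule cmp_eqI[of "{n}"])
  show "x = (\<Oplus>j\<in>{n}. if j = n then x else \<zero>)" using piece(3)[OF x] by simp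
qed (use x piece(2) in auto)

lemma cmp_zero: "cmp \<zero> j = \<zero>"
  using cmp_piece[OF piece(2)] by simp

lemma cmp_add:
  assumes x: "x \<in> carrier G" and y: "y \<in> carrier G"
  shows "cmp (x \<oplus> y) n = cmp x n \<oplus> cmp y n"
proof -
  let ?F = "{n. cmp x n \<noteq> \<zero>} \<union> {n. cmp y n \<noteq> \<zero>}"
  have F: "finite ?F" using finite_support x y by simp
  have "cmp (x \<oplus> y) = (\<lambda>n. cmp x n \<oplus> cmp y n)"
  proof (rule cmp_eqI[OF F])
    have "x = (\<Oplus>n\<in>?F. cmp x n)" "y = (\<Oplus>n\<in>?F. cmp y n)"
      using finsum_cmp[OF x F] finsum_cmp[OF y F] by auto
    then show "x \<oplus> y = (\<Oplus>n\<in>?F. cmp x n \<oplus> cmp y n)"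
      using finsum_addf[of "cmp x" ?F "cmp y"] cmp_carrier x y by auto
  qed (use piece(4) cmp_in x y cmp_carrier in auto)
  then show ?thesis by simp
qed

lemma cmp_uminus:
  assumes x: "x \<in> carrier G" shows "cmp (\<ominus> x) n = \<ominus> cmp x n"
proof -
  have "cmp x n \<oplus> cmp (\<ominus> x) n = cmp (x \<oplus> \<ominus> x) n" using cmp_add[OF x a_inv_closed[OF x]] by simp
  then have "cmp x n \<oplus> cmp (\<ominus> x) n = \<zero>" using x by (simp add: r_neg cmp_zero)
  then show ?thesis
    using cmp_carrier x minus_equality[of "cmp (\<ominus> x) n" "cmp x n"] a_comm by simp
qed

lemma homogeneous_induct [consumes 1, case_names piece add]:
  assumes x: "x \<in> carrier G" and pieceP: "\<And>n y. y \<in> \<G> n \<Longrightarrow> P y"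
    and add: "\<And>y z. y \<in> carrier G \<Longrightarrow> z \<in> carrier G \<Longrightarrow> P y \<Longrightarrow> P z \<Longrightarrow> P (y \<oplus> z)"
  shows "P x"
proof -
  have "finite F \<Longrightarrow> P (\<Oplus>n\<in>F. cmp x n)" for F
  proof (induction F rule: finite_induct)
    case empty
    show ?case using pieceP[OF piece(2)] by simp
  next
    case (insert n F)
    have "(\<Oplus>n\<in>insert n F. cmp x n) = cmp x n \<oplus> (\<Oplus>n\<in>F. cmp x n)"
      using insert cmp_carrier[OF x] by (intro finsum_insert) auto
    then show ?case
      using add[OF cmp_carrier[OF x] _ pieceP[OF cmp_in[OF x]] insert.IH] cmp_carrier[OF x] by auto
  qed
  then have "P (\<Oplus>n\<in>{n. cmp x n \<noteq> \<zero>}. cmp x n)" using finite_support[OF x] by blast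
  then show ?thesis using finsum_cmp[OF x finite_support[OF x]] by auto
qed

lemma cmp_finsum:
  assumes "finite F" "\<And>i. i \<in> F \<Longrightarrow> f i \<in> carrier G"
  shows "cmp (\<Oplus>i\<in>F. f i) n = (\<Oplus>i\<in>F. cmp (f i) n)"
  using assms
proof (induction F rule: finite_induct)
  case empty
  then show ?case by (simp add: cmp_zero)
next
  case (insert i F)
  have "(\<Oplus>i\<in>F. f i) \<in> carrier G" using insert by (intro finsum_closed) auto
  then show ?case using insert cmp_carrier by (simp add: cmp_add Pi_def)
qed

lemma finsum_in_subgroup:
  assumes "additive_subgroup N G" "\<And>i. i \<in> F \<Longrightarrow> f i \<in> N"
  shows "(\<Oplus>i\<in>F. f i) \<in> N"
proof -
  interpret N: additive_subgroup N G by fact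
  show ?thesis using assms(2)
  proof (induction F rule: infinite_finite_induct)
    case (insert i F)
    then have "f \<in> F \<rightarrow> carrier G" "f i \<in> carrier G" using N.a_subset by auto
    then show ?case using insert by simp
  qed auto
qed

lemma in_subgroup_if_cmp_in:
  assumes N: "additive_subgroup N G" and x: "x \<in> carrier G" "\<And>n. cmp x n \<in> N"
  shows "x \<in> N"
proof -
  have "(\<Oplus>n\<in>{n. cmp x n \<noteq> \<zero>}. cmp x n) \<in> N" by (rule finsum_in_subgroup[OF N x(2)])
  then show ?thesis using finsum_cmp[OF x(1) finite_support[OF x(1)] order_refl] by simp
qed

lemma cmp_self: "x \<in> carrier G \<Longrightarrow> cmp x n = x \<longleftrightarrow> x \<in> \<G> n"
  using cmp_in[of x n] cmp_piece[of x n] by (metis (no_types, lifting))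

end

text \<open>Weights \<open>\<Prod>i. p\<^sub>i\<^sup>n\<^sup>i\<close> with distinct primes embed the monoid \<open>\<nat>\<^sup>d\<close> into the positive integers under
  multiplication, and so order it compatibly with addition.\<close>

lemma multiplicative_weight:
  obtains w :: "('d::finite \<Rightarrow> nat) \<Rightarrow> nat"
  where "inj w" "\<And>m n. w (m + n) = w m * w n" "\<And>n. w n > 0"
proof -
  obtain f :: "nat \<Rightarrow> nat" where f: "inj f" "range f \<subseteq> {p. prime p}"
    using infinite_countable_subset[OF primes_infinite] by blast
  obtain g :: "'d \<Rightarrow> nat" where g: "inj g" using finite_imp_inj_to_nat_seg[of "UNIV :: 'd set"] by auto
  define p where "p = f \<circ> g"
  have p: "prime (p i)" "inj p" for i using f g by (auto simp: p_def intro: inj_compose)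
  define w where "w = (\<lambda>n :: 'd \<Rightarrow> nat. \<Prod>i\<in>UNIV. p i ^ n i)"
  have mult: "multiplicity (p j) (w n) = n j" for n j
  proof -
    have "w n = (\<Prod>q\<in>range p. q ^ n (inv_into UNIV p q))"
      unfolding w_def using p(2) by (subst prod.reindex) auto
    then have "multiplicity (p j) (w n) = n (inv_into UNIV p (p j))"
      using multiplicity_prod_prime_powers[of "range p" "p j" "\<lambda>q. n (inv_into UNIV p q)"] p by auto
    then show ?thesis using p(2) by simp
  qed
  show thesis
  proof (rule that[of w])
    show "inj w" by (rule injI) (metis mult ext)
    show "w (m + n) = w m * w n" for m n by (simp add: w_def power_add prod.distrib plus_fun_apply)
    show "w n > 0" for n using p(1) by (auto simp: w_def prime_gt_0_nat intro!: prod_pos)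
  qed
qed

section \<open>Graded modules\<close>

locale graded_module = module R M for R (structure) and M (structure) +
  fixes RG :: "('i::finite \<Rightarrow> nat) \<Rightarrow> 'a set" and MG :: "('i \<Rightarrow> nat) \<Rightarrow> 'c set"
  assumes R_graded: "direct_sum R RG" and M_graded: "direct_sum M MG"
    and R_mult: "x \<in> RG m \<Longrightarrow> y \<in> RG n \<Longrightarrow> x \<otimes> y \<in> RG (m + n)"
    and M_smult: "x \<in> RG m \<Longrightarrow> z \<in> MG n \<Longrightarrow> x \<odot>\<^bsub>M\<^esub> z \<in> MG (m + n)"
begin

sublocale RG: graded_group R RG
  by unfold_locales (rule R_graded)

sublocale MG: graded_group M MG
  by unfold_locales (rule M_graded)

lemma direct_sum_ring_module: "direct_sum (ring_module R) RG"
proof -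
  have *: "finsum (ring_module R) f F = finsum R f F" for f :: "('i \<Rightarrow> nat) \<Rightarrow> 'a" and F
    by (simp add: finsum_def finprod_def ring_module_def)
  have "additive_subgroup H (ring_module R) \<longleftrightarrow> additive_subgroup H R" for H
    by (simp add: additive_subgroup_def subgroup_def m_inv_def)
  then show ?thesis
    using R_graded unfolding direct_sum_def decomposition_def by (simp add: *)
qed

lemma component_ring_module: "component (ring_module R) RG = component R RG"
proof -
  have *: "finsum (ring_module R) f F = finsum R f F" for f :: "('i \<Rightarrow> nat) \<Rightarrow> 'a" and F
    by (simp add: finsum_def finprod_def ring_module_def)
  show ?thesis by (simp add: fun_eq_iff component_def decomposition_def *)
qed

lemma graded_ring_module: "graded_module R (ring_module R) RG RG"
  by (intro graded_module.intro graded_module_axioms.intro module_ring_module)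
    (use R_graded direct_sum_ring_module R_mult in auto)

lemma component_smult_left:
  assumes s: "s \<in> RG k" and m: "m \<in> carrier M"
  shows "MG.cmp (s \<odot>\<^bsub>M\<^esub> m) j = (if k \<le> j then s \<odot>\<^bsub>M\<^esub> MG.cmp m (j - k) else \<zero>\<^bsub>M\<^esub>)"
  using m
proof (induction m rule: MG.homogeneous_induct)
  case (piece n y)
  show ?case
    unfolding MG.cmp_piece[OF M_smult[OF s piece]] MG.cmp_piece[OF piece] deg_add_iff[symmetric]
    using RG.piece(3)[OF s] by (cases "k \<le> j"; cases "j - k = n") simp_all
next
  case (add y z)
  have sc: "s \<in> carrier R" using RG.piece(3)[OF s] .
  show ?case
    using add sc by (cases "k \<le> j") (simp_all add: smult_r_distr MG.cmp_add MG.cmp_carrier)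
qed

lemma component_smult_right:
  assumes m: "m \<in> MG k" and s: "s \<in> carrier R"
  shows "MG.cmp (s \<odot>\<^bsub>M\<^esub> m) j = (if k \<le> j then RG.cmp s (j - k) \<odot>\<^bsub>M\<^esub> m else \<zero>\<^bsub>M\<^esub>)"
  using s
proof (induction s rule: RG.homogeneous_induct)
  case (piece n y)
  have *: "y \<odot>\<^bsub>M\<^esub> m \<in> MG (k + n)" using M_smult[OF piece m] by (simp add: add.commute)
  show ?case
    unfolding MG.cmp_piece[OF *] RG.cmp_piece[OF piece] deg_add_iff[symmetric]
    using MG.piece(3)[OF m] by (cases "k \<le> j"; cases "j - k = n") simp_all
next
  case (add y z)
  have mc: "m \<in> carrier M" using MG.piece(3)[OF m] .
  show ?case
    using add mc by (cases "k \<le> j") (simp_all add: smult_l_distr MG.cmp_add RG.cmp_add RG.cmp_carrier)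
qed

lemma stable_degree:
  assumes X: "X \<subseteq> RG 0" shows "stable M X (MG n)"
proof (rule stableI)
  show "a \<odot>\<^bsub>M\<^esub> x \<in> MG n" if "a \<in> X" "x \<in> MG n" for a x
    using M_smult[of a 0 x n] X that by auto
qed (use MG.piece(1,2,4,5) in auto)

definition graded_sub :: "'c set \<Rightarrow> bool" where
  "graded_sub N \<longleftrightarrow> stable M (carrier R) N \<and> graded_subset M MG N"

lemma graded_sub_stable: "graded_sub N \<Longrightarrow> stable M (carrier R) N"
  and graded_sub_cmp: "graded_sub N \<Longrightarrow> x \<in> N \<Longrightarrow> MG.cmp x n \<in> N"
  by (auto simp: graded_sub_def graded_subset_def)

lemmas graded_subD = stableD[OF graded_sub_stable]

lemma graded_sub_cmp_iff: "graded_sub N \<Longrightarrow> x \<in> carrier M \<Longrightarrow> x \<in> N \<longleftrightarrow> (\<forall>n. MG.cmp x n \<in> N)"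
  using graded_sub_cmp MG.in_subgroup_if_cmp_in[of N x] graded_sub_stable unfolding stable_def by blast

lemma graded_sub_zero: "graded_sub {\<zero>\<^bsub>M\<^esub>}"
  using stable_zero[OF subset_refl] by (simp add: graded_sub_def graded_subset_def MG.cmp_zero)

lemma graded_sub_carrier: "graded_sub (carrier M)"
  using stable_carrier[OF subset_refl] MG.cmp_carrier by (simp add: graded_sub_def graded_subset_def)

lemma graded_sub_Int: "graded_sub N \<Longrightarrow> graded_sub K \<Longrightarrow> graded_sub (N \<inter> K)"
  using stable_Int by (auto simp: graded_sub_def graded_subset_def)

lemma graded_sub_add: assumes N: "graded_sub N" and K: "graded_sub K" shows "graded_sub (N <+>\<^bsub>M\<^esub> K)"
  unfolding graded_sub_def graded_subset_def
proof (intro conjI ballI allI)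
  show "stable M (carrier R) (N <+>\<^bsub>M\<^esub> K)"
    by (rule stable_add[OF subset_refl graded_sub_stable[OF N] graded_sub_stable[OF K]])
  fix x n assume "x \<in> N <+>\<^bsub>M\<^esub> K"
  then obtain a b where ab: "a \<in> N" "b \<in> K" "x = a \<oplus>\<^bsub>M\<^esub> b" by (auto simp: set_add_iff)
  then have "MG.cmp x n = MG.cmp a n \<oplus>\<^bsub>M\<^esub> MG.cmp b n"
    using MG.cmp_add graded_subD(3)[OF N] graded_subD(3)[OF K] by simp
  then show "MG.cmp x n \<in> N <+>\<^bsub>M\<^esub> K"
    unfolding set_add_iff using graded_sub_cmp[OF N ab(1)] graded_sub_cmp[OF K ab(2)] by blast
qed

lemma graded_sub_smult_image:
  assumes x: "x \<in> RG k" and N: "graded_sub N" shows "graded_sub ((\<lambda>m. x \<odot>\<^bsub>M\<^esub> m) ` N)"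
  unfolding graded_sub_def graded_subset_def
proof (intro conjI ballI allI)
  have xc: "x \<in> carrier R" by (rule RG.piece(3)[OF x])
  show "stable M (carrier R) ((\<lambda>m. x \<odot>\<^bsub>M\<^esub> m) ` N)"
    by (rule stable_smult_image[OF subset_refl xc graded_sub_stable[OF N]])
  fix y n assume "y \<in> (\<lambda>m. x \<odot>\<^bsub>M\<^esub> m) ` N"
  then obtain m where m: "m \<in> N" "y = x \<odot>\<^bsub>M\<^esub> m" by auto
  have "MG.cmp y n = x \<odot>\<^bsub>M\<^esub> (if k \<le> n then MG.cmp m (n - k) else \<zero>\<^bsub>M\<^esub>)"
    using component_smult_left[OF x graded_subD(3)[OF N m(1)]] m(2) xc by simp
  moreover have "(if k \<le> n then MG.cmp m (n - k) else \<zero>\<^bsub>M\<^esub>) \<in> N"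
    using graded_sub_cmp[OF N m(1)] graded_subD(2)[OF N] by simp
  ultimately show "MG.cmp y n \<in> (\<lambda>m. x \<odot>\<^bsub>M\<^esub> m) ` N" by blast
qed

lemma graded_sub_colon:
  assumes x: "x \<in> RG k" and N: "graded_sub N" shows "graded_sub (colon N x)"
  unfolding graded_sub_def graded_subset_def
proof (intro conjI ballI allI)
  have xc: "x \<in> carrier R" by (rule RG.piece(3)[OF x])
  show "stable M (carrier R) (colon N x)" by (rule stable_colon[OF xc graded_sub_stable[OF N] subset_refl])
  fix m j assume m: "m \<in> colon N x"
  then have mc: "m \<in> carrier M" by (simp add: colon_def)
  have "MG.cmp (x \<odot>\<^bsub>M\<^esub> m) (k + j) \<in> N" using m graded_sub_cmp[OF N] by (simp add: colon_def)
  then show "MG.cmp m j \<in> colon N x"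
    using component_smult_left[OF x mc] MG.cmp_carrier[OF mc] by (simp add: colon_def)
qed

text \<open>The ideal \<open>(N : m)\<close>, which is the annihilator of the class of \<open>m\<close> in \<open>M / N\<close>.\<close>

definition conductor :: "'c set \<Rightarrow> 'c \<Rightarrow> 'a set" where
  "conductor N m = {s \<in> carrier R. s \<odot>\<^bsub>M\<^esub> m \<in> N}"

definition graded_ideal :: "'a set \<Rightarrow> bool" where
  "graded_ideal I \<longleftrightarrow> ideal I R \<and> graded_subset R RG I"

lemma graded_ideal_iff_homogeneous: "graded_ideal I \<longleftrightarrow> homogeneous_ideal R RG I"
proof -
  have "(\<forall>x\<in>I. \<forall>f. decomposition R RG x f \<longrightarrow> (\<forall>n. f n \<in> I)) \<longleftrightarrow> graded_subset R RG I" if "ideal I R"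
  proof -
    interpret ideal I R by fact
    show ?thesis unfolding graded_subset_def
      using RG.decomposition_iff a_subset by (metis subsetD)
  qed
  then show ?thesis unfolding graded_ideal_def homogeneous_ideal_def by blast
qed

lemma ideal_conductor:
  assumes N: "graded_sub N" and m: "m \<in> carrier M" shows "ideal (conductor N m) R"
  unfolding ideal_iff_stable
proof (rule module.stableI[OF module_ring_module])
  note n = graded_subD[OF N]
  show "\<And>a x. a \<in> carrier R \<Longrightarrow> x \<in> conductor N m \<Longrightarrow> a \<odot>\<^bsub>ring_module R\<^esub> x \<in> conductor N m"
    using n(7) m by (auto simp: conductor_def smult_assoc1)
qed (use graded_subD(2,4,5)[OF N] m in \<open>auto simp: conductor_def smult_l_distr smult_l_minus\<close>)

lemma graded_ideal_conductor:
  assumes N: "graded_sub N" and m: "m \<in> MG k" shows "graded_ideal (conductor N m)"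
  unfolding graded_ideal_def graded_subset_def
proof (intro conjI ballI allI ideal_conductor[OF N])
  show mc: "m \<in> carrier M" by (rule MG.piece(3)[OF m])
  fix s j assume "s \<in> conductor N m"
  then have s: "s \<in> carrier R" "s \<odot>\<^bsub>M\<^esub> m \<in> N" by (auto simp: conductor_def)
  have "MG.cmp (s \<odot>\<^bsub>M\<^esub> m) (k + j) \<in> N" by (rule graded_sub_cmp[OF N s(2)])
  then show "RG.cmp s j \<in> conductor N m"
    using component_smult_right[OF m s(1)] RG.cmp_carrier[OF s(1)] by (simp add: conductor_def)
qed

lemma graded_ideal_carrier: "graded_ideal (carrier R)"
  using RG.cmp_carrier oneideal by (simp add: graded_ideal_def graded_subset_def)

lemma graded_sub_ideal_smult:
  assumes I: "graded_ideal I" and m: "m \<in> MG k" shows "graded_sub ((\<lambda>s. s \<odot>\<^bsub>M\<^esub> m) ` I)"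
  unfolding graded_sub_def graded_subset_def
proof (intro conjI ballI allI)
  have mc: "m \<in> carrier M" by (rule MG.piece(3)[OF m])
  interpret I: ideal I R using I by (simp add: graded_ideal_def)
  have Ic: "s \<in> I \<Longrightarrow> s \<in> carrier R" for s using I.a_subset by blast
  show "stable M (carrier R) ((\<lambda>s. s \<odot>\<^bsub>M\<^esub> m) ` I)" by (rule stable_ideal_smult[OF I.is_ideal mc])
  fix x n assume "x \<in> (\<lambda>s. s \<odot>\<^bsub>M\<^esub> m) ` I"
  then obtain s where s: "s \<in> I" "x = s \<odot>\<^bsub>M\<^esub> m" by auto
  have "MG.cmp x n = (if k \<le> n then RG.cmp s (n - k) else \<zero>) \<odot>\<^bsub>M\<^esub> m"
    using component_smult_right[OF m Ic[OF s(1)]] s(2) mc by simp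
  moreover have "(if k \<le> n then RG.cmp s (n - k) else \<zero>) \<in> I"
    using I s(1) by (simp add: graded_ideal_def graded_subset_def)
  ultimately show "MG.cmp x n \<in> (\<lambda>s. s \<odot>\<^bsub>M\<^esub> m) ` I" by blast
qed

abbreviation cyclic :: "'c \<Rightarrow> 'c set" where
  "cyclic m \<equiv> (\<lambda>s. s \<odot>\<^bsub>M\<^esub> m) ` carrier R"

lemma in_cyclic: "m \<in> carrier M \<Longrightarrow> m \<in> cyclic m"
  by (rule image_eqI[of _ _ \<one>]) auto

lemma piece_set_add:
  assumes N: "graded_sub N" and K: "graded_sub K" and y: "y \<in> N <+>\<^bsub>M\<^esub> K" "y \<in> MG n"
  shows "\<exists>h\<in>N \<inter> MG n. \<exists>k\<in>K \<inter> MG n. y = h \<oplus>\<^bsub>M\<^esub> k"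
proof -
  obtain a b where ab: "a \<in> N" "b \<in> K" "y = a \<oplus>\<^bsub>M\<^esub> b" using y by (auto simp: set_add_iff)
  then have "y = MG.cmp a n \<oplus>\<^bsub>M\<^esub> MG.cmp b n"
    using MG.cmp_add graded_subD(3)[OF N] graded_subD(3)[OF K] MG.cmp_self[of y n] MG.piece(3) y(2) by simp
  then show ?thesis
    using graded_sub_cmp[OF N ab(1)] graded_sub_cmp[OF K ab(2)] MG.cmp_in graded_subD(3)[OF N ab(1)] graded_subD(3)[OF K ab(2)]
    by blast
qed

lemma piece_smult_image:
  assumes N: "graded_sub N" and x: "x \<in> RG k" and y: "y \<in> (\<lambda>m. x \<odot>\<^bsub>M\<^esub> m) ` N" "y \<in> MG (k + n)"
  shows "\<exists>m\<in>N \<inter> MG n. y = x \<odot>\<^bsub>M\<^esub> m"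
proof -
  obtain m where m: "m \<in> N" "y = x \<odot>\<^bsub>M\<^esub> m" using y by auto
  have "y = MG.cmp y (k + n)" using MG.cmp_self[of y "k + n"] MG.piece(3) y(2) by simp
  then have "y = x \<odot>\<^bsub>M\<^esub> MG.cmp m n"
    using component_smult_left[OF x graded_subD(3)[OF N m(1)], of "k + n"] m(2) by simp
  then show ?thesis
    using graded_sub_cmp[OF N m(1)] MG.cmp_in graded_subD(3)[OF N m(1)] by blast
qed

lemma piece_cyclic:
  assumes m: "m \<in> MG k" and y: "y \<in> cyclic m" "y \<in> MG n"
  shows "if k \<le> n then \<exists>s\<in>RG (n - k). y = s \<odot>\<^bsub>M\<^esub> m else y = \<zero>\<^bsub>M\<^esub>"
proof -
  obtain s where s: "s \<in> carrier R" "y = s \<odot>\<^bsub>M\<^esub> m" using y by auto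
  have "y = MG.cmp y n" using MG.cmp_self[of y n] MG.piece(3) y(2) by simp
  then show ?thesis
    using component_smult_right[OF m s(1), of n] s RG.cmp_in[OF s(1)] by auto
qed

text \<open>The degree \<open>0\<close> component of the unit element fixes every homogeneous element, hence is
  itself a unit element.\<close>

lemma one_in_RG0: "\<one> \<in> RG 0"
proof -
  interpret S: graded_module R "ring_module R" RG RG by (rule graded_ring_module)
  let ?e = "RG.cmp \<one> 0"
  have ec: "?e \<in> carrier R" by (rule RG.cmp_carrier) simp
  have "?e \<otimes> x = x" if "x \<in> carrier R" for x
    using that
  proof (induction x rule: RG.homogeneous_induct)
    case (piece n y)
    have "RG.cmp (\<one> \<otimes> y) n = RG.cmp \<one> (n - n) \<otimes> y"
      using S.component_smult_right[OF piece, of \<one> n] by (simp add: component_ring_module)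
    moreover have "n - n = (0 :: 'i \<Rightarrow> nat)" by (simp add: fun_eq_iff minus_apply zero_fun_apply)
    moreover have "RG.cmp (\<one> \<otimes> y) n = y"
      using RG.cmp_self[of y n] RG.piece(3)[OF piece] piece by simp
    ultimately show ?case by metis
  next
    case (add y z)
    then show ?case using r_distr[OF add(1,2) ec] by metis
  qed
  then have "?e \<otimes> \<one> = \<one>" by simp
  then have "?e = \<one>" using ec by simp
  then show ?thesis using RG.cmp_in[of \<one> 0] by simp
qed

text \<open>For \<open>a, b \<notin> P\<close> choose components of \<open>a\<close> and \<open>b\<close> outside \<open>P\<close> of greatest weight, in degrees
  \<open>u\<close> and \<open>v\<close>. In the component of \<open>a b\<close> of degree \<open>u + v\<close> each other summand has a factor
  of greater weight, which lies in \<open>P\<close>. So the product of the two chosen components lies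
  in \<open>P\<close> as soon as \<open>a b\<close> does.\<close>

lemma prime_if_homogeneous_prime:
  assumes P: "graded_ideal P" and one: "\<one> \<notin> P"
    and hp: "\<And>a b i j. a \<in> RG i \<Longrightarrow> b \<in> RG j \<Longrightarrow> a \<otimes> b \<in> P \<Longrightarrow> a \<in> P \<or> b \<in> P"
  shows "primeideal P R"
proof -
  interpret P: ideal P R using P by (simp add: graded_ideal_def)
  interpret S: graded_module R "ring_module R" RG RG by (rule graded_ring_module)
  have Pc: "x \<in> P \<Longrightarrow> RG.cmp x n \<in> P" for x n using P by (simp add: graded_ideal_def graded_subset_def)
  obtain w :: "('i \<Rightarrow> nat) \<Rightarrow> nat" where w: "inj w" "\<And>m n. w (m + n) = w m * w n" "\<And>n. w n > 0"
    using multiplicative_weight by blast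
  have top: "\<exists>u. RG.cmp a u \<notin> P \<and> (\<forall>i. RG.cmp a i \<notin> P \<longrightarrow> w i \<le> w u)"
    if a: "a \<in> carrier R" "a \<notin> P" for a
  proof -
    let ?U = "{i. RG.cmp a i \<notin> P}"
    have "?U \<subseteq> {i. RG.cmp a i \<noteq> \<zero>}" using P.zero_closed by auto
    then have fin: "finite ?U" using RG.finite_support[OF a(1)] finite_subset by blast
    have ne: "?U \<noteq> {}" using RG.in_subgroup_if_cmp_in[OF P.is_additive_subgroup a(1)] a(2) by blast
    have "Max (w ` ?U) \<in> w ` ?U" using fin ne by (intro Max_in) auto
    then obtain u where u: "u \<in> ?U" "w u = Max (w ` ?U)" by auto
    then have "w i \<le> w u" if "i \<in> ?U" for i using fin that by simp
    then show ?thesis using u(1) by blast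
  qed
  have "a \<in> P \<or> b \<in> P" if a: "a \<in> carrier R" and b: "b \<in> carrier R" and ab: "a \<otimes> b \<in> P" for a b
  proof (rule ccontr)
    assume "\<not> (a \<in> P \<or> b \<in> P)"
    then obtain u v where u: "RG.cmp a u \<notin> P" "\<And>i. RG.cmp a i \<notin> P \<Longrightarrow> w i \<le> w u"
      and v: "RG.cmp b v \<notin> P" "\<And>i. RG.cmp b i \<notin> P \<Longrightarrow> w i \<le> w v"
      using top[OF a] top[OF b] by metis
    let ?F = "{i. RG.cmp a i \<noteq> \<zero>}"
    let ?t = "\<lambda>i. if i \<le> u + v then RG.cmp a i \<otimes> RG.cmp b (u + v - i) else \<zero>"
    have F: "finite ?F" by (rule RG.finite_support[OF a])
    have ac: "RG.cmp a i \<in> carrier R" and bc: "RG.cmp b i \<in> carrier R" for i using RG.cmp_carrier a b by auto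
    have tc: "?t i \<in> carrier R" for i using ac bc by simp
    have "a \<otimes> b = (\<Oplus>i\<in>?F. RG.cmp a i) \<otimes> b" using RG.finsum_cmp[OF a F] by simp
    also have "\<dots> = (\<Oplus>i\<in>?F. RG.cmp a i \<otimes> b)" using F b ac by (simp add: finsum_ldistr)
    finally have "RG.cmp (a \<otimes> b) (u + v) = (\<Oplus>i\<in>?F. RG.cmp (RG.cmp a i \<otimes> b) (u + v))"
      using RG.cmp_finsum[OF F, of "\<lambda>i. RG.cmp a i \<otimes> b"] ac b by simp
    also have "\<dots> = (\<Oplus>i\<in>?F. ?t i)"
    proof (rule R.finsum_cong')
      show "RG.cmp (RG.cmp a i \<otimes> b) (u + v) = ?t i" if "i \<in> ?F" for i
        using S.component_smult_left[OF RG.cmp_in[OF a, of i], of b "u + v"] b by (simp add: component_ring_module)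
    qed (use tc in auto)
    finally have sum: "(\<Oplus>i\<in>?F. ?t i) \<in> P" using Pc[OF ab] by metis
    have rest: "?t i \<in> P" if "i \<noteq> u" for i
    proof (cases "i \<le> u + v \<and> RG.cmp a i \<notin> P")
      case True
      then have j: "i + (u + v - i) = u + v" by (intro deg_add_diff) auto
      have "w i < w u" using u(2) True w(1) that by (metis injD le_neq_implies_less)
      moreover have "w i * w (u + v - i) = w u * w v" using w(2) j by metis
      moreover have "w i * w v < w u * w v" using \<open>w i < w u\<close> w(3) by simp
      ultimately have "w v < w (u + v - i)"
        using mult_le_mono2[of "w (u + v - i)" "w v" "w i"] by linarith
      then have "RG.cmp b (u + v - i) \<in> P" using v(2) linorder_not_le by blast
      then show ?thesis using P.I_l_closed ac by simp
    next
      case False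
      then show ?thesis using P.I_r_closed bc P.zero_closed by auto
    qed
    have uF: "u \<in> ?F" using u(1) P.zero_closed by auto
    have eq: "(\<Oplus>i\<in>?F. ?t i) = ?t u \<oplus> (\<Oplus>i\<in>?F - {u}. ?t i)"
    proof -
      define t where "t = ?t"
      have "(\<Oplus>i\<in>insert u (?F - {u}). t i) = t u \<oplus> (\<Oplus>i\<in>?F - {u}. t i)"
        using F tc ac bc by (intro R.finsum_insert) (auto simp: t_def)
      then show ?thesis using uF unfolding t_def by (simp only: insert_Diff)
    qed
    define r where "r = (\<Oplus>i\<in>?F - {u}. ?t i)"
    have r: "r \<in> P" unfolding r_def
      by (rule RG.finsum_in_subgroup[OF P.is_additive_subgroup]) (use rest in blast)
    then have rc: "r \<in> carrier R" using P.a_subset by blast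
    have "?t u \<oplus> r \<in> P" using sum unfolding eq r_def .
    then have "?t u \<oplus> r \<oplus> \<ominus> r \<in> P" using P.a_closed P.a_inv_closed[OF r] by blast
    moreover have "?t u \<oplus> r \<oplus> \<ominus> r = ?t u" using rc tc[of u] by (simp only: R.a_assoc R.r_neg R.r_zero R.a_inv_closed)
    ultimately have "?t u \<in> P" by metis
    then have "RG.cmp a u \<otimes> RG.cmp b v \<in> P" by simp
    then show False using hp[OF RG.cmp_in[OF a] RG.cmp_in[OF b]] u(1) v(1) by blast
  qed
  then show ?thesis
    using one by (intro primeidealI P.is_ideal is_cring) auto
qed

end

section \<open>Polynomials in the binomial basis\<close>

lemma for_large_mono: "for_large P \<Longrightarrow> (\<And>n. P n \<Longrightarrow> Q n) \<Longrightarrow> for_large Q"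
  unfolding for_large_def by blast

lemma for_large_all: "(\<And>n. P n) \<Longrightarrow> for_large P"
  unfolding for_large_def by blast

lemma for_large_conj:
  assumes "for_large (P :: ('d \<Rightarrow> nat) \<Rightarrow> bool)" "for_large Q" shows "for_large (\<lambda>n. P n \<and> Q n)"
proof -
  obtain N K where NK: "\<forall>n\<ge>N. P n" "\<forall>n\<ge>K. Q n" using assms unfolding for_large_def by blast
  have "P n \<and> Q n" if "n \<ge> N + K" for n
    using NK that order_trans[OF deg_le_add(1) that] order_trans[OF deg_le_add(2) that] by blast
  then show ?thesis unfolding for_large_def by blast
qed

lemma for_large_ge: "for_large (\<lambda>n. n \<ge> (a :: 'd \<Rightarrow> nat))"
  unfolding for_large_def by blast

lemma for_large_shift:
  assumes "for_large (P :: ('d \<Rightarrow> nat) \<Rightarrow> bool)" shows "for_large (\<lambda>n. P (n + a))"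
  using assms order_trans[OF _ deg_le_add(1)] unfolding for_large_def by blast

lemma for_large_unshift:
  assumes "for_large (\<lambda>n. (P :: ('d \<Rightarrow> nat) \<Rightarrow> bool) (n + a))" shows "for_large P"
proof -
  obtain N where N: "\<forall>n\<ge>N. P (n + a)" using assms unfolding for_large_def by blast
  have "P n" if n: "n \<ge> N + a" for n
  proof -
    have "a \<le> n" using order_trans[OF deg_le_add(2) n] .
    then have e: "n - a + a = n" using deg_add_diff[of a n] by (simp add: add.commute)
    have "N \<le> n - a" using n by (auto simp: le_fun_def plus_fun_apply minus_apply le_diff_conv2) (metis add_le_imp_le_diff)
    then show ?thesis using N e by metis
  qed
  then show ?thesis unfolding for_large_def by blast
qed

lemma for_large_ex: "for_large (P :: ('d \<Rightarrow> nat) \<Rightarrow> bool) \<Longrightarrow> \<exists>n\<ge>a. P n"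
  using for_large_conj[OF for_large_ge[of a], of P] unfolding for_large_def by blast

lemma deg_split: "k j > 0 \<Longrightarrow> (k :: 'd \<Rightarrow> nat) - unit_vec j + unit_vec j = k"
  by (auto simp: fun_eq_iff unit_vec_def plus_fun_apply minus_apply)

lemma deg_induct [case_names zero step]:
  fixes k :: "'d::finite \<Rightarrow> nat"
  assumes "P 0" "\<And>k j. P k \<Longrightarrow> P (k + unit_vec j)"
  shows "P k"
proof (induction "\<Sum>i\<in>UNIV. k i" arbitrary: k)
  case 0
  then have "k = 0" by (simp add: fun_eq_iff zero_fun_apply)
  then show ?case using assms(1) by simp
next
  case (Suc s)
  then obtain j where j: "k j > 0" by (metis gr0I nat.distinct(1) sum.neutral)
  have "(\<Sum>i\<in>UNIV. k i) = (\<Sum>i\<in>UNIV. (k - unit_vec j) i) + (\<Sum>i\<in>UNIV. unit_vec j i)"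
    by (subst deg_split[of k j, OF j, symmetric]) (simp add: sum.distrib plus_fun_apply)
  also have "(\<Sum>i\<in>UNIV. unit_vec j i) = 1" by (simp add: unit_vec_def)
  finally have "P (k - unit_vec j)" using Suc by simp
  then show ?case using assms(2)[of "k - unit_vec j" j] deg_split[of k j, OF j] by simp
qed

definition binomial_basis :: "('d::finite \<Rightarrow> nat) \<Rightarrow> ('d \<Rightarrow> nat) \<Rightarrow> int" where
  "binomial_basis k n = (\<Prod>i\<in>UNIV. int ((n i + k i) choose (k i)))"

text \<open>By the Pascal rule the polynomial with coefficients \<open>shift (unit_vec j) e\<close> is the
  difference in direction \<open>j\<close> of the one with coefficients \<open>e\<close>, evaluated at the upper of
  the two points.\<close>

definition shift :: "('d \<Rightarrow> nat) \<Rightarrow> (('d \<Rightarrow> nat) \<Rightarrow> int) \<Rightarrow> ('d \<Rightarrow> nat) \<Rightarrow> int" where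
  "shift k e = (\<lambda>h. e (h + k))"

abbreviation fin_supp :: "(('d \<Rightarrow> nat) \<Rightarrow> int) \<Rightarrow> bool" where
  "fin_supp e \<equiv> finite {k. e k \<noteq> 0}"

lemma binomial_poly_superset:
  assumes "finite F" "{k. e k \<noteq> 0} \<subseteq> F"
  shows "binomial_poly e n = (\<Sum>k\<in>F. e k * binomial_basis k n)"
  unfolding binomial_poly_def binomial_basis_def
  by (rule sum.mono_neutral_left) (use assms in auto)

lemma fin_supp_add: "fin_supp e \<Longrightarrow> fin_supp e' \<Longrightarrow> fin_supp (\<lambda>k. e k + e' k)"
  by (rule finite_subset[of _ "{k. e k \<noteq> 0} \<union> {k. e' k \<noteq> 0}"]) auto

lemma fin_supp_diff: "fin_supp e \<Longrightarrow> fin_supp e' \<Longrightarrow> fin_supp (\<lambda>k. e k - e' k)"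
  by (rule finite_subset[of _ "{k. e k \<noteq> 0} \<union> {k. e' k \<noteq> 0}"]) auto

lemma fin_supp_shift: assumes "fin_supp e" shows "fin_supp (shift k e)"
proof -
  have "inj (\<lambda>h. h + k)" by (rule injI) simp
  then have "finite ((\<lambda>h. h + k) -` {h. e h \<noteq> 0})" using assms by (intro finite_vimageI)
  then show ?thesis by (simp add: shift_def vimage_def)
qed

lemma binomial_poly_add:
  assumes "fin_supp e" "fin_supp e'"
  shows "binomial_poly (\<lambda>k. e k + e' k) n = binomial_poly e n + binomial_poly e' n"
  using assms
  by (subst (1 2 3) binomial_poly_superset[of "{k. e k \<noteq> 0} \<union> {k. e' k \<noteq> 0}"])
    (auto simp: sum.distrib distrib_right)

lemma binomial_poly_diff:
  assumes "fin_supp e" "fin_supp e'"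
  shows "binomial_poly (\<lambda>k. e k - e' k) n = binomial_poly e n - binomial_poly e' n"
  using assms
  by (subst (1 2 3) binomial_poly_superset[of "{k. e k \<noteq> 0} \<union> {k. e' k \<noteq> 0}"])
    (auto simp: sum_subtractf left_diff_distrib)

lemma binomial_poly_zero [simp]: "binomial_poly (\<lambda>_. 0) n = 0"
  by (simp add: binomial_poly_def)

lemma binomial_poly_const:
  assumes "\<And>h. h \<noteq> 0 \<Longrightarrow> e h = 0" shows "binomial_poly e n = e 0"
proof -
  have "binomial_poly e n = (\<Sum>k\<in>{0}. e k * binomial_basis k n)"
    by (rule binomial_poly_superset) (use assms in auto)
  then show ?thesis by (simp add: binomial_basis_def zero_fun_apply)
qed

lemma binomial_basis_diff:
  "binomial_basis k (n + unit_vec j) - binomial_basis k n =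
    (if k j = 0 then 0 else binomial_basis (k - unit_vec j) (n + unit_vec j))"
proof -
  let ?c = "\<lambda>k n i. int ((n i + k i) choose (k i))"
  have split: "binomial_basis k n = ?c k n j * (\<Prod>i\<in>UNIV - {j}. ?c k n i)" for k n :: "'a \<Rightarrow> nat"
    unfolding binomial_basis_def by (rule prod.remove) auto
  have rest: "(\<Prod>i\<in>UNIV - {j}. ?c k (n + unit_vec j) i) = (\<Prod>i\<in>UNIV - {j}. ?c k n i)"
    by (rule prod.cong) (auto simp: unit_vec_def plus_fun_apply)
  have rest': "(\<Prod>i\<in>UNIV - {j}. ?c (k - unit_vec j) (n + unit_vec j) i) = (\<Prod>i\<in>UNIV - {j}. ?c k n i)"
    by (rule prod.cong) (auto simp: unit_vec_def plus_fun_apply minus_apply)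
  have main: "?c k (n + unit_vec j) j - ?c k n j = (if k j = 0 then 0 else ?c (k - unit_vec j) (n + unit_vec j) j)"
  proof (cases "k j")
    case (Suc l)
    then show ?thesis by (simp add: unit_vec_def plus_fun_apply minus_apply)
  qed simp
  show ?thesis
    unfolding split[of k "n + unit_vec j"] split[of k n] split[of "k - unit_vec j"] rest rest'
    using main by (auto simp: left_diff_distrib[symmetric])
qed

lemma binomial_poly_shift:
  assumes e: "fin_supp e"
  shows "binomial_poly e (n + unit_vec j) - binomial_poly e n = binomial_poly (shift (unit_vec j) e) (n + unit_vec j)"
proof -
  let ?F = "{k. e k \<noteq> 0}" and ?u = "unit_vec j"
  let ?G = "{k. shift ?u e k \<noteq> 0}"
  have "binomial_poly e (n + ?u) - binomial_poly e n =
      (\<Sum>k\<in>?F. e k * (binomial_basis k (n + ?u) - binomial_basis k n))"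
    by (simp add: binomial_poly_superset[OF e order_refl] sum_subtractf right_diff_distrib)
  also have "\<dots> = (\<Sum>k\<in>?F \<inter> {k. k j > 0}. e k * binomial_basis (k - ?u) (n + ?u))"
    unfolding binomial_basis_diff by (rule sum.mono_neutral_cong_right) (use e in auto)
  also have "\<dots> = (\<Sum>h\<in>?G. e (h + ?u) * binomial_basis h (n + ?u))"
  proof (rule sum.reindex_bij_witness[of _ "\<lambda>h. h + ?u" "\<lambda>k. k - ?u"])
    fix h assume "h \<in> ?G"
    then show "h + ?u - ?u = h" "h + ?u \<in> ?F \<inter> {k. k j > 0}"
      by (auto simp: shift_def add.commute[of h] unit_vec_def plus_fun_apply)
  qed (auto simp: deg_split shift_def)
  also have "\<dots> = binomial_poly (shift ?u e) (n + ?u)"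
    unfolding binomial_poly_superset[OF fin_supp_shift[OF e] order_refl] by (simp add: shift_def)
  finally show ?thesis .
qed

text \<open>Differencing a polynomial that vanishes at all large points gives another one.
  Differencing along an exponent \<open>k\<close> of maximal degree in the support leaves the constant
  \<open>e k\<close>.\<close>

lemma binomial_poly_large_zero:
  assumes e: "fin_supp e" and z: "for_large (\<lambda>n. binomial_poly e n = 0)"
  shows "e = (\<lambda>_. 0)"
proof (rule ccontr)
  assume "e \<noteq> (\<lambda>_. 0)"
  then have ne: "{k. e k \<noteq> 0} \<noteq> {}" by auto
  define deg where "deg = (\<lambda>k :: 'a \<Rightarrow> nat. \<Sum>i\<in>UNIV. k i)"
  have "\<exists>k\<in>{k. e k \<noteq> 0}. deg k = Max (deg ` {k. e k \<noteq> 0})"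
    using Max_in[of "deg ` {k. e k \<noteq> 0}"] e ne by (metis (no_types, lifting) finite_imageI image_iff image_is_empty)
  then obtain k where k: "e k \<noteq> 0" "deg k = Max (deg ` {k. e k \<noteq> 0})" by auto
  have zk: "for_large (\<lambda>n. binomial_poly (shift k e) n = 0)" for k
  proof (induction k rule: deg_induct)
    case zero
    then show ?case using z by (simp add: shift_def)
  next
    case (step k j)
    have s: "shift (unit_vec j) (shift k e) = shift (k + unit_vec j) e"
      by (simp add: shift_def fun_eq_iff add.commute add.left_commute)
    have "for_large (\<lambda>n. binomial_poly (shift k e) n = 0 \<and> binomial_poly (shift k e) (n + unit_vec j) = 0)"
      by (rule for_large_conj[OF step for_large_shift[OF step]])
    then have "for_large (\<lambda>n. binomial_poly (shift (unit_vec j) (shift k e)) (n + unit_vec j) = 0)"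
      by (rule for_large_mono) (simp add: binomial_poly_shift[OF fin_supp_shift[OF e], symmetric])
    then show ?case unfolding s by (rule for_large_unshift)
  qed
  have c: "shift k e h = 0" if "h \<noteq> 0" for h
  proof (rule ccontr)
    assume "shift k e h \<noteq> 0"
    then have "deg (h + k) \<le> deg k" unfolding k(2) using e by (intro Max_ge) (auto simp: shift_def)
    then have "deg h = 0" by (simp add: deg_def sum.distrib plus_fun_apply)
    then show False using that by (auto simp: deg_def fun_eq_iff zero_fun_apply)
  qed
  obtain n where "binomial_poly (shift k e) n = 0" using for_large_ex[OF zk] by blast
  then have "shift k e 0 = 0" using binomial_poly_const[of "shift k e" n, OF c] by simp
  then show False using k(1) by (simp add: shift_def)
qed

lemma binomial_poly_large_eq:
  assumes "fin_supp e" "fin_supp e'" "for_large (\<lambda>n. binomial_poly e n = binomial_poly e' n)"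
  shows "e = e'"
proof -
  have "(\<lambda>k. e k - e' k) = (\<lambda>_. 0)"
    by (rule binomial_poly_large_zero[OF fin_supp_diff[OF assms(1,2)]])
      (rule for_large_mono[OF assms(3)], simp add: binomial_poly_diff[OF assms(1,2)])
  then show ?thesis by (simp add: fun_eq_iff)
qed

text \<open>A function all of whose partial differences are eventually polynomial is eventually
  polynomial: antidifferences along different directions fit together because the mixed second
  differences agree.\<close>

lemma eventually_polynomial_if_differences:
  fixes f :: "('d::finite \<Rightarrow> nat) \<Rightarrow> int"
  assumes E: "\<And>j. fin_supp (E j)"
    and diff: "\<And>j. for_large (\<lambda>n. f (n + unit_vec j) - f n = binomial_poly (E j) (n + unit_vec j))"
  shows "\<exists>e. fin_supp e \<and> for_large (\<lambda>n. f n = binomial_poly e n)"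
proof -
  have mixed: "shift (unit_vec i) (E j) = shift (unit_vec j) (E i)" for i j
  proof (rule binomial_poly_large_eq[OF fin_supp_shift[OF E] fin_supp_shift[OF E]])
    let ?i = "unit_vec i :: 'd \<Rightarrow> nat" and ?j = "unit_vec j :: 'd \<Rightarrow> nat"
    have "for_large (\<lambda>n. (f (n + ?i) - f n = binomial_poly (E i) (n + ?i) \<and>
        f (n + ?j + ?i) - f (n + ?j) = binomial_poly (E i) (n + ?j + ?i)) \<and>
        (f (n + ?j) - f n = binomial_poly (E j) (n + ?j) \<and>
        f (n + ?i + ?j) - f (n + ?i) = binomial_poly (E j) (n + ?i + ?j)))"
      by (intro for_large_conj diff for_large_shift[OF diff])
    then have "for_large (\<lambda>n. binomial_poly (shift ?i (E j)) (n + (?i + ?j)) = binomial_poly (shift ?j (E i)) (n + (?i + ?j)))"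
    proof (rule for_large_mono)
      fix n
      assume a: "(f (n + ?i) - f n = binomial_poly (E i) (n + ?i) \<and>
        f (n + ?j + ?i) - f (n + ?j) = binomial_poly (E i) (n + ?j + ?i)) \<and>
        (f (n + ?j) - f n = binomial_poly (E j) (n + ?j) \<and>
        f (n + ?i + ?j) - f (n + ?i) = binomial_poly (E j) (n + ?i + ?j))"
      have "n + ?j + ?i = n + (?i + ?j)" "n + ?i + ?j = n + (?i + ?j)" by (simp_all add: ac_simps)
      then show "binomial_poly (shift ?i (E j)) (n + (?i + ?j)) = binomial_poly (shift ?j (E i)) (n + (?i + ?j))"
        using a binomial_poly_shift[OF E[of j], of "n + ?j" i] binomial_poly_shift[OF E[of i], of "n + ?i" j]
        by simp
    qed
    then show "for_large (\<lambda>n. binomial_poly (shift ?i (E j)) n = binomial_poly (shift ?j (E i)) n)"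
      by (rule for_large_unshift)
  qed
  \<comment> \<open>The coefficient at \<open>k\<close> is read off from a direction in which \<open>k\<close> is positive; the choice
    does not matter by the equality of mixed differences.\<close>
  define idx where "idx = (\<lambda>k :: 'd \<Rightarrow> nat. SOME i. k i > 0)"
  define e where "e = (\<lambda>k. if k = 0 then 0 else E (idx k) (k - unit_vec (idx k)))"
  have idx: "k (idx k) > 0" if "k \<noteq> 0" for k
  proof -
    have "\<exists>i. k i > 0" using that by (metis gr0I ext zero_fun_apply)
    then show ?thesis unfolding idx_def by (rule someI_ex)
  qed
  have sh: "shift (unit_vec j) e = E j" for j
  proof
    fix k
    let ?k = "k + unit_vec j"
    have pos: "?k j > 0" by (simp add: plus_fun_apply unit_vec_def)
    then have nz: "?k \<noteq> 0" by (metis less_irrefl zero_fun_apply)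
    have e: "shift (unit_vec j) e k = E (idx ?k) (?k - unit_vec (idx ?k))"
      unfolding shift_def e_def by (rule if_not_P[OF nz])
    show "shift (unit_vec j) e k = E j k"
    proof (cases "idx ?k = j")
      case True
      then show ?thesis using e by (simp add: add.commute[of k])
    next
      case False
      define i where "i = idx ?k"
      have "?k i > 0" using idx[OF nz] by (simp add: i_def)
      then have ki: "k i > 0" using False by (simp add: plus_fun_apply unit_vec_def i_def)
      define l where "l = k - unit_vec i"
      have k: "k = l + unit_vec i" using deg_split[of k i, OF ki] by (simp add: l_def)
      have "?k - unit_vec i = l + unit_vec j"
        unfolding k by (metis add.commute add.left_commute deg_add_diff_cancel)
      then have "shift (unit_vec j) e k = shift (unit_vec j) (E i) l" using e by (simp add: i_def[symmetric] shift_def)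
      also have "\<dots> = E j k" using mixed[of j i] unfolding k by (simp add: shift_def fun_eq_iff)
      finally show ?thesis .
    qed
  qed
  have "{k. e k \<noteq> 0} \<subseteq> (\<Union>j. (\<lambda>h. h + unit_vec j) ` {h. E j h \<noteq> 0})"
  proof
    fix k assume "k \<in> {k. e k \<noteq> 0}"
    then have "k \<noteq> 0" "E (idx k) (k - unit_vec (idx k)) \<noteq> 0" by (auto simp: e_def split: if_splits)
    then show "k \<in> (\<Union>j. (\<lambda>h. h + unit_vec j) ` {h. E j h \<noteq> 0})"
      using deg_split[of k "idx k"] idx[of k]
      by (intro UN_I[of "idx k"] image_eqI[of _ _ "k - unit_vec (idx k)"]) auto
  qed
  moreover have "finite (\<Union>j. (\<lambda>h. h + unit_vec j) ` {h. E j h \<noteq> 0})" using E by simp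
  ultimately have efin: "fin_supp e" by (rule finite_subset)
  define g where "g = (\<lambda>n. f n - binomial_poly e n)"
  have gl: "for_large (\<lambda>n. g (n + unit_vec j) = g n)" for j
    by (rule for_large_mono[OF diff[of j]])
      (use binomial_poly_shift[OF efin] in \<open>simp add: sh g_def algebra_simps\<close>)
  then have "\<forall>j. \<exists>N. \<forall>n\<ge>N. g (n + unit_vec j) = g n" unfolding for_large_def by blast
  then obtain L where L: "\<And>j n. n \<ge> L j \<Longrightarrow> g (n + unit_vec j) = g n" by metis
  define N where "N = (\<lambda>i :: 'd. \<Sum>j\<in>UNIV. L j i)"
  have LN: "L j \<le> N" for j by (auto simp: le_fun_def N_def intro: member_le_sum)
  have gN: "g (N + k) = g N" for k
  proof (induction k rule: deg_induct)
    case (step k j)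
    have "L j \<le> N + k" using LN deg_le_add(1) by (rule order_trans)
    then show ?case using L step by (simp add: add.assoc[symmetric])
  qed simp
  \<comment> \<open>The antidifference is determined up to a constant, which enters as the coefficient at
    exponent \<open>0\<close>.\<close>
  define e' where "e' = (\<lambda>k :: 'd \<Rightarrow> nat. if k = 0 then g N else 0)"
  have e'fin: "fin_supp e'" by (rule finite_subset[of _ "{0}"]) (auto simp: e'_def)
  have "f n = binomial_poly (\<lambda>k. e k + e' k) n" if "n \<ge> N" for n
  proof -
    have "g n = g N" using gN[of "n - N"] deg_add_diff[OF that] by simp
    then show ?thesis
      using binomial_poly_add[OF efin e'fin, of n] binomial_poly_const[of e' n] by (simp add: g_def e'_def)
  qed
  then have "for_large (\<lambda>n. f n = binomial_poly (\<lambda>k. e k + e' k) n)" unfolding for_large_def by blast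
  then show ?thesis using fin_supp_add[OF efin e'fin] by (intro exI[of _ "\<lambda>k. e k + e' k"]) simp
qed

section \<open>Noetherian induction\<close>

lemma acc_maximal:
  fixes M :: "('a, 'b, 'e) module_scheme"
  assumes a: "acc M X E" and ne: "N0 \<in> Q" and Q: "\<And>N. N \<in> Q \<Longrightarrow> stable M X N \<and> N \<subseteq> E"
  shows "\<exists>N\<in>Q. \<forall>K\<in>Q. N \<subseteq> K \<longrightarrow> K = N"
proof (rule ccontr)
  assume "\<not> ?thesis"
  then have step: "\<exists>K. K \<in> Q \<and> N \<subset> K" if "N \<in> Q" for N using that by blast
  have "\<exists>f :: nat \<Rightarrow> 'b set. \<forall>n. f n \<in> Q \<and> f n \<subset> f (Suc n)"
    by (rule dependent_nat_choice) (use ne step in blast)+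
  then obtain f :: "nat \<Rightarrow> 'b set" where f: "\<And>n. f n \<in> Q" "\<And>n. f n \<subset> f (Suc n)" by blast
  have "\<exists>n. \<forall>m\<ge>n. f m = f n"
    by (rule accD[OF a]) (use f(1) Q f(2)[THEN psubset_imp_subset] in simp_all)
  then obtain n where "f (Suc n) = f n" by (metis le_SucI order_refl)
  then show False using f(2)[of n] by simp
qed

lemma acc_induct:
  assumes a: "acc M X E" and N: "Q N" and Q: "\<And>N. Q N \<Longrightarrow> stable M X N \<and> N \<subseteq> E"
    and step: "\<And>N. Q N \<Longrightarrow> (\<And>K. Q K \<Longrightarrow> N \<subset> K \<Longrightarrow> \<Phi> K) \<Longrightarrow> \<Phi> N"
  shows "\<Phi> N"
proof (rule ccontr)
  assume "\<not> \<Phi> N"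
  then have "N \<in> {K. Q K \<and> \<not> \<Phi> K}" using N by simp
  then obtain L where L: "Q L" "\<not> \<Phi> L" and max: "\<And>K. Q K \<Longrightarrow> \<not> \<Phi> K \<Longrightarrow> L \<subseteq> K \<Longrightarrow> K = L"
    using acc_maximal[OF a, of N "{K. Q K \<and> \<not> \<Phi> K}"] Q by blast
  have "\<Phi> L" by (rule step[OF L(1)]) (use max in blast)
  then show False using L(2) by simp
qed

section \<open>Devissage\<close>

text \<open>The properties of a standard graded algebra over an Artinian local ring with infinite
  residue field on which the argument rests. The operators \<open>X\<close> are the image of the
  coefficient ring. That \<open>R\<close> is generated in total degree one enters through primes: a
  homogeneous prime with \<open>R\<^sub>j \<subseteq> P\<close> contains all pieces of degree \<open>n\<close> with \<open>n\<^sub>j > 0\<close>. The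
  infinite residue field enters through the avoidance of finitely many primes inside
  \<open>R\<^sub>j\<close>.\<close>

locale noetherian_graded_module = graded_module +
  fixes X :: "'a set"
  assumes X0: "X \<subseteq> RG 0" and fin: "fin_len M X {\<zero>\<^bsub>M\<^esub>} (MG n)"
    and accM: "acc M (carrier R) (carrier M)"
    and accR: "acc (ring_module R) (carrier R) (carrier R)"
    and gen: "primeideal P R \<Longrightarrow> graded_ideal P \<Longrightarrow> RG (unit_vec j) \<subseteq> P \<Longrightarrow> n j > 0 \<Longrightarrow> RG n \<subseteq> P"
    and avoid: "finite \<P> \<Longrightarrow>
      (\<And>P. P \<in> \<P> \<Longrightarrow> primeideal P R \<and> \<not> RG (unit_vec j) \<subseteq> P) \<Longrightarrow>
      \<exists>x\<in>RG (unit_vec j). \<forall>P\<in>\<P>. x \<notin> P"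
begin

lemma X: "X \<subseteq> carrier R"
  using X0 RG.piece(1) by blast

lemma stable_piece: "graded_sub N \<Longrightarrow> stable M X (N \<inter> MG n)"
  by (rule stable_Int[OF stable_mono[OF graded_sub_stable X] stable_degree[OF X0]])

lemma fin_piece: "graded_sub N \<Longrightarrow> fin_len M X (N \<inter> MG n) (K \<inter> MG n)"
  by (rule fin_len_subinterval[OF fin[of n]]) (use graded_subD(2) MG.piece(2) in auto)

text \<open>The length of the degree \<open>n\<close> piece of \<open>K / N\<close> over the coefficient ring.\<close>

definition piece_len :: "'c set \<Rightarrow> 'c set \<Rightarrow> ('e \<Rightarrow> nat) \<Rightarrow> nat" where
  "piece_len N K n = len M X (N \<inter> MG n) (K \<inter> MG n)"

lemma piece_len_add:
  assumes "graded_sub a" "graded_sub b" "graded_sub c" "a \<subseteq> b" "b \<subseteq> c"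
  shows "piece_len a c n = piece_len a b n + piece_len b c n"
  unfolding piece_len_def
  by (rule len_add[OF X]) (use assms in \<open>auto intro: stable_piece fin_piece\<close>)

lemma piece_len_eq_0_iff:
  assumes "graded_sub a" "graded_sub b" "a \<subseteq> b"
  shows "piece_len a b n = 0 \<longleftrightarrow> b \<inter> MG n \<subseteq> a"
proof -
  have "piece_len a b n = 0 \<longleftrightarrow> a \<inter> MG n = b \<inter> MG n"
    unfolding piece_len_def by (rule len_eq_0_iff) (use assms in \<open>auto intro: stable_piece fin_piece\<close>)
  then show ?thesis using assms(3) by blast
qed

text \<open>Multiplication by \<open>x\<close> of degree \<open>k\<close> carries \<open>N / (N' : x)\<close> isomorphically onto
  \<open>(N' + xN) / N'\<close>, raising degrees by \<open>k\<close>.\<close>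

lemma piece_len_mult:
  assumes x: "x \<in> RG k" and N': "graded_sub N'" and N: "graded_sub N" and le: "N' \<subseteq> N"
  shows "piece_len (colon N' x \<inter> N) N n = piece_len N' (N' <+>\<^bsub>M\<^esub> (\<lambda>m. x \<odot>\<^bsub>M\<^esub> m) ` N) (k + n)"
proof -
  have xc: "x \<in> carrier R" by (rule RG.piece(3)[OF x])
  let ?xN = "(\<lambda>m. x \<odot>\<^bsub>M\<^esub> m) ` N"
  let ?C = "colon N' x \<inter> N" and ?S = "N' <+>\<^bsub>M\<^esub> ?xN"
  have gx: "graded_sub ?xN" by (rule graded_sub_smult_image[OF x N])
  have gC: "graded_sub ?C" by (rule graded_sub_Int[OF graded_sub_colon[OF x N'] N])
  have gS: "graded_sub ?S" by (rule graded_sub_add[OF N' gx])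
  have N'S: "N' \<subseteq> ?S" and xS: "?xN \<subseteq> ?S"
    using set_add_ge1[OF graded_sub_stable[OF N'] graded_sub_stable[OF gx]] set_add_ge2[OF graded_sub_stable[OF N'] graded_sub_stable[OF gx]] .
  have le1: "len M X (?C \<inter> MG n) (N \<inter> MG n) \<le> len M X (N' \<inter> MG (k + n)) (?S \<inter> MG (k + n))"
  proof (rule len_map_le[of M X "N' \<inter> MG (k + n)" "?S \<inter> MG (k + n)" M X _ _
        "\<lambda>H. (N' \<inter> MG (k + n)) <+>\<^bsub>M\<^esub> (\<lambda>m. x \<odot>\<^bsub>M\<^esub> m) ` H"])
    show "fin_len M X (N' \<inter> MG (k + n)) (?S \<inter> MG (k + n))" by (rule fin_piece[OF N'])
    show "stable M X (?C \<inter> MG n)" by (rule stable_piece[OF gC])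
    show "?C \<inter> MG n \<subseteq> N \<inter> MG n" by blast
  next
    fix H assume "H \<in> between M X (?C \<inter> MG n) (N \<inter> MG n)"
    then have H: "stable M X H" "H \<subseteq> N" "H \<subseteq> MG n" by (auto simp: between_def)
    let ?xH = "(\<lambda>m. x \<odot>\<^bsub>M\<^esub> m) ` H"
    have sx: "stable M X ?xH" by (rule stable_smult_image[OF X xc H(1)])
    have "?xH \<subseteq> MG (k + n)" using M_smult[OF x] H(3) by blast
    moreover have "?xH \<subseteq> ?S" using H(2) xS by blast
    ultimately have "(N' \<inter> MG (k + n)) <+>\<^bsub>M\<^esub> ?xH \<subseteq> ?S \<inter> MG (k + n)"
      using N'S by (intro set_add_le[OF stable_piece[OF gS]]) auto
    then show "(N' \<inter> MG (k + n)) <+>\<^bsub>M\<^esub> ?xH \<in> between M X (N' \<inter> MG (k + n)) (?S \<inter> MG (k + n))"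
      using stable_add[OF X stable_piece[OF N'] sx] set_add_ge1[OF stable_piece[OF N'] sx]
      unfolding between_def by blast
  next
    fix H H'
    assume "H \<in> between M X (?C \<inter> MG n) (N \<inter> MG n)" "H' \<in> between M X (?C \<inter> MG n) (N \<inter> MG n)" and lt: "H \<subset> H'"
    then have H: "stable M X H" "?C \<inter> MG n \<subseteq> H" "stable M X H'" "H' \<subseteq> N" "H' \<subseteq> MG n" by (auto simp: between_def)
    let ?f = "\<lambda>H. (N' \<inter> MG (k + n)) <+>\<^bsub>M\<^esub> (\<lambda>m. x \<odot>\<^bsub>M\<^esub> m) ` H"
    obtain y where y: "y \<in> H'" "y \<notin> H" using lt by blast
    have yc: "y \<in> carrier M" using stableD(3)[OF H(3) y(1)] .
    have "x \<odot>\<^bsub>M\<^esub> y \<in> ?f H'"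
      using set_add_ge2[OF stable_piece[OF N'] stable_smult_image[OF X xc H(3)]] y(1) by blast
    moreover have "x \<odot>\<^bsub>M\<^esub> y \<notin> ?f H"
    proof
      assume "x \<odot>\<^bsub>M\<^esub> y \<in> ?f H"
      then obtain h z where h: "h \<in> N'" "z \<in> H" "x \<odot>\<^bsub>M\<^esub> y = h \<oplus>\<^bsub>M\<^esub> x \<odot>\<^bsub>M\<^esub> z" by (auto simp: set_add_iff)
      have hc: "h \<in> carrier M" "z \<in> carrier M" using graded_subD(3)[OF N' h(1)] stableD(3)[OF H(1) h(2)] by auto
      have zH': "z \<in> H'" using h(2) lt by blast
      have "x \<odot>\<^bsub>M\<^esub> (y \<ominus>\<^bsub>M\<^esub> z) = h"
        using h(3) hc yc xc by (simp add: M.minus_eq smult_r_distr smult_r_minus M.a_assoc M.r_neg)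
      moreover have d: "y \<ominus>\<^bsub>M\<^esub> z \<in> H'" using stableD(6)[OF H(3) y(1) zH'] .
      ultimately have "y \<ominus>\<^bsub>M\<^esub> z \<in> ?C \<inter> MG n" using h(1) H(4,5) yc hc by (auto simp: colon_def)
      then have "y \<ominus>\<^bsub>M\<^esub> z \<in> H" using H(2) by blast
      then have "(y \<ominus>\<^bsub>M\<^esub> z) \<oplus>\<^bsub>M\<^esub> z \<in> H" using stableD(4)[OF H(1)] h(2) by blast
      then show False using y(2) yc hc by (simp add: M.minus_eq M.a_assoc M.l_neg)
    qed
    moreover have "?f H \<subseteq> ?f H'" using lt unfolding set_add_def' by blast
    ultimately show "?f H \<subset> ?f H'" by blast
  qed
  have le2: "len M X (N' \<inter> MG (k + n)) (?S \<inter> MG (k + n)) \<le> len M X (?C \<inter> MG n) (N \<inter> MG n)"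
  proof (rule len_map_le[of M X "?C \<inter> MG n" "N \<inter> MG n" M X _ _
        "\<lambda>K. colon K x \<inter> (N \<inter> MG n)"])
    show "fin_len M X (?C \<inter> MG n) (N \<inter> MG n)" by (rule fin_piece[OF gC])
    show "stable M X (N' \<inter> MG (k + n))" by (rule stable_piece[OF N'])
    show "N' \<inter> MG (k + n) \<subseteq> ?S \<inter> MG (k + n)" using N'S by blast
  next
    fix K assume "K \<in> between M X (N' \<inter> MG (k + n)) (?S \<inter> MG (k + n))"
    then have K: "stable M X K" "N' \<inter> MG (k + n) \<subseteq> K" by (auto simp: between_def)
    have "stable M X (colon K x \<inter> (N \<inter> MG n))"
      by (rule stable_Int[OF stable_colon[OF xc K(1) X] stable_piece[OF N]])
    moreover have "?C \<inter> MG n \<subseteq> colon K x \<inter> (N \<inter> MG n)"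
      using K(2) M_smult[OF x] by (auto simp: colon_def)
    ultimately show "colon K x \<inter> (N \<inter> MG n) \<in> between M X (?C \<inter> MG n) (N \<inter> MG n)"
      by (auto simp: between_def)
  next
    fix K K'
    assume "K \<in> between M X (N' \<inter> MG (k + n)) (?S \<inter> MG (k + n))" "K' \<in> between M X (N' \<inter> MG (k + n)) (?S \<inter> MG (k + n))"
      and lt: "K \<subset> K'"
    then have K: "stable M X K" "N' \<inter> MG (k + n) \<subseteq> K" "stable M X K'" "K' \<subseteq> ?S" "K' \<subseteq> MG (k + n)"
      by (auto simp: between_def)
    obtain y where y: "y \<in> K'" "y \<notin> K" using lt by blast
    obtain h z where h: "h \<in> N' \<inter> MG (k + n)" "z \<in> ?xN \<inter> MG (k + n)" "y = h \<oplus>\<^bsub>M\<^esub> z"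
      using piece_set_add[OF N' gx, of y "k + n"] y(1) K(4,5) by blast
    obtain m where m: "m \<in> N \<inter> MG n" "z = x \<odot>\<^bsub>M\<^esub> m" using piece_smult_image[OF N x] h(2) by blast
    have mc: "m \<in> carrier M" "h \<in> carrier M" using MG.piece(3) m(1) h(1) by auto
    have hK: "h \<in> K" using h(1) K(2) by blast
    then have "z \<notin> K" using y(2) h(3) stableD(4)[OF K(1)] by blast
    moreover have "z \<in> K'"
    proof -
      have "y \<ominus>\<^bsub>M\<^esub> h \<in> K'" using stableD(6)[OF K(3) y(1)] hK lt by blast
      moreover have "y \<ominus>\<^bsub>M\<^esub> h = z"
        using mc m(2) xc h(3) by (simp add: M.minus_eq M.a_comm[of h] M.a_assoc M.r_neg)
      ultimately show ?thesis by simp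
    qed
    ultimately show "colon K x \<inter> (N \<inter> MG n) \<subset> colon K' x \<inter> (N \<inter> MG n)"
      using m mc lt unfolding colon_def by blast
  qed
  show ?thesis unfolding piece_len_def using le1 le2 by (rule antisym)
qed

text \<open>The homogeneous primes that do not contain \<open>R\<^sub>+\<^sub>+\<close>: because \<open>R\<close> is generated in total
  degree one, containing \<open>R\<^sub>+\<^sub>+\<close> is the same as containing some \<open>R\<^sub>j\<close>.\<close>

definition relevant :: "'a set \<Rightarrow> bool" where
  "relevant P \<longleftrightarrow> primeideal P R \<and> graded_ideal P \<and> (\<forall>j. \<not> RG (unit_vec j) \<subseteq> P)"

lemma primeideal_facts:
  assumes "primeideal P R"
  shows "P \<subseteq> carrier R" "\<one> \<notin> P" "\<zero> \<in> P" "a \<in> P \<Longrightarrow> b \<in> P \<Longrightarrow> a \<oplus> b \<in> P" "a \<in> P \<Longrightarrow> \<ominus> a \<in> P"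
    "a \<in> P \<Longrightarrow> b \<in> P \<Longrightarrow> a \<ominus> b \<in> P"
    "a \<in> carrier R \<Longrightarrow> b \<in> P \<Longrightarrow> a \<otimes> b \<in> P"
    "a \<in> carrier R \<Longrightarrow> b \<in> carrier R \<Longrightarrow> a \<otimes> b \<in> P \<Longrightarrow> a \<in> P \<or> b \<in> P"
proof -
  interpret primeideal P R by fact
  show "P \<subseteq> carrier R" "\<zero> \<in> P" "a \<in> P \<Longrightarrow> b \<in> P \<Longrightarrow> a \<oplus> b \<in> P" "a \<in> P \<Longrightarrow> \<ominus> a \<in> P"
    "a \<in> P \<Longrightarrow> b \<in> P \<Longrightarrow> a \<ominus> b \<in> P" "a \<in> carrier R \<Longrightarrow> b \<in> P \<Longrightarrow> a \<otimes> b \<in> P"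
    "a \<in> carrier R \<Longrightarrow> b \<in> carrier R \<Longrightarrow> a \<otimes> b \<in> P \<Longrightarrow> a \<in> P \<or> b \<in> P"
    using a_subset I_l_closed I_prime by (auto simp: R.minus_eq)
  show "\<one> \<notin> P" using one_imp_carrier I_notcarr by blast
qed

text \<open>Products of elements of the sets \<open>R\<^sub>j - P\<close> lie outside \<open>P\<close> and reach every degree.\<close>

lemma relevant_piece: "relevant P \<Longrightarrow> \<exists>x\<in>RG n. x \<notin> P"
proof (induction n rule: deg_induct)
  case zero
  then show ?case using one_in_RG0 primeideal_facts(2) by (auto simp: relevant_def)
next
  case (step n j)
  then obtain x where x: "x \<in> RG n" "x \<notin> P" by blast
  obtain y where y: "y \<in> RG (unit_vec j)" "y \<notin> P" using step.prems by (auto simp: relevant_def)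
  have pr: "primeideal P R" using step.prems by (simp add: relevant_def)
  have "x \<otimes> y \<notin> P"
    using primeideal_facts(8)[OF pr RG.piece(3)[OF x(1)] RG.piece(3)[OF y(1)]] x(2) y(2) by blast
  then show ?case using R_mult[OF x(1) y(1)] by blast
qed

text \<open>Among the ideals \<open>(N' : m)\<close> with \<open>m\<close> homogeneous in \<open>N - N'\<close> a maximal one is prime: if
  \<open>t\<close> lies outside it, then \<open>(N' : t m)\<close> is another such ideal above it, hence equal to
  it.\<close>

lemma prime_quotient_exists:
  assumes N': "graded_sub N'" and N: "graded_sub N" and lt: "\<not> N \<subseteq> N'"
  shows "\<exists>a m. m \<in> MG a \<and> m \<in> N \<and> m \<notin> N' \<and> primeideal (conductor N' m) R"
proof -
  obtain y where y: "y \<in> N" "y \<notin> N'" using lt by blast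
  have yc: "y \<in> carrier M" by (rule graded_subD(3)[OF N y(1)])
  obtain a0 where a0: "MG.cmp y a0 \<notin> N'" using graded_sub_cmp_iff[OF N' yc] y(2) by blast
  define Q where "Q = {conductor N' m | m a. m \<in> MG a \<and> m \<in> N \<and> m \<notin> N'}"
  have QI: "conductor N' m \<in> Q" if "m \<in> MG a" "m \<in> N" "m \<notin> N'" for m a
    unfolding Q_def using that by blast
  have "conductor N' (MG.cmp y a0) \<in> Q"
    by (rule QI[OF MG.cmp_in[OF yc] graded_sub_cmp[OF N y(1)] a0])
  moreover have "stable (ring_module R) (carrier R) P \<and> P \<subseteq> carrier R" if "P \<in> Q" for P
  proof -
    obtain m a where "m \<in> MG a" "P = conductor N' m" using \<open>P \<in> Q\<close> unfolding Q_def by blast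
    then show ?thesis using ideal_conductor[OF N'] MG.piece(3) ideal_iff_stable by (auto simp: conductor_def)
  qed
  ultimately have "\<exists>P\<in>Q. \<forall>K\<in>Q. P \<subseteq> K \<longrightarrow> K = P"
    by (rule acc_maximal[OF accR])
  then obtain P where P: "P \<in> Q" "\<forall>K\<in>Q. P \<subseteq> K \<longrightarrow> K = P" by (elim bexE)
  obtain m a where m: "m \<in> MG a" "m \<in> N" "m \<notin> N'" "P = conductor N' m"
    using P(1) unfolding Q_def by blast
  have max: "K = conductor N' m" if "K \<in> Q" "conductor N' m \<subseteq> K" for K
    using P(2) that unfolding m(4) by simp
  have mc: "m \<in> carrier M" by (rule MG.piece(3)[OF m(1)])
  have "primeideal (conductor N' m) R"
  proof (rule prime_if_homogeneous_prime[OF graded_ideal_conductor[OF N' m(1)]])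
    show "\<one> \<notin> conductor N' m" using m(3) mc by (simp add: conductor_def)
    fix s t i j assume st: "s \<in> RG i" "t \<in> RG j" "s \<otimes> t \<in> conductor N' m"
    have c: "s \<in> carrier R" "t \<in> carrier R" using RG.piece(3) st by auto
    show "s \<in> conductor N' m \<or> t \<in> conductor N' m"
    proof (rule disjCI)
      assume "t \<notin> conductor N' m"
      then have tm: "t \<odot>\<^bsub>M\<^esub> m \<notin> N'" using c by (simp add: conductor_def)
      have "conductor N' (t \<odot>\<^bsub>M\<^esub> m) \<in> Q"
        by (rule QI[OF M_smult[OF st(2) m(1)] graded_subD(7)[OF N c(2) m(2)] tm])
      moreover have "conductor N' m \<subseteq> conductor N' (t \<odot>\<^bsub>M\<^esub> m)"
      proof
        fix u assume u: "u \<in> conductor N' m"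
        then have "u \<odot>\<^bsub>M\<^esub> (t \<odot>\<^bsub>M\<^esub> m) = t \<odot>\<^bsub>M\<^esub> (u \<odot>\<^bsub>M\<^esub> m)"
          using c mc R.m_comm by (simp add: conductor_def smult_assoc1[symmetric])
        then show "u \<in> conductor N' (t \<odot>\<^bsub>M\<^esub> m)" using u graded_subD(7)[OF N' c(2)] by (simp add: conductor_def)
      qed
      ultimately have "conductor N' (t \<odot>\<^bsub>M\<^esub> m) = conductor N' m" by (rule max)
      moreover have "s \<in> conductor N' (t \<odot>\<^bsub>M\<^esub> m)"
        using st(3) c mc by (simp add: conductor_def smult_assoc1)
      ultimately show "s \<in> conductor N' m" by simp
    qed
  qed
  then show ?thesis using m by blast
qed

lemma graded_sub_adjoin:
  assumes K: "graded_sub K" and m: "m \<in> MG a"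
  shows "graded_sub (K <+>\<^bsub>M\<^esub> cyclic m)" "K \<subseteq> K <+>\<^bsub>M\<^esub> cyclic m" "m \<in> K <+>\<^bsub>M\<^esub> cyclic m"
    "graded_sub N \<Longrightarrow> K \<subseteq> N \<Longrightarrow> m \<in> N \<Longrightarrow> K <+>\<^bsub>M\<^esub> cyclic m \<subseteq> N"
proof -
  have mc: "m \<in> carrier M" by (rule MG.piece(3)[OF m])
  have g: "graded_sub (cyclic m)" by (rule graded_sub_ideal_smult[OF graded_ideal_carrier m])
  show "graded_sub (K <+>\<^bsub>M\<^esub> cyclic m)" by (rule graded_sub_add[OF K g])
  show "K \<subseteq> K <+>\<^bsub>M\<^esub> cyclic m" by (rule set_add_ge1[OF graded_sub_stable[OF K] graded_sub_stable[OF g]])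
  show "m \<in> K <+>\<^bsub>M\<^esub> cyclic m"
    using set_add_ge2[OF graded_sub_stable[OF K] graded_sub_stable[OF g]] in_cyclic[OF mc] by blast
  show "K <+>\<^bsub>M\<^esub> cyclic m \<subseteq> N" if "graded_sub N" "K \<subseteq> N" "m \<in> N"
    by (rule set_add_le[OF graded_sub_stable[OF that(1)] that(2)]) (use graded_subD(7)[OF that(1) _ that(3)] in blast)
qed

text \<open>Adjoining to \<open>K\<close> a homogeneous \<open>m\<close> with \<open>P = (K : m)\<close> prime adds a quotient isomorphic to
  \<open>R / P\<close> up to a shift of degrees. Repeating this leads from \<open>N'\<close> to \<open>N\<close> by the ascending
  chain condition, so a property of \<open>K\<close>, relative to a fixed \<open>N\<close>, has to be pulled back
  only across one such step.\<close>

theorem devissage: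
  assumes N: "graded_sub N" and N': "graded_sub N'" "N' \<subseteq> N" and base: "\<Phi> N"
    and step: "\<And>K a m. \<lbrakk>graded_sub K; N' \<subseteq> K; K \<subseteq> N; m \<in> MG a; m \<in> N; m \<notin> K;
      primeideal (conductor K m) R; \<Phi> (K <+>\<^bsub>M\<^esub> cyclic m)\<rbrakk> \<Longrightarrow> \<Phi> K"
  shows "\<Phi> N'"
proof (rule acc_induct[OF accM, where Q = "\<lambda>K. graded_sub K \<and> N' \<subseteq> K \<and> K \<subseteq> N"])
  show "graded_sub N' \<and> N' \<subseteq> N' \<and> N' \<subseteq> N" using N' by simp
  show "stable M (carrier R) K \<and> K \<subseteq> carrier M" if "graded_sub K \<and> N' \<subseteq> K \<and> K \<subseteq> N" for K
    using graded_sub_stable stableD(1) that by blast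
  fix K assume K: "graded_sub K \<and> N' \<subseteq> K \<and> K \<subseteq> N"
    and IH: "\<And>L. graded_sub L \<and> N' \<subseteq> L \<and> L \<subseteq> N \<Longrightarrow> K \<subset> L \<Longrightarrow> \<Phi> L"
  show "\<Phi> K"
  proof (cases "N \<subseteq> K")
    case True
    then show ?thesis using K base by auto
  next
    case False
    then obtain a m where m: "m \<in> MG a" "m \<in> N" "m \<notin> K" "primeideal (conductor K m) R"
      using prime_quotient_exists[of K N] K N by blast
    have gK: "graded_sub K" using K by blast
    note adj = graded_sub_adjoin[OF gK m(1)]
    have "K \<subset> K <+>\<^bsub>M\<^esub> cyclic m" using adj(2,3) m(3) by blast
    moreover have "K <+>\<^bsub>M\<^esub> cyclic m \<subseteq> N" using adj(4)[OF N] K m(2) by blast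
    ultimately have "\<Phi> (K <+>\<^bsub>M\<^esub> cyclic m)" using IH adj(1) K by blast
    then show ?thesis using step[OF gK _ _ m] K by blast
  qed
qed

lemma conductor_kills:
  assumes L: "graded_sub L" "K \<subseteq> L" and K: "graded_sub K" and m: "m \<in> carrier M" and s: "s \<in> conductor L m" and y: "y \<in> K <+>\<^bsub>M\<^esub> cyclic m"
  shows "s \<odot>\<^bsub>M\<^esub> y \<in> L"
proof -
  obtain h t where h: "h \<in> K" "t \<in> carrier R" "y = h \<oplus>\<^bsub>M\<^esub> t \<odot>\<^bsub>M\<^esub> m" using y by (auto simp: set_add_iff)
  have sc: "s \<in> carrier R" "s \<odot>\<^bsub>M\<^esub> m \<in> L" using s by (auto simp: conductor_def)
  have "s \<odot>\<^bsub>M\<^esub> y = s \<odot>\<^bsub>M\<^esub> h \<oplus>\<^bsub>M\<^esub> t \<odot>\<^bsub>M\<^esub> (s \<odot>\<^bsub>M\<^esub> m)"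
    using h sc m graded_subD(3)[OF K h(1)] R.m_comm by (simp add: smult_r_distr smult_assoc1[symmetric])
  moreover have "s \<odot>\<^bsub>M\<^esub> h \<in> L" using graded_subD(7)[OF L(1) sc(1)] h(1) L(2) by blast
  ultimately show ?thesis using graded_subD(4)[OF L(1)] graded_subD(7)[OF L(1) h(2) sc(2)] by simp
qed

text \<open>The quotient is a copy of \<open>R / P\<close>, a domain on which \<open>x \<notin> P\<close> acts injectively.\<close>

lemma colon_prime_quotient:
  assumes K: "graded_sub K" and m: "m \<in> MG a" and P: "primeideal (conductor K m) R"
    and x: "x \<in> RG k" "x \<notin> conductor K m"
  shows "colon K x \<inter> (K <+>\<^bsub>M\<^esub> cyclic m) = K"
proof
  have xc: "x \<in> carrier R" by (rule RG.piece(3)[OF x(1)])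
  have mc: "m \<in> carrier M" by (rule MG.piece(3)[OF m])
  show "colon K x \<inter> (K <+>\<^bsub>M\<^esub> cyclic m) \<subseteq> K"
  proof
    fix y assume y: "y \<in> colon K x \<inter> (K <+>\<^bsub>M\<^esub> cyclic m)"
    then obtain h t where h: "h \<in> K" "t \<in> carrier R" "y = h \<oplus>\<^bsub>M\<^esub> t \<odot>\<^bsub>M\<^esub> m" by (auto simp: set_add_iff)
    have hc: "h \<in> carrier M" by (rule graded_subD(3)[OF K h(1)])
    have "x \<odot>\<^bsub>M\<^esub> y \<in> K" using y by (simp add: colon_def)
    then have "x \<odot>\<^bsub>M\<^esub> y \<ominus>\<^bsub>M\<^esub> x \<odot>\<^bsub>M\<^esub> h \<in> K" using graded_subD(6)[OF K] graded_subD(7)[OF K xc h(1)] by blast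
    moreover have "x \<odot>\<^bsub>M\<^esub> y \<ominus>\<^bsub>M\<^esub> x \<odot>\<^bsub>M\<^esub> h = (x \<otimes> t) \<odot>\<^bsub>M\<^esub> m"
      using h(2,3) hc xc mc by (simp add: M.minus_eq smult_r_distr smult_assoc1 M.a_comm[of "x \<odot>\<^bsub>M\<^esub> h"] M.a_assoc M.r_neg)
    ultimately have "x \<otimes> t \<in> conductor K m" using xc h(2) by (simp add: conductor_def)
    then have "t \<in> conductor K m" using primeideal_facts(8)[OF P xc h(2)] x(2) by blast
    then show "y \<in> K" using h(1,3) graded_subD(4)[OF K] by (simp add: conductor_def)
  qed
  show "K \<subseteq> colon K x \<inter> (K <+>\<^bsub>M\<^esub> cyclic m)"
    using graded_sub_adjoin(2)[OF K m] graded_subD(7)[OF K xc] graded_subD(3)[OF K] by (auto simp: colon_def)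
qed

text \<open>The quotient is a copy of \<open>R / P\<close> generated in degree \<open>a\<close>, and \<open>P\<close> contains all pieces of
  degree positive in some direction \<open>j\<close>.\<close>

lemma nonrelevant_quotient_vanishes:
  assumes K: "graded_sub K" and m: "m \<in> MG a" and P: "primeideal (conductor K m) R" and np: "\<not> relevant (conductor K m)"
  shows "for_large (\<lambda>n. (K <+>\<^bsub>M\<^esub> cyclic m) \<inter> MG n \<subseteq> K)"
proof -
  obtain j where j: "RG (unit_vec j) \<subseteq> conductor K m"
    using np P graded_ideal_conductor[OF K m] by (auto simp: relevant_def)
  have "(K <+>\<^bsub>M\<^esub> cyclic m) \<inter> MG n \<subseteq> K" if n: "n \<ge> a + unit_vec j" for n
  proof
    fix y assume y: "y \<in> (K <+>\<^bsub>M\<^esub> cyclic m) \<inter> MG n"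
    then obtain h z where h: "h \<in> K" "z \<in> cyclic m" "z \<in> MG n" "y = h \<oplus>\<^bsub>M\<^esub> z"
      using piece_set_add[OF K graded_sub_ideal_smult[OF graded_ideal_carrier m], of y n] by blast
    have an: "a \<le> n" using order_trans[OF deg_le_add(1) n] .
    then obtain s where s: "s \<in> RG (n - a)" "z = s \<odot>\<^bsub>M\<^esub> m" using piece_cyclic[OF m h(2,3)] by auto
    have "a j + 1 \<le> n j" using le_funD[OF n, of j] by (simp add: plus_fun_apply unit_vec_def)
    then have "(n - a) j > 0" by (simp add: minus_apply)
    then have "s \<in> conductor K m" using gen[OF P graded_ideal_conductor[OF K m] j] s(1) by blast
    then have "z \<in> K" using s(2) by (simp add: conductor_def)
    then show "y \<in> K" using h(1,4) graded_subD(4)[OF K] by simp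
  qed
  then show ?thesis unfolding for_large_def by blast
qed

section \<open>Hilbert polynomials\<close>

definition has_coeffs :: "'c set \<Rightarrow> 'c set \<Rightarrow> (('e \<Rightarrow> nat) \<Rightarrow> int) \<Rightarrow> bool" where
  "has_coeffs N K e \<longleftrightarrow> fin_supp e \<and> for_large (\<lambda>n. int (piece_len N K n) = binomial_poly e n)"

lemma has_coeffs_unique:
  assumes "has_coeffs N K e" "has_coeffs N K e'" shows "e = e'"
proof (rule binomial_poly_large_eq)
  have "for_large (\<lambda>n. int (piece_len N K n) = binomial_poly e n \<and> int (piece_len N K n) = binomial_poly e' n)"
    by (intro for_large_conj) (use assms in \<open>simp_all add: has_coeffs_def\<close>)
  then show "for_large (\<lambda>n. binomial_poly e n = binomial_poly e' n)" by (rule for_large_mono) simp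
qed (use assms in \<open>auto simp: has_coeffs_def\<close>)

lemma has_coeffs_add:
  assumes g: "graded_sub a" "graded_sub b" "graded_sub c" "a \<subseteq> b" "b \<subseteq> c" and e: "has_coeffs a b e" "has_coeffs b c e'"
  shows "has_coeffs a c (\<lambda>k. e k + e' k)"
proof -
  have f: "fin_supp e" "fin_supp e'" using e by (auto simp: has_coeffs_def)
  have "for_large (\<lambda>n. int (piece_len a b n) = binomial_poly e n \<and> int (piece_len b c n) = binomial_poly e' n)"
    by (intro for_large_conj) (use e in \<open>simp_all add: has_coeffs_def\<close>)
  then have "for_large (\<lambda>n. int (piece_len a c n) = binomial_poly (\<lambda>k. e k + e' k) n)"
    by (rule for_large_mono) (simp add: piece_len_add[OF g] binomial_poly_add[OF f])
  then show ?thesis using fin_supp_add[OF f] by (simp add: has_coeffs_def)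
qed

lemma has_coeffs_vanishing:
  assumes g: "graded_sub a" "graded_sub b" "a \<subseteq> b" and z: "for_large (\<lambda>n. b \<inter> MG n \<subseteq> a)"
  shows "has_coeffs a b (\<lambda>_. 0)"
proof -
  have "for_large (\<lambda>n. int (piece_len a b n) = 0)"
    by (rule for_large_mono[OF z]) (use piece_len_eq_0_iff[OF g] in simp)
  then show ?thesis by (simp add: has_coeffs_def)
qed

text \<open>Noetherian induction on an ideal \<open>I\<close> that kills \<open>N / N'\<close>. Devissage reduces to a quotient
  \<open>(K + R m) / K\<close> with \<open>P = (K : m) \<supseteq> I\<close> prime. If \<open>P\<close> is strictly larger than \<open>I\<close>, the
  induction hypothesis applies to \<open>P\<close>. If \<open>P\<close> contains some \<open>R\<^sub>j\<close>, the large pieces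
  vanish. Otherwise multiplication by an element \<open>x\<close> of \<open>R\<^sub>j - P\<close> is injective and its
  cokernel is killed by an ideal that contains \<open>P\<close> and \<open>x\<close>, so every partial difference of
  the Hilbert function is eventually polynomial.\<close>

lemma has_coeffs_exist_killed:
  assumes I: "graded_ideal I" and N: "graded_sub N'" "graded_sub N" "N' \<subseteq> N"
    and kill: "\<And>s y. s \<in> I \<Longrightarrow> y \<in> N \<Longrightarrow> s \<odot>\<^bsub>M\<^esub> y \<in> N'"
  shows "\<exists>e. has_coeffs N' N e"
proof -
  have "\<forall>N' N. graded_sub N' \<longrightarrow> graded_sub N \<longrightarrow> N' \<subseteq> N \<longrightarrow> (\<forall>s\<in>I. \<forall>y\<in>N. s \<odot>\<^bsub>M\<^esub> y \<in> N') \<longrightarrow> (\<exists>e. has_coeffs N' N e)"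
  proof (rule acc_induct[OF accR, where Q = graded_ideal, OF I])
    show "stable (ring_module R) (carrier R) J \<and> J \<subseteq> carrier R" if "graded_ideal J" for J
    proof -
      have "stable (ring_module R) (carrier R) J" using that ideal_iff_stable by (simp add: graded_ideal_def)
      then show ?thesis using module.stableD(1)[OF module_ring_module] by fastforce
    qed
    fix I assume I: "graded_ideal I"
      and IH: "\<And>J. graded_ideal J \<Longrightarrow> I \<subset> J \<Longrightarrow>
        \<forall>N' N. graded_sub N' \<longrightarrow> graded_sub N \<longrightarrow> N' \<subseteq> N \<longrightarrow> (\<forall>s\<in>J. \<forall>y\<in>N. s \<odot>\<^bsub>M\<^esub> y \<in> N') \<longrightarrow> (\<exists>e. has_coeffs N' N e)"
    show "\<forall>N' N. graded_sub N' \<longrightarrow> graded_sub N \<longrightarrow> N' \<subseteq> N \<longrightarrow> (\<forall>s\<in>I. \<forall>y\<in>N. s \<odot>\<^bsub>M\<^esub> y \<in> N') \<longrightarrow> (\<exists>e. has_coeffs N' N e)"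
    proof (intro allI impI)
      fix N' N assume N: "graded_sub N'" "graded_sub N" "N' \<subseteq> N" and kill: "\<forall>s\<in>I. \<forall>y\<in>N. s \<odot>\<^bsub>M\<^esub> y \<in> N'"
      show "\<exists>e. has_coeffs N' N e"
      proof (rule devissage[OF N(2,1,3)])
        have "has_coeffs N N (\<lambda>_. 0)" by (rule has_coeffs_vanishing[OF N(2,2)]) (auto intro: for_large_all)
        then show "\<exists>e. has_coeffs N N e" by blast
        fix K a m
        assume K: "graded_sub K" "N' \<subseteq> K" "K \<subseteq> N" and m: "m \<in> MG a" "m \<in> N" "m \<notin> K"
          and P: "primeideal (conductor K m) R" and ind: "\<exists>e. has_coeffs (K <+>\<^bsub>M\<^esub> cyclic m) N e"
        let ?P = "conductor K m" and ?L = "K <+>\<^bsub>M\<^esub> cyclic m"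
        have mc: "m \<in> carrier M" by (rule MG.piece(3)[OF m(1)])
        note adj = graded_sub_adjoin[OF K(1) m(1)]
        have LN: "?L \<subseteq> N" by (rule adj(4)[OF N(2) K(3) m(2)])
        have gP: "graded_ideal ?P" by (rule graded_ideal_conductor[OF K(1) m(1)])
        have IR: "I \<subseteq> carrier R" using I additive_subgroup.a_subset ideal.axioms(1) by (auto simp: graded_ideal_def)
        have IP: "I \<subseteq> ?P" using kill m(2) K(2) IR by (auto simp: conductor_def)
        have killP: "\<forall>s\<in>?P. \<forall>y\<in>?L. s \<odot>\<^bsub>M\<^esub> y \<in> K" using conductor_kills[OF K(1) order_refl K(1) mc] by blast
        have "\<exists>e. has_coeffs K ?L e"
        proof (cases "?P = I \<and> relevant ?P")
          case False
          then consider "I \<subset> ?P" | "\<not> relevant ?P" using IP by blast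
          then show ?thesis
          proof cases
            case 1
            show ?thesis using IH[OF gP 1] K(1) adj(1,2) killP by blast
          next
            case 2
            show ?thesis
              using has_coeffs_vanishing[OF K(1) adj(1,2) nonrelevant_quotient_vanishes[OF K(1) m(1) P 2]] by blast
          qed
        next
          case True
          have "\<forall>j. \<exists>E. fin_supp E \<and> for_large (\<lambda>n. int (piece_len K ?L (n + unit_vec j)) - int (piece_len K ?L n) =
              binomial_poly E (n + unit_vec j))"
          proof
            fix j
            obtain x where x: "x \<in> RG (unit_vec j)" "x \<notin> ?P" using True by (auto simp: relevant_def)
            have xc: "x \<in> carrier R" by (rule RG.piece(3)[OF x(1)])
            let ?xL = "(\<lambda>m. x \<odot>\<^bsub>M\<^esub> m) ` ?L"
            let ?B = "K <+>\<^bsub>M\<^esub> ?xL"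
            have gx: "graded_sub ?xL" by (rule graded_sub_smult_image[OF x(1) adj(1)])
            have gB: "graded_sub ?B" by (rule graded_sub_add[OF K(1) gx])
            have KB: "K \<subseteq> ?B" and xB: "?xL \<subseteq> ?B"
              using set_add_ge1[OF graded_sub_stable[OF K(1)] graded_sub_stable[OF gx]]
                set_add_ge2[OF graded_sub_stable[OF K(1)] graded_sub_stable[OF gx]] .
            have BL: "?B \<subseteq> ?L"
              by (rule set_add_le[OF graded_sub_stable[OF adj(1)] adj(2)]) (use graded_subD(7)[OF adj(1) xc] in blast)
            let ?J = "conductor ?B m"
            have "?P \<subseteq> ?J" using KB by (auto simp: conductor_def)
            moreover have "x \<in> ?J" using xc xB adj(3) by (auto simp: conductor_def)
            ultimately have lt: "I \<subset> ?J" using True x(2) by blast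
            have "\<forall>s\<in>?J. \<forall>y\<in>?L. s \<odot>\<^bsub>M\<^esub> y \<in> ?B" using conductor_kills[OF gB KB K(1) mc] by blast
            then obtain E where E: "has_coeffs ?B ?L E"
              using IH[OF graded_ideal_conductor[OF gB m(1)] lt] gB adj(1) BL by blast
            have "int (piece_len K ?L (n + unit_vec j)) - int (piece_len K ?L n) = int (piece_len ?B ?L (n + unit_vec j))" for n
            proof -
              have "piece_len K ?L n = piece_len K ?B (unit_vec j + n)"
                using piece_len_mult[OF x(1) K(1) adj(1,2), of n] colon_prime_quotient[OF K(1) m(1) P x] by simp
              then show ?thesis using piece_len_add[OF K(1) gB adj(1) KB BL, of "unit_vec j + n"] by (simp add: add.commute)
            qed
            moreover have "for_large (\<lambda>n. int (piece_len ?B ?L (n + unit_vec j)) = binomial_poly E (n + unit_vec j))"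
              using E for_large_shift[of "\<lambda>n. int (piece_len ?B ?L n) = binomial_poly E n"] by (simp add: has_coeffs_def)
            ultimately show "\<exists>E. fin_supp E \<and> for_large (\<lambda>n. int (piece_len K ?L (n + unit_vec j)) - int (piece_len K ?L n) =
              binomial_poly E (n + unit_vec j))" using E by (auto simp: has_coeffs_def)
          qed
          from choice[OF this] obtain E where E: "\<forall>j. fin_supp (E j) \<and> for_large (\<lambda>n. int (piece_len K ?L (n + unit_vec j)) - int (piece_len K ?L n) =
              binomial_poly (E j) (n + unit_vec j))" ..
          then show ?thesis
            using eventually_polynomial_if_differences[of E "\<lambda>n. int (piece_len K ?L n)"] by (simp add: has_coeffs_def)
        qed
        then show "\<exists>e. has_coeffs K N e" using ind has_coeffs_add[OF K(1) adj(1) N(2) adj(2) LN] by blast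
      qed
    qed
  qed
  then show ?thesis using N kill by blast
qed

theorem has_coeffs_exist:
  assumes N: "graded_sub N'" "graded_sub N" "N' \<subseteq> N"
  shows "\<exists>e. has_coeffs N' N e"
proof (rule has_coeffs_exist_killed[OF _ N])
  show "graded_ideal {\<zero>}" using zeroideal by (simp add: graded_ideal_def graded_subset_def RG.cmp_zero)
  show "s \<odot>\<^bsub>M\<^esub> y \<in> N'" if "s \<in> {\<zero>}" "y \<in> N" for s y
    using that graded_subD(3)[OF N(2)] graded_subD(2)[OF N(1)] by simp
qed

end

section \<open>Dimensions and types of sequences\<close>

lemma chain_dim_empty: "chain_dim {} = -\<infinity>"
proof -
  have "chain_lengths ({} :: 'a set set) = {}" by (auto simp: chain_lengths_def)
  then show ?thesis unfolding chain_dim_def by (simp add: bot_ereal_def)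
qed

lemma chain_dim_nonneg: "\<C> \<noteq> {} \<Longrightarrow> chain_dim \<C> \<ge> 0"
proof -
  assume "\<C> \<noteq> {}"
  then have "0 \<in> chain_lengths \<C>" using zero_in_chain_lengths by blast
  then have "ereal (real 0) \<le> chain_dim \<C>" unfolding chain_dim_def by (intro Sup_upper) blast
  then show ?thesis by (simp add: zero_ereal_def)
qed

lemma chain_dim_le_0:
  assumes "\<And>P Q. P \<in> \<C> \<Longrightarrow> Q \<in> \<C> \<Longrightarrow> \<not> P \<subset> Q" shows "chain_dim \<C> \<le> 0"
  unfolding chain_dim_def
proof (rule Sup_least)
  fix y assume "y \<in> (\<lambda>n. ereal (real n)) ` chain_lengths \<C>"
  then obtain n where n: "n \<in> chain_lengths \<C>" "y = ereal (real n)" by blast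
  then obtain P :: "nat \<Rightarrow> 'a set" where P: "\<forall>i\<le>n. P i \<in> \<C>" "\<forall>i<n. P i \<subset> P (Suc i)"
    by (auto simp: chain_lengths_def)
  have "n = 0"
  proof (rule ccontr)
    assume "n \<noteq> 0"
    then have "P 0 \<in> \<C>" "P 1 \<in> \<C>" "P 0 \<subset> P 1" using P by auto
    then show False using assms by blast
  qed
  then show "y \<le> 0" using n(2) by (simp add: zero_ereal_def)
qed

lemma chain_dim_eq_0: "chain_dim \<C> \<le> 0 \<Longrightarrow> chain_dim \<C> = 0 \<longleftrightarrow> \<C> \<noteq> {}"
  using chain_dim_nonneg[of \<C>] by (cases "\<C> = {}") (auto simp: chain_dim_empty)

text \<open>The type of a sequence whose members lie in the directions listed.\<close>

fun type_of :: "'d list \<Rightarrow> 'd \<Rightarrow> nat" where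
  "type_of [] = 0"
| "type_of (j # js) = unit_vec j + type_of js"

lemma type_of_snoc: "type_of (js @ [j]) = type_of js + unit_vec j"
  by (induction js) (simp_all add: ac_simps)

lemma type_of_count: "type_of js i = count_list js i"
  by (induction js) (auto simp: plus_fun_apply zero_fun_apply unit_vec_def)

lemma type_of_surj: "\<exists>js. type_of js = (k :: 'd::finite \<Rightarrow> nat)"
proof (induction k rule: deg_induct)
  case zero
  then show ?case by (intro exI[of _ "[]"]) simp
next
  case (step k j)
  then show ?case by (metis type_of_snoc)
qed

lemma shift_shift: "shift k (shift l e) = shift (k + l) e"
  by (simp add: shift_def add.assoc)

context noetherian_graded_module
begin

section \<open>Filter-regular elements\<close>

abbreviation of_degrees :: "'a list \<Rightarrow> 'e list \<Rightarrow> bool" where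
  "of_degrees \<equiv> list_all2 (\<lambda>x j. x \<in> RG (unit_vec j))"

text \<open>Filter-regularity of \<open>x\<close> with respect to \<open>M / N\<close>.\<close>

definition filter_reg :: "'c set \<Rightarrow> 'a \<Rightarrow> bool" where
  "filter_reg N x \<longleftrightarrow> for_large (\<lambda>n. \<forall>m\<in>MG n. x \<odot>\<^bsub>M\<^esub> m \<in> N \<longrightarrow> m \<in> N)"

text \<open>By devissage there are finitely many relevant primes such that each \<open>x\<close> outside all of
  them acts injectively on \<open>M / N\<close> in large degrees: the steps with a relevant prime \<open>P\<close>
  are copies of \<open>R / P\<close>, and the others vanish in large degrees.\<close>

lemma filter_reg_exists:
  assumes N: "graded_sub N" shows "\<exists>x\<in>RG (unit_vec j). filter_reg N x"
proof -
  have "\<exists>\<P>. finite \<P> \<and> (\<forall>P\<in>\<P>. relevant P) \<and> (\<forall>x\<in>RG (unit_vec j). (\<forall>P\<in>\<P>. x \<notin> P) \<longrightarrow> filter_reg N x)"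
  proof (rule devissage[OF graded_sub_carrier N, where \<Phi> = "\<lambda>K. \<exists>\<P>. finite \<P> \<and> (\<forall>P\<in>\<P>. relevant P) \<and>
      (\<forall>x\<in>RG (unit_vec j). (\<forall>P\<in>\<P>. x \<notin> P) \<longrightarrow> filter_reg K x)"])
    show "N \<subseteq> carrier M" using graded_subD(1)[OF N] .
    show "\<exists>\<P>. finite \<P> \<and> (\<forall>P\<in>\<P>. relevant P) \<and>
      (\<forall>x\<in>RG (unit_vec j). (\<forall>P\<in>\<P>. x \<notin> P) \<longrightarrow> filter_reg (carrier M) x)"
      by (intro exI[of _ "{}"]) (use MG.piece(3) in \<open>auto simp: filter_reg_def intro!: for_large_all\<close>)
    fix K a m
    assume K: "graded_sub K" and m: "m \<in> MG a" and P: "primeideal (conductor K m) R"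
      and ind: "\<exists>\<P>. finite \<P> \<and> (\<forall>P\<in>\<P>. relevant P) \<and>
        (\<forall>x\<in>RG (unit_vec j). (\<forall>P\<in>\<P>. x \<notin> P) \<longrightarrow> filter_reg (K <+>\<^bsub>M\<^esub> cyclic m) x)"
    let ?P = "conductor K m" and ?L = "K <+>\<^bsub>M\<^esub> cyclic m"
    note adj = graded_sub_adjoin[OF K m]
    obtain \<P> where \<P>: "finite \<P>" "\<forall>P\<in>\<P>. relevant P"
      "\<forall>x\<in>RG (unit_vec j). (\<forall>P\<in>\<P>. x \<notin> P) \<longrightarrow> filter_reg ?L x" using ind by (elim exE conjE)
    let ?\<P>' = "\<P> \<union> {P. P = ?P \<and> relevant P}"
    have "filter_reg K x" if x: "x \<in> RG (unit_vec j)" "\<forall>P\<in>?\<P>'. x \<notin> P" for x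
    proof -
      have xL: "for_large (\<lambda>n. \<forall>m\<in>MG n. x \<odot>\<^bsub>M\<^esub> m \<in> ?L \<longrightarrow> m \<in> ?L)"
        using \<P>(3) x by (simp add: filter_reg_def)
      show ?thesis
      proof (cases "relevant ?P")
        case True
        then have c: "colon K x \<inter> ?L = K" using colon_prime_quotient[OF K m P x(1)] x(2) by blast
        show ?thesis unfolding filter_reg_def
        proof (rule for_large_mono[OF xL], intro ballI impI)
          fix n y assume n: "\<forall>m\<in>MG n. x \<odot>\<^bsub>M\<^esub> m \<in> ?L \<longrightarrow> m \<in> ?L" and y: "y \<in> MG n" "x \<odot>\<^bsub>M\<^esub> y \<in> K"
          then have "y \<in> ?L" using adj(2) by blast
          moreover have "y \<in> colon K x" using y MG.piece(3) by (simp add: colon_def)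
          ultimately show "y \<in> K" using c by blast
        qed
      next
        case False
        have "for_large (\<lambda>n. (\<forall>m\<in>MG n. x \<odot>\<^bsub>M\<^esub> m \<in> ?L \<longrightarrow> m \<in> ?L) \<and> ?L \<inter> MG n \<subseteq> K)"
          by (rule for_large_conj[OF xL nonrelevant_quotient_vanishes[OF K m P False]])
        then show ?thesis unfolding filter_reg_def
          by (rule for_large_mono) (use adj(2) in blast)
      qed
    qed
    then show "\<exists>\<P>. finite \<P> \<and> (\<forall>P\<in>\<P>. relevant P) \<and>
        (\<forall>x\<in>RG (unit_vec j). (\<forall>P\<in>\<P>. x \<notin> P) \<longrightarrow> filter_reg K x)"
      using \<P>(1,2) by (intro exI[of _ ?\<P>']) auto
  qed
  then obtain \<P> where \<P>: "finite \<P>" "\<forall>P\<in>\<P>. relevant P"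
    "\<forall>x\<in>RG (unit_vec j). (\<forall>P\<in>\<P>. x \<notin> P) \<longrightarrow> filter_reg N x" by (elim exE conjE)
  have "\<exists>x\<in>RG (unit_vec j). \<forall>P\<in>\<P>. x \<notin> P"
    by (rule avoid[OF \<P>(1)]) (use \<P>(2) in \<open>auto simp: relevant_def\<close>)
  then show ?thesis using \<P>(3) by blast
qed

abbreviation addmul :: "'c set \<Rightarrow> 'a \<Rightarrow> 'c set" where
  "addmul N x \<equiv> N <+>\<^bsub>M\<^esub> (\<lambda>m. x \<odot>\<^bsub>M\<^esub> m) ` carrier M"

lemma graded_sub_addmul:
  assumes N: "graded_sub N" and x: "x \<in> RG k"
  shows "graded_sub (addmul N x)" "N \<subseteq> addmul N x" "(\<lambda>m. x \<odot>\<^bsub>M\<^esub> m) ` carrier M \<subseteq> addmul N x"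
proof -
  have g: "graded_sub ((\<lambda>m. x \<odot>\<^bsub>M\<^esub> m) ` carrier M)" by (rule graded_sub_smult_image[OF x graded_sub_carrier])
  show "graded_sub (addmul N x)" by (rule graded_sub_add[OF N g])
  show "N \<subseteq> addmul N x" by (rule set_add_ge1[OF graded_sub_stable[OF N] graded_sub_stable[OF g]])
  show "(\<lambda>m. x \<odot>\<^bsub>M\<^esub> m) ` carrier M \<subseteq> addmul N x" by (rule set_add_ge2[OF graded_sub_stable[OF N] graded_sub_stable[OF g]])
qed

text \<open>In large degrees the kernel of multiplication by \<open>x\<close> on \<open>M / N\<close> vanishes, so the Hilbert
  polynomial of the cokernel is the difference of that of \<open>M / N\<close>.\<close>

lemma filter_reg_has_coeffs:
  assumes N: "graded_sub N" and x: "x \<in> RG (unit_vec j)" and f: "filter_reg N x" and e: "has_coeffs N (carrier M) e"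
  shows "has_coeffs (addmul N x) (carrier M) (shift (unit_vec j) e)"
proof -
  have NM: "N \<subseteq> carrier M" using graded_subD(1)[OF N] .
  note g = graded_sub_addmul[OF N x]
  have efin: "fin_supp e" using e by (simp add: has_coeffs_def)
  have e0: "for_large (\<lambda>n. int (piece_len N (carrier M) n) = binomial_poly e n)" using e by (simp add: has_coeffs_def)
  have "for_large (\<lambda>n. (int (piece_len N (carrier M) n) = binomial_poly e n \<and>
      int (piece_len N (carrier M) (n + unit_vec j)) = binomial_poly e (n + unit_vec j)) \<and>
      (\<forall>m\<in>MG n. x \<odot>\<^bsub>M\<^esub> m \<in> N \<longrightarrow> m \<in> N))"
    using f unfolding filter_reg_def by (intro for_large_conj e0 for_large_shift[OF e0])
  then have "for_large (\<lambda>n. int (piece_len (addmul N x) (carrier M) (n + unit_vec j)) =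
      binomial_poly (shift (unit_vec j) e) (n + unit_vec j))"
  proof (rule for_large_mono)
    fix n
    assume a: "(int (piece_len N (carrier M) n) = binomial_poly e n \<and>
      int (piece_len N (carrier M) (n + unit_vec j)) = binomial_poly e (n + unit_vec j)) \<and>
      (\<forall>m\<in>MG n. x \<odot>\<^bsub>M\<^esub> m \<in> N \<longrightarrow> m \<in> N)"
    have xc: "x \<in> carrier R" by (rule RG.piece(3)[OF x])
    have "(colon N x \<inter> carrier M) \<inter> MG n = N \<inter> MG n"
      using a graded_subD(7)[OF N xc] MG.piece(3) by (auto simp: colon_def)
    then have "piece_len (colon N x \<inter> carrier M) (carrier M) n = piece_len N (carrier M) n" by (simp add: piece_len_def)
    then have "piece_len N (carrier M) n = piece_len N (addmul N x) (unit_vec j + n)"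
      using piece_len_mult[OF x N graded_sub_carrier NM, of n] by simp
    moreover have "piece_len N (carrier M) (unit_vec j + n) = piece_len N (addmul N x) (unit_vec j + n) + piece_len (addmul N x) (carrier M) (unit_vec j + n)"
      by (rule piece_len_add[OF N g(1) graded_sub_carrier g(2) graded_subD(1)[OF g(1)]])
    ultimately have "int (piece_len (addmul N x) (carrier M) (n + unit_vec j)) = binomial_poly e (n + unit_vec j) - binomial_poly e n"
      using a by (simp add: add.commute)
    then show "int (piece_len (addmul N x) (carrier M) (n + unit_vec j)) = binomial_poly (shift (unit_vec j) e) (n + unit_vec j)"
      using binomial_poly_shift[OF efin] by simp
  qed
  then have "for_large (\<lambda>n. int (piece_len (addmul N x) (carrier M) n) = binomial_poly (shift (unit_vec j) e) n)"
    by (rule for_large_unshift)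
  then show ?thesis using fin_supp_shift[OF efin] by (simp add: has_coeffs_def)
qed

section \<open>Supports\<close>

text \<open>Membership of \<open>P\<close> in the support of \<open>N / N'\<close>: the class of some element of \<open>N\<close> survives
  localization at \<open>P\<close>.\<close>

definition in_supp :: "'c set \<Rightarrow> 'c set \<Rightarrow> 'a set \<Rightarrow> bool" where
  "in_supp N' N P \<longleftrightarrow> (\<exists>m\<in>N. conductor N' m \<subseteq> P)"

lemma in_supp_mono: "in_supp N' N P \<Longrightarrow> N \<subseteq> L \<Longrightarrow> L' \<subseteq> N' \<Longrightarrow> in_supp L' L P"
  unfolding in_supp_def conductor_def by blast

text \<open>Every prime \<open>(K : m)\<close> with \<open>N' \<subseteq> K\<close> that occurs in a devissage of \<open>N / N'\<close> lies in the
  support, so none of them is relevant and every step vanishes in large degrees.\<close>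

lemma vanishing_if_no_support:
  assumes N: "graded_sub N'" "graded_sub N" "N' \<subseteq> N" and no: "\<And>P. relevant P \<Longrightarrow> \<not> in_supp N' N P"
  shows "for_large (\<lambda>n. N \<inter> MG n \<subseteq> N')"
proof (rule devissage[OF N(2,1,3), where \<Phi> = "\<lambda>K. for_large (\<lambda>n. N \<inter> MG n \<subseteq> K)"])
  show "for_large (\<lambda>n. N \<inter> MG n \<subseteq> N)" by (rule for_large_all) blast
  fix K a m
  assume K: "graded_sub K" "N' \<subseteq> K" and m: "m \<in> MG a" "m \<in> N" and P: "primeideal (conductor K m) R"
    and ind: "for_large (\<lambda>n. N \<inter> MG n \<subseteq> K <+>\<^bsub>M\<^esub> cyclic m)"
  have "in_supp N' N (conductor K m)" using m(2) K(2) unfolding in_supp_def conductor_def by blast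
  then have np: "\<not> relevant (conductor K m)" using no by blast
  have "for_large (\<lambda>n. N \<inter> MG n \<subseteq> K <+>\<^bsub>M\<^esub> cyclic m \<and> (K <+>\<^bsub>M\<^esub> cyclic m) \<inter> MG n \<subseteq> K)"
    by (rule for_large_conj[OF ind nonrelevant_quotient_vanishes[OF K(1) m(1) P np]])
  then show "for_large (\<lambda>n. N \<inter> MG n \<subseteq> K)" by (rule for_large_mono) blast
qed

text \<open>If each component of \<open>m\<close> were carried into \<open>N\<close> by an element outside \<open>P\<close>, the product of
  these finitely many elements would carry \<open>m\<close> into \<open>N\<close>.\<close>

lemma homogeneous_witness:
  assumes N: "graded_sub N" and P: "primeideal P R" and m: "m \<in> carrier M" "conductor N m \<subseteq> P"
  shows "\<exists>a. conductor N (MG.cmp m a) \<subseteq> P"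
proof (rule ccontr)
  assume "\<not> ?thesis"
  then have ex: "\<exists>s. s \<in> conductor N (MG.cmp m a) \<and> s \<notin> P" for a by blast
  have fin: "\<exists>s\<in>carrier R. s \<notin> P \<and> (\<forall>a\<in>F. s \<odot>\<^bsub>M\<^esub> MG.cmp m a \<in> N)" if "finite F" for F
    using that
  proof (induction F rule: finite_induct)
    case empty
    then show ?case using primeideal_facts(2)[OF P] by (intro bexI[of _ \<one>]) auto
  next
    case (insert a F)
    then obtain s where s: "s \<in> carrier R" "s \<notin> P" "\<forall>a\<in>F. s \<odot>\<^bsub>M\<^esub> MG.cmp m a \<in> N" by blast
    obtain t where t: "t \<in> carrier R" "t \<notin> P" "t \<odot>\<^bsub>M\<^esub> MG.cmp m a \<in> N" using ex[of a] by (auto simp: conductor_def)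
    have c: "MG.cmp m b \<in> carrier M" for b by (rule MG.cmp_carrier[OF m(1)])
    have "s \<otimes> t \<notin> P" using primeideal_facts(8)[OF P s(1) t(1)] s(2) t(2) by blast
    moreover have "(s \<otimes> t) \<odot>\<^bsub>M\<^esub> MG.cmp m b \<in> N" if "b \<in> insert a F" for b
    proof (cases "b = a")
      case True
      have "(s \<otimes> t) \<odot>\<^bsub>M\<^esub> MG.cmp m b = s \<odot>\<^bsub>M\<^esub> (t \<odot>\<^bsub>M\<^esub> MG.cmp m b)" by (rule smult_assoc1[OF s(1) t(1) c])
      then show ?thesis using graded_subD(7)[OF N s(1) t(3)] True by simp
    next
      case False
      then have b: "s \<odot>\<^bsub>M\<^esub> MG.cmp m b \<in> N" using that s(3) by blast
      have "(s \<otimes> t) \<odot>\<^bsub>M\<^esub> MG.cmp m b = t \<odot>\<^bsub>M\<^esub> (s \<odot>\<^bsub>M\<^esub> MG.cmp m b)"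
        using smult_assoc1[OF t(1) s(1) c] R.m_comm[OF s(1) t(1)] by simp
      then show ?thesis using graded_subD(7)[OF N t(1) b] by simp
    qed
    ultimately show ?case using s(1) t(1) by (intro bexI[of _ "s \<otimes> t"]) auto
  qed
  obtain s where s: "s \<in> carrier R" "s \<notin> P" "\<forall>a\<in>{a. MG.cmp m a \<noteq> \<zero>\<^bsub>M\<^esub>}. s \<odot>\<^bsub>M\<^esub> MG.cmp m a \<in> N"
    using fin[OF MG.finite_support[OF m(1)]] by blast
  let ?C = "colon N s"
  have "stable M (carrier R) ?C" by (rule stable_colon[OF s(1) graded_sub_stable[OF N] order_refl])
  then have "additive_subgroup ?C M" by (simp add: stable_def)
  moreover have "MG.cmp m a \<in> ?C" for a
    using s(1,3) MG.cmp_carrier[OF m(1), of a] graded_subD(2)[OF N] by (cases "MG.cmp m a = \<zero>\<^bsub>M\<^esub>") (auto simp: colon_def)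
  ultimately have "m \<in> ?C" by (rule MG.in_subgroup_if_cmp_in[OF _ m(1)])
  then show False using m(2) s(1,2) by (auto simp: conductor_def colon_def)
qed

text \<open>A homogeneous witness is carried into \<open>N'\<close> by all ring elements of large degree, and a
  relevant prime does not contain all of these.\<close>

lemma no_support_if_vanishing:
  assumes N: "graded_sub N'" "graded_sub N" and z: "for_large (\<lambda>n. N \<inter> MG n \<subseteq> N')" and P: "relevant P"
  shows "\<not> in_supp N' N P"
proof
  assume "in_supp N' N P"
  then obtain m where m: "m \<in> N" "conductor N' m \<subseteq> P" by (auto simp: in_supp_def)
  have pr: "primeideal P R" using P by (simp add: relevant_def)
  have mc: "m \<in> carrier M" by (rule graded_subD(3)[OF N(2) m(1)])
  obtain a where a: "conductor N' (MG.cmp m a) \<subseteq> P" using homogeneous_witness[OF N(1) pr mc m(2)] by blast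
  obtain n where n: "n \<ge> a" "N \<inter> MG n \<subseteq> N'" using for_large_ex[OF z] by blast
  obtain s where s: "s \<in> RG (n - a)" "s \<notin> P" using relevant_piece[OF P] by blast
  have sc: "s \<in> carrier R" by (rule RG.piece(3)[OF s(1)])
  have "n - a + a = n" using deg_add_diff[OF n(1)] by (simp add: add.commute)
  then have "s \<odot>\<^bsub>M\<^esub> MG.cmp m a \<in> MG n" using M_smult[OF s(1) MG.cmp_in[OF mc, of a]] by simp
  moreover have "s \<odot>\<^bsub>M\<^esub> MG.cmp m a \<in> N" using graded_subD(7)[OF N(2) sc graded_sub_cmp[OF N(2) m(1)]] .
  ultimately have "s \<in> conductor N' (MG.cmp m a)" using n(2) sc by (auto simp: conductor_def)
  then show False using a s(2) by blast
qed

text \<open>Since \<open>P\<close> contains \<open>(N : m)\<close>, the module \<open>R m / (P m + N \<inter> R m)\<close> is isomorphic to \<open>R / P\<close>.\<close>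

lemma conductor_add_ideal:
  assumes N: "graded_sub N" and m: "m \<in> MG a" and P: "primeideal P R" and le: "conductor N m \<subseteq> P"
  shows "conductor (N <+>\<^bsub>M\<^esub> (\<lambda>s. s \<odot>\<^bsub>M\<^esub> m) ` P) m = P"
proof
  have mc: "m \<in> carrier M" by (rule MG.piece(3)[OF m])
  note pf = primeideal_facts[OF P]
  show "conductor (N <+>\<^bsub>M\<^esub> (\<lambda>s. s \<odot>\<^bsub>M\<^esub> m) ` P) m \<subseteq> P"
  proof
    fix s assume "s \<in> conductor (N <+>\<^bsub>M\<^esub> (\<lambda>s. s \<odot>\<^bsub>M\<^esub> m) ` P) m"
    then obtain h p where h: "s \<in> carrier R" "h \<in> N" "p \<in> P" "s \<odot>\<^bsub>M\<^esub> m = h \<oplus>\<^bsub>M\<^esub> p \<odot>\<^bsub>M\<^esub> m"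
      by (auto simp: conductor_def set_add_iff)
    have pc: "p \<in> carrier R" using pf(1) h(3) by blast
    have "(s \<ominus> p) \<odot>\<^bsub>M\<^esub> m = h"
      using h pc mc graded_subD(3)[OF N h(2)]
      by (simp add: R.minus_eq smult_l_distr smult_l_minus M.a_assoc M.r_neg)
    then have "s \<ominus> p \<in> conductor N m" using h pc by (simp add: conductor_def)
    then have "(s \<ominus> p) \<oplus> p \<in> P" using le pf(4) h(3) by blast
    then show "s \<in> P" using h(1) pc by (simp add: R.minus_eq R.a_assoc R.l_neg)
  qed
  show "P \<subseteq> conductor (N <+>\<^bsub>M\<^esub> (\<lambda>s. s \<odot>\<^bsub>M\<^esub> m) ` P) m"
  proof
    fix p assume p: "p \<in> P"
    then have pc: "p \<in> carrier R" using pf(1) by blast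
    have "p \<odot>\<^bsub>M\<^esub> m = \<zero>\<^bsub>M\<^esub> \<oplus>\<^bsub>M\<^esub> p \<odot>\<^bsub>M\<^esub> m" using pc mc by simp
    then show "p \<in> conductor (N <+>\<^bsub>M\<^esub> (\<lambda>s. s \<odot>\<^bsub>M\<^esub> m) ` P) m"
      using p pc graded_subD(2)[OF N] unfolding conductor_def set_add_iff by blast
  qed
qed

text \<open>If \<open>P \<subset> Q\<close> are in the support then for a homogeneous \<open>y \<in> Q - P\<close> multiplication by \<open>y\<close> is
  injective on \<open>R / P\<close> and its cokernel surjects onto \<open>R / Q\<close>, whose pieces in large degrees do not
  vanish; so the Hilbert function of \<open>R / P\<close> grows without bound.\<close>

lemma bounded_imp_no_chain:
  assumes N: "graded_sub N" and bound: "for_large (\<lambda>n. piece_len N (carrier M) n \<le> c)"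
    and P: "relevant P" "in_supp N (carrier M) P" and Q: "relevant Q"
  shows "\<not> P \<subset> Q"
proof
  assume PQ: "P \<subset> Q"
  have pP: "primeideal P R" "graded_ideal P" and pQ: "primeideal Q R" "graded_ideal Q" using P Q by (auto simp: relevant_def)
  obtain m0 where m0: "m0 \<in> carrier M" "conductor N m0 \<subseteq> P" using P(2) by (auto simp: in_supp_def)
  obtain a where a: "conductor N (MG.cmp m0 a) \<subseteq> P" using homogeneous_witness[OF N pP(1) m0] by blast
  define m where "m = MG.cmp m0 a"
  have m: "m \<in> MG a" "conductor N m \<subseteq> P" unfolding m_def using MG.cmp_in[OF m0(1)] a by auto
  have mc: "m \<in> carrier M" by (rule MG.piece(3)[OF m(1)])
  let ?N1 = "N <+>\<^bsub>M\<^esub> (\<lambda>s. s \<odot>\<^bsub>M\<^esub> m) ` P" and ?N2 = "N <+>\<^bsub>M\<^esub> (\<lambda>s. s \<odot>\<^bsub>M\<^esub> m) ` Q"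
  let ?L = "?N1 <+>\<^bsub>M\<^esub> cyclic m"
  have gP: "graded_sub ((\<lambda>s. s \<odot>\<^bsub>M\<^esub> m) ` P)" by (rule graded_sub_ideal_smult[OF pP(2) m(1)])
  have gQ: "graded_sub ((\<lambda>s. s \<odot>\<^bsub>M\<^esub> m) ` Q)" by (rule graded_sub_ideal_smult[OF pQ(2) m(1)])
  have g1: "graded_sub ?N1" and g2: "graded_sub ?N2" using graded_sub_add[OF N gP] graded_sub_add[OF N gQ] .
  note adj = graded_sub_adjoin[OF g1 m(1)]
  have N1: "N \<subseteq> ?N1" by (rule set_add_ge1[OF graded_sub_stable[OF N] graded_sub_stable[OF gP]])
  have N12: "?N1 \<subseteq> ?N2" using PQ unfolding set_add_def' by blast
  have N2L: "?N2 \<subseteq> ?L"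
  proof (rule set_add_le[OF graded_sub_stable[OF adj(1)]])
    show "N \<subseteq> ?L" using N1 adj(2) by (rule order_trans)
    show "(\<lambda>s. s \<odot>\<^bsub>M\<^esub> m) ` Q \<subseteq> ?L"
      using graded_subD(7)[OF adj(1) _ adj(3)] primeideal_facts(1)[OF pQ(1)] by blast
  qed
  have ann1: "conductor ?N1 m = P" by (rule conductor_add_ideal[OF N m(1) pP(1) m(2)])
  have ann2: "conductor ?N2 m = Q" by (rule conductor_add_ideal[OF N m(1) pQ(1)]) (use m(2) PQ in blast)
  obtain z where z: "z \<in> Q" "z \<notin> P" using PQ by blast
  have zc: "z \<in> carrier R" using z(1) primeideal_facts(1)[OF pQ(1)] by blast
  have subP: "additive_subgroup P R" using pP(2) ideal.axioms(1) by (auto simp: graded_ideal_def)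
  obtain b where b: "RG.cmp z b \<notin> P" using RG.in_subgroup_if_cmp_in[OF subP zc] z(2) by blast
  define y where "y = RG.cmp z b"
  have y: "y \<in> RG b" "y \<notin> P" "y \<in> Q"
    using RG.cmp_in[OF zc] b pQ(2) z(1) by (auto simp: y_def graded_ideal_def graded_subset_def)
  have yc: "y \<in> carrier R" by (rule RG.piece(3)[OF y(1)])
  let ?yL = "(\<lambda>m. y \<odot>\<^bsub>M\<^esub> m) ` ?L"
  let ?B = "?N1 <+>\<^bsub>M\<^esub> ?yL"
  have gy: "graded_sub ?yL" by (rule graded_sub_smult_image[OF y(1) adj(1)])
  have gB: "graded_sub ?B" by (rule graded_sub_add[OF g1 gy])
  have N1B: "?N1 \<subseteq> ?B" by (rule set_add_ge1[OF graded_sub_stable[OF g1] graded_sub_stable[OF gy]])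
  have BN2: "?B \<subseteq> ?N2"
  proof (rule set_add_le[OF graded_sub_stable[OF g2] N12])
    have "y \<in> conductor ?N2 m" using ann2 y(3) by simp
    then show "?yL \<subseteq> ?N2" using conductor_kills[OF g2 N12 g1 mc] by blast
  qed
  let ?h = "\<lambda>n. piece_len ?N1 ?L n"
  have grow: "?h (b + n) \<ge> Suc (?h n)" if n: "n \<ge> a" for n
  proof -
    have "colon ?N1 y \<inter> ?L = ?N1"
      by (rule colon_prime_quotient[OF g1 m(1) _ y(1)]) (use ann1 pP(1) y(2) in auto)
    then have "?h n = piece_len ?N1 ?B (b + n)" using piece_len_mult[OF y(1) g1 adj(1,2), of n] by simp
    moreover have "?h (b + n) = piece_len ?N1 ?B (b + n) + piece_len ?B ?L (b + n)"
      by (rule piece_len_add[OF g1 gB adj(1) N1B order_trans[OF BN2 N2L]])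
    moreover have "piece_len ?B ?L (b + n) = piece_len ?B ?N2 (b + n) + piece_len ?N2 ?L (b + n)"
      by (rule piece_len_add[OF gB g2 adj(1) BN2 N2L])
    moreover have "piece_len ?N2 ?L (b + n) \<noteq> 0"
    proof
      assume "piece_len ?N2 ?L (b + n) = 0"
      then have v: "?L \<inter> MG (b + n) \<subseteq> ?N2" using piece_len_eq_0_iff[OF g2 adj(1) N2L] by blast
      have bn: "a \<le> b + n" by (rule order_trans[OF n deg_le_add(2)])
      obtain s where s: "s \<in> RG (b + n - a)" "s \<notin> Q" using relevant_piece[OF Q] by blast
      have sc: "s \<in> carrier R" by (rule RG.piece(3)[OF s(1)])
      have "b + n - a + a = b + n" using deg_add_diff[OF bn] by (simp add: add.commute)
      then have "s \<odot>\<^bsub>M\<^esub> m \<in> MG (b + n)" using M_smult[OF s(1) m(1)] by simp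
      moreover have "s \<odot>\<^bsub>M\<^esub> m \<in> ?L" by (rule graded_subD(7)[OF adj(1) sc adj(3)])
      ultimately have "s \<in> conductor ?N2 m" using v sc by (auto simp: conductor_def)
      then show False using ann2 s(2) by simp
    qed
    ultimately show ?thesis by linarith
  qed
  obtain N0 where N0: "\<forall>n\<ge>N0. piece_len N (carrier M) n \<le> c" using bound unfolding for_large_def by blast
  have "\<exists>n. n \<ge> N0 \<and> n \<ge> a \<and> ?h n \<ge> t" for t
  proof (induction t)
    case 0
    show ?case by (intro exI[of _ "N0 + a"]) simp
  next
    case (Suc t)
    then obtain n where n: "n \<ge> N0" "n \<ge> a" "?h n \<ge> t" by blast
    have "b + n \<ge> N0" "b + n \<ge> a" using n(1,2) order_trans[OF _ deg_le_add(2)] by blast+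
    moreover have "?h (b + n) \<ge> Suc t" using grow[OF n(2)] n(3) by linarith
    ultimately show ?case by blast
  qed
  then obtain n where n: "n \<ge> N0" "?h n \<ge> Suc c" by blast
  have "piece_len N (carrier M) n = piece_len N ?N1 n + piece_len ?N1 (carrier M) n"
    by (rule piece_len_add[OF N g1 graded_sub_carrier N1 graded_subD(1)[OF g1]])
  moreover have "piece_len ?N1 (carrier M) n = ?h n + piece_len ?L (carrier M) n"
    by (rule piece_len_add[OF g1 adj(1) graded_sub_carrier adj(2) graded_subD(1)[OF adj(1)]])
  ultimately have "piece_len N (carrier M) n \<ge> Suc c" using n(2) by linarith
  then show False using N0 n(1) by fastforce
qed

text \<open>Nakayama's lemma for the support: among the submodules \<open>K\<close> with \<open>P\<close> in the support of \<open>M / K\<close> a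
  maximal one contains \<open>PM\<close>.\<close>

lemma support_nakayama:
  assumes P: "primeideal P R" and s: "in_supp {\<zero>\<^bsub>M\<^esub>} (carrier M) P"
  shows "\<exists>K. stable M (carrier R) K \<and> (\<forall>p\<in>P. \<forall>m\<in>carrier M. p \<odot>\<^bsub>M\<^esub> m \<in> K) \<and> in_supp K (carrier M) P"
proof -
  note pf = primeideal_facts[OF P]
  define Q where "Q = {K. stable M (carrier R) K \<and> in_supp K (carrier M) P}"
  have "{\<zero>\<^bsub>M\<^esub>} \<in> Q" using s stable_zero by (simp add: Q_def)
  then have "\<exists>K\<in>Q. \<forall>L\<in>Q. K \<subseteq> L \<longrightarrow> L = K"
    by (rule acc_maximal[OF accM]) (auto simp: Q_def dest: stableD(1))
  then obtain K where K: "K \<in> Q" and max: "\<forall>L\<in>Q. K \<subseteq> L \<longrightarrow> L = K" by (elim bexE)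
  have sK: "stable M (carrier R) K" and iK: "in_supp K (carrier M) P" using K by (auto simp: Q_def)
  have "p \<odot>\<^bsub>M\<^esub> m \<in> K" if p: "p \<in> P" and m: "m \<in> carrier M" for p m
  proof (rule ccontr)
    assume no: "p \<odot>\<^bsub>M\<^esub> m \<notin> K"
    have pc: "p \<in> carrier R" using p pf(1) by blast
    let ?n = "p \<odot>\<^bsub>M\<^esub> m"
    have nc: "?n \<in> carrier M" using pc m by simp
    have sC: "stable M (carrier R) (cyclic ?n)" by (rule stable_ideal_smult[OF oneideal nc])
    let ?L = "K <+>\<^bsub>M\<^esub> cyclic ?n"
    have sL: "stable M (carrier R) ?L" by (rule stable_add[OF order_refl sK sC])
    have KL: "K \<subseteq> ?L" by (rule set_add_ge1[OF sK sC])
    have "?n \<in> ?L" using set_add_ge2[OF sK sC] in_cyclic[OF nc] by blast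
    then have "?L \<noteq> K" using no by blast
    then have noL: "\<not> in_supp ?L (carrier M) P" using max sL KL by (auto simp: Q_def)
    then have ex: "\<exists>u. u \<in> conductor ?L v \<and> u \<notin> P" if "v \<in> carrier M" for v
      using that unfolding in_supp_def by blast
    obtain u where u: "u \<in> carrier R" "u \<notin> P" "u \<odot>\<^bsub>M\<^esub> m \<in> ?L" using ex[OF m] by (auto simp: conductor_def)
    then obtain h t where h: "h \<in> K" "t \<in> carrier R" "u \<odot>\<^bsub>M\<^esub> m = h \<oplus>\<^bsub>M\<^esub> t \<odot>\<^bsub>M\<^esub> ?n" by (auto simp: set_add_iff)
    have hc: "h \<in> carrier M" by (rule stableD(3)[OF sK h(1)])
    define w where "w = u \<ominus> t \<otimes> p"
    have wc: "w \<in> carrier R" using u(1) h(2) pc by (simp add: w_def)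
    have wP: "w \<notin> P"
    proof
      assume "w \<in> P"
      then have "w \<oplus> t \<otimes> p \<in> P" using pf(4) pf(7)[OF h(2) p] by blast
      then show False using u(1,2) h(2) pc by (simp add: w_def R.minus_eq R.a_assoc R.l_neg)
    qed
    have "w \<odot>\<^bsub>M\<^esub> m = h"
      using u(1) h(2,3) pc m hc
      by (simp add: w_def R.minus_eq smult_l_distr smult_l_minus smult_assoc1 M.a_assoc M.r_neg)
    then have wn: "w \<odot>\<^bsub>M\<^esub> ?n \<in> K"
      using stableD(7)[OF sK pc h(1)] wc pc m R.m_comm by (metis smult_assoc1)
    have "\<exists>s. s \<in> conductor K v \<and> s \<notin> P" if v: "v \<in> carrier M" for v
    proof -
      obtain s where s: "s \<in> carrier R" "s \<notin> P" "s \<odot>\<^bsub>M\<^esub> v \<in> ?L" using ex[OF v] by (auto simp: conductor_def)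
      then obtain g r where g: "g \<in> K" "r \<in> carrier R" "s \<odot>\<^bsub>M\<^esub> v = g \<oplus>\<^bsub>M\<^esub> r \<odot>\<^bsub>M\<^esub> ?n" by (auto simp: set_add_iff)
      have gc: "g \<in> carrier M" by (rule stableD(3)[OF sK g(1)])
      have "(w \<otimes> s) \<odot>\<^bsub>M\<^esub> v = w \<odot>\<^bsub>M\<^esub> (g \<oplus>\<^bsub>M\<^esub> r \<odot>\<^bsub>M\<^esub> ?n)" using g(3) smult_assoc1[OF wc s(1) v] by simp
      also have "\<dots> = w \<odot>\<^bsub>M\<^esub> g \<oplus>\<^bsub>M\<^esub> w \<odot>\<^bsub>M\<^esub> (r \<odot>\<^bsub>M\<^esub> ?n)" using wc gc g(2) nc by (simp add: smult_r_distr)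
      also have "w \<odot>\<^bsub>M\<^esub> (r \<odot>\<^bsub>M\<^esub> ?n) = r \<odot>\<^bsub>M\<^esub> (w \<odot>\<^bsub>M\<^esub> ?n)"
        using wc g(2) nc R.m_comm by (metis smult_assoc1)
      finally have "(w \<otimes> s) \<odot>\<^bsub>M\<^esub> v \<in> K"
        using stableD(4)[OF sK stableD(7)[OF sK wc g(1)] stableD(7)[OF sK g(2) wn]] by simp
      moreover have "w \<otimes> s \<notin> P" using pf(8)[OF wc s(1)] wP s(2) by blast
      ultimately show ?thesis using wc s(1) by (intro exI[of _ "w \<otimes> s"]) (simp add: conductor_def)
    qed
    then show False using iK unfolding in_supp_def by blast
  qed
  then show ?thesis using sK iK by blast
qed

section \<open>Mixed multiplicity systems\<close>

text \<open>Multiplication by \<open>x\<close> on \<open>N / N'\<close> has cokernel \<open>N / (N' + x N)\<close> and kernel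
  \<open>((N' : x) \<inter> N) / N'\<close>. Both are killed by \<open>x\<close> and supported inside the support of
  \<open>N / N'\<close>, so the induction hypothesis for the remaining elements applies to them. Their
  Hilbert polynomials determine the difference of that of \<open>N / N'\<close> in direction \<open>j\<close>, up to
  a shift of the kernel in degree.\<close>

lemma shift_coeffs_zero:
  assumes "of_degrees xs js"
    and "graded_sub N'" "graded_sub N" "N' \<subseteq> N" "has_coeffs N' N e"
    and "\<And>P. relevant P \<Longrightarrow> set xs \<subseteq> P \<Longrightarrow> \<not> in_supp N' N P"
  shows "shift (type_of js) e = (\<lambda>_. 0)"
  using assms
proof (induction xs js arbitrary: N' N e rule: list_all2_induct)
  case Nil
  have "for_large (\<lambda>n. N \<inter> MG n \<subseteq> N')"
    by (rule vanishing_if_no_support[OF Nil.prems(1-3)]) (use Nil.prems(5) in simp)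
  then have "has_coeffs N' N (\<lambda>_. 0)" by (rule has_coeffs_vanishing[OF Nil.prems(1-3)])
  then have "e = (\<lambda>_. 0)" by (rule has_coeffs_unique[OF Nil.prems(4)])
  then show ?case by (simp add: shift_def)
next
  case (Cons x xs j js)
  note N = Cons.prems(1-3)
  note x = Cons.hyps(1)
  have xc: "x \<in> carrier R" by (rule RG.piece(3)[OF x])
  let ?xN = "(\<lambda>m. x \<odot>\<^bsub>M\<^esub> m) ` N"
  let ?N1 = "N' <+>\<^bsub>M\<^esub> ?xN" and ?N2 = "colon N' x \<inter> N"
  have gx: "graded_sub ?xN" by (rule graded_sub_smult_image[OF x N(2)])
  have g1: "graded_sub ?N1" by (rule graded_sub_add[OF N(1) gx])
  have g2: "graded_sub ?N2" by (rule graded_sub_Int[OF graded_sub_colon[OF x N(1)] N(2)])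
  have l1: "N' \<subseteq> ?N1" "?xN \<subseteq> ?N1"
    using set_add_ge1[OF graded_sub_stable[OF N(1)] graded_sub_stable[OF gx]] set_add_ge2[OF graded_sub_stable[OF N(1)] graded_sub_stable[OF gx]] .
  have l1N: "?N1 \<subseteq> N" by (rule set_add_le[OF graded_sub_stable[OF N(2)] N(3)]) (use graded_subD(7)[OF N(2) xc] in blast)
  have l2: "N' \<subseteq> ?N2" "?N2 \<subseteq> N"
    using N(3) graded_subD(7)[OF N(1) xc] graded_subD(3)[OF N(1)] by (auto simp: colon_def)
  obtain e1 where e1: "has_coeffs ?N1 N e1" using has_coeffs_exist[OF g1 N(2) l1N] by blast
  obtain e2 where e2: "has_coeffs N' ?N2 e2" using has_coeffs_exist[OF N(1) g2 l2(1)] by blast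
  have f: "fin_supp e" "fin_supp e1" "fin_supp e2" using e1 e2 Cons.prems(4) by (auto simp: has_coeffs_def)
  have z1: "shift (type_of js) e1 = (\<lambda>_. 0)"
  proof (rule Cons.IH[OF g1 N(2) l1N e1], rule notI)
    fix P assume P: "relevant P" "set xs \<subseteq> P" "in_supp ?N1 N P"
    then obtain m where m: "m \<in> N" "conductor ?N1 m \<subseteq> P" by (auto simp: in_supp_def)
    have "x \<in> conductor ?N1 m" using m(1) l1(2) xc by (auto simp: conductor_def)
    then have "set (x # xs) \<subseteq> P" using m(2) P(2) by auto
    then show False using Cons.prems(5)[OF P(1)] in_supp_mono[OF P(3) order_refl l1(1)] by blast
  qed
  have z2: "shift (type_of js) e2 = (\<lambda>_. 0)"
  proof (rule Cons.IH[OF N(1) g2 l2(1) e2], rule notI)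
    fix P assume P: "relevant P" "set xs \<subseteq> P" "in_supp N' ?N2 P"
    then obtain m where m: "m \<in> ?N2" "conductor N' m \<subseteq> P" by (auto simp: in_supp_def)
    have "x \<in> conductor N' m" using m(1) xc by (auto simp: conductor_def colon_def)
    then have "set (x # xs) \<subseteq> P" using m(2) P(2) by auto
    then show False using Cons.prems(5)[OF P(1)] in_supp_mono[OF P(3) l2(2) order_refl] by blast
  qed
  let ?u = "unit_vec j"
  have "for_large (\<lambda>n. (int (piece_len N' N n) = binomial_poly e n \<and> int (piece_len N' N (n + ?u)) = binomial_poly e (n + ?u)) \<and>
      int (piece_len ?N1 N (n + ?u)) = binomial_poly e1 (n + ?u) \<and> int (piece_len N' ?N2 n) = binomial_poly e2 n)"
  proof (intro for_large_conj)
    have a: "for_large (\<lambda>n. int (piece_len N' N n) = binomial_poly e n)" using Cons.prems(4) by (simp add: has_coeffs_def)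
    show "for_large (\<lambda>n. int (piece_len N' N n) = binomial_poly e n)" by (rule a)
    show "for_large (\<lambda>n. int (piece_len N' N (n + ?u)) = binomial_poly e (n + ?u))" by (rule for_large_shift[OF a])
    have b: "for_large (\<lambda>n. int (piece_len ?N1 N n) = binomial_poly e1 n)" using e1 by (simp add: has_coeffs_def)
    show "for_large (\<lambda>n. int (piece_len ?N1 N (n + ?u)) = binomial_poly e1 (n + ?u))" by (rule for_large_shift[OF b])
    show "for_large (\<lambda>n. int (piece_len N' ?N2 n) = binomial_poly e2 n)" using e2 by (simp add: has_coeffs_def)
  qed
  then have "for_large (\<lambda>n. binomial_poly (shift ?u e) (n + ?u) =
      binomial_poly (\<lambda>k. (e1 k - e2 k) + shift ?u e2 k) (n + ?u))"
  proof (rule for_large_mono)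
    fix n
    assume a: "(int (piece_len N' N n) = binomial_poly e n \<and> int (piece_len N' N (n + ?u)) = binomial_poly e (n + ?u)) \<and>
      int (piece_len ?N1 N (n + ?u)) = binomial_poly e1 (n + ?u) \<and> int (piece_len N' ?N2 n) = binomial_poly e2 n"
    have "piece_len N' N (?u + n) = piece_len N' ?N1 (?u + n) + piece_len ?N1 N (?u + n)"
      by (rule piece_len_add[OF N(1) g1 N(2) l1(1) l1N])
    moreover have "piece_len ?N2 N n = piece_len N' ?N1 (?u + n)" by (rule piece_len_mult[OF x N])
    moreover have "piece_len N' N n = piece_len N' ?N2 n + piece_len ?N2 N n" by (rule piece_len_add[OF N(1) g2 N(2) l2])
    ultimately have "int (piece_len N' N (n + ?u)) - int (piece_len N' N n) = int (piece_len ?N1 N (n + ?u)) - int (piece_len N' ?N2 n)"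
      by (simp add: add.commute)
    then have "binomial_poly (shift ?u e) (n + ?u) = binomial_poly e1 (n + ?u) - binomial_poly e2 n"
      using a binomial_poly_shift[OF f(1), of n j] by simp
    also have "\<dots> = binomial_poly e1 (n + ?u) - binomial_poly e2 (n + ?u) + binomial_poly (shift ?u e2) (n + ?u)"
      using binomial_poly_shift[OF f(3), of n j] by simp
    also have "\<dots> = binomial_poly (\<lambda>k. (e1 k - e2 k) + shift ?u e2 k) (n + ?u)"
      by (simp add: binomial_poly_add[OF fin_supp_diff[OF f(2,3)] fin_supp_shift[OF f(3)]] binomial_poly_diff[OF f(2,3)])
    finally show "binomial_poly (shift ?u e) (n + ?u) =
      binomial_poly (\<lambda>k. (e1 k - e2 k) + shift ?u e2 k) (n + ?u)" .
  qed
  then have "for_large (\<lambda>n. binomial_poly (shift ?u e) n = binomial_poly (\<lambda>k. (e1 k - e2 k) + shift ?u e2 k) n)"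
    by (rule for_large_unshift)
  then have "shift ?u e = (\<lambda>k. (e1 k - e2 k) + shift ?u e2 k)"
    by (rule binomial_poly_large_eq[OF fin_supp_shift[OF f(1)] fin_supp_add[OF fin_supp_diff[OF f(2,3)] fin_supp_shift[OF f(3)]]])
  then have s: "e (h + ?u) = e1 h - e2 h + e2 (h + ?u)" for h by (simp add: shift_def fun_eq_iff)
  have "e (h + (?u + type_of js)) = 0" for h
  proof -
    have "e1 (h + type_of js) = 0" "e2 (h + type_of js) = 0" "e2 (h + ?u + type_of js) = 0"
      using fun_cong[OF z1, of h] fun_cong[OF z2, of h] fun_cong[OF z2, of "h + ?u"] by (simp_all add: shift_def)
    then show ?thesis using s[of "h + type_of js"] by (simp add: add.assoc add.commute[of ?u] add.left_commute)
  qed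
  then show ?case by (simp add: shift_def)
qed

text \<open>The submodule \<open>(x\<^sub>1, \<dots>, x\<^sub>t) M\<close>, built up from the left as in the definition of a
  filter-regular sequence.\<close>

definition seq_sub :: "'a list \<Rightarrow> 'c set" where
  "seq_sub xs = foldl addmul {\<zero>\<^bsub>M\<^esub>} xs"

lemma seq_sub_snoc: "seq_sub (xs @ [x]) = addmul (seq_sub xs) x"
  by (simp add: seq_sub_def)

lemma graded_sub_seq_sub:
  "of_degrees xs js \<Longrightarrow> graded_sub (seq_sub xs)"
proof (induction xs arbitrary: js rule: rev_induct)
  case Nil
  then show ?case using graded_sub_zero by (simp add: seq_sub_def)
next
  case (snoc x xs)
  then obtain js' j where "js = js' @ [j]" "of_degrees xs js'" "x \<in> RG (unit_vec j)"
    by (auto simp: list_all2_append1 list_all2_Cons1)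
  then show ?case using snoc.IH graded_sub_addmul(1) by (simp add: seq_sub_snoc)
qed

lemma seq_sub_le:
  assumes "stable M (carrier R) K" "\<And>x m. x \<in> set xs \<Longrightarrow> m \<in> carrier M \<Longrightarrow> x \<odot>\<^bsub>M\<^esub> m \<in> K"
  shows "seq_sub xs \<subseteq> K"
  using assms(2)
proof (induction xs rule: rev_induct)
  case Nil
  then show ?case using stableD(2)[OF assms(1)] by (simp add: seq_sub_def)
next
  case (snoc x xs)
  then have "seq_sub xs \<subseteq> K" "(\<lambda>m. x \<odot>\<^bsub>M\<^esub> m) ` carrier M \<subseteq> K" by auto
  then show ?case unfolding seq_sub_snoc by (rule set_add_le[OF assms(1)])
qed

definition filter_reg_seq :: "'a list \<Rightarrow> bool" where
  "filter_reg_seq xs \<longleftrightarrow> (\<forall>i<length xs. filter_reg (seq_sub (take i xs)) (xs ! i))"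

lemma filter_reg_seq_snoc: "filter_reg_seq (xs @ [x]) \<longleftrightarrow> filter_reg_seq xs \<and> filter_reg (seq_sub xs) x"
  by (auto simp: filter_reg_seq_def less_Suc_eq nth_append)

lemma filter_reg_seq_exists:
  "\<exists>xs. of_degrees xs js \<and> filter_reg_seq xs"
proof (induction js rule: rev_induct)
  case Nil
  show ?case by (intro exI[of _ "[]"]) (simp add: filter_reg_seq_def)
next
  case (snoc j js)
  then obtain xs where xs: "of_degrees xs js" "filter_reg_seq xs" by blast
  obtain x where "x \<in> RG (unit_vec j)" "filter_reg (seq_sub xs) x" using filter_reg_exists[OF graded_sub_seq_sub[OF xs(1)]] by blast
  then show ?case using xs by (intro exI[of _ "xs @ [x]"]) (simp add: filter_reg_seq_snoc list_all2_appendI)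
qed

lemma filter_reg_seq_has_coeffs:
  assumes e: "has_coeffs {\<zero>\<^bsub>M\<^esub>} (carrier M) e"
  shows "of_degrees xs js \<Longrightarrow> filter_reg_seq xs \<Longrightarrow>
    has_coeffs (seq_sub xs) (carrier M) (shift (type_of js) e)"
proof (induction xs arbitrary: js rule: rev_induct)
  case Nil
  then show ?case using e by (simp add: seq_sub_def shift_def)
next
  case (snoc x xs)
  then obtain js' j where js: "js = js' @ [j]" "of_degrees xs js'" "x \<in> RG (unit_vec j)"
    by (auto simp: list_all2_append1 list_all2_Cons1)
  have "filter_reg_seq xs" "filter_reg (seq_sub xs) x" using snoc.prems(2) by (auto simp: filter_reg_seq_snoc)
  then have "has_coeffs (seq_sub (xs @ [x])) (carrier M) (shift (unit_vec j) (shift (type_of js') e))"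
    unfolding seq_sub_snoc by (intro filter_reg_has_coeffs[OF graded_sub_seq_sub[OF js(2)] js(3)] snoc.IH[OF js(2)]) auto
  then show ?case by (simp add: js(1) type_of_snoc shift_shift add.commute)
qed

definition supp_set :: "'c set \<Rightarrow> 'a set set" where
  "supp_set N = {P. relevant P \<and> in_supp N (carrier M) P}"

text \<open>Since all coefficients above the type of the sequence vanish, the iterated difference of
  the Hilbert polynomial is the constant \<open>e\<close> at that type. A constant Hilbert function
  bounds the dimension of the support by \<open>0\<close>, and the support is empty exactly if the
  constant is \<open>0\<close>.\<close>

lemma filter_reg_seq_dim:
  assumes e: "has_coeffs {\<zero>\<^bsub>M\<^esub>} (carrier M) e" and def: "\<And>h. h > type_of js \<Longrightarrow> e h = 0"
    and xs: "of_degrees xs js" "filter_reg_seq xs"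
  shows "chain_dim (supp_set (seq_sub xs)) \<le> 0"
    and "chain_dim (supp_set (seq_sub xs)) = 0 \<longleftrightarrow> e (type_of js) > 0"
proof -
  let ?N = "seq_sub xs" and ?k = "type_of js"
  have g: "graded_sub ?N" by (rule graded_sub_seq_sub[OF xs(1)])
  have le: "?N \<subseteq> carrier M" by (rule graded_subD(1)[OF g])
  have "shift ?k e h = 0" if "h \<noteq> 0" for h
  proof -
    have "h + ?k > ?k" using that by (simp add: less_le)
    then show ?thesis using def by (simp add: shift_def)
  qed
  then have "binomial_poly (shift ?k e) n = e ?k" for n
    using binomial_poly_const[of "shift ?k e" n] by (simp add: shift_def)
  then have len: "for_large (\<lambda>n. int (piece_len ?N (carrier M) n) = e ?k)"
    using filter_reg_seq_has_coeffs[OF e xs] by (simp add: has_coeffs_def)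
  have "for_large (\<lambda>n. piece_len ?N (carrier M) n \<le> nat (e ?k))" by (rule for_large_mono[OF len]) linarith
  then show dim: "chain_dim (supp_set ?N) \<le> 0"
    by (intro chain_dim_le_0) (use bounded_imp_no_chain[OF g] in \<open>auto simp: supp_set_def\<close>)
  have "supp_set ?N = {} \<longleftrightarrow> e ?k = 0"
  proof
    assume "supp_set ?N = {}"
    then have "for_large (\<lambda>n. carrier M \<inter> MG n \<subseteq> ?N)"
      by (intro vanishing_if_no_support[OF g graded_sub_carrier le]) (auto simp: supp_set_def)
    then have "for_large (\<lambda>n. int (piece_len ?N (carrier M) n) = e ?k \<and> carrier M \<inter> MG n \<subseteq> ?N)"
      by (rule for_large_conj[OF len])
    then obtain n where "int (piece_len ?N (carrier M) n) = e ?k" "carrier M \<inter> MG n \<subseteq> ?N" using for_large_ex by blast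
    then show "e ?k = 0" using piece_len_eq_0_iff[OF g graded_sub_carrier le, of n] by simp
  next
    assume "e ?k = 0"
    then have "for_large (\<lambda>n. carrier M \<inter> MG n \<subseteq> ?N)"
      using piece_len_eq_0_iff[OF g graded_sub_carrier le] by (intro for_large_mono[OF len]) auto
    then show "supp_set ?N = {}"
      using no_support_if_vanishing[OF g graded_sub_carrier] by (auto simp: supp_set_def)
  qed
  moreover have "e ?k \<ge> 0"
  proof -
    obtain n where "int (piece_len ?N (carrier M) n) = e ?k" using for_large_ex[OF len] by blast
    then show ?thesis by linarith
  qed
  ultimately show "chain_dim (supp_set ?N) = 0 \<longleftrightarrow> e ?k > 0" using chain_dim_eq_0[OF dim] by auto
qed

text \<open>An empty support of \<open>M / (x\<^sub>1, \<dots>, x\<^sub>t) M\<close> would, by Nakayama's lemma, make the iterated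
  difference vanish, whose constant coefficient is \<open>e\<close> at the type of the sequence.\<close>

lemma mixed_system_support:
  assumes e: "has_coeffs {\<zero>\<^bsub>M\<^esub>} (carrier M) e" and xs: "of_degrees xs js"
    and pos: "e (type_of js) > 0"
  shows "supp_set (seq_sub xs) \<noteq> {}"
proof
  assume empty: "supp_set (seq_sub xs) = {}"
  have "shift (type_of js) e = (\<lambda>_. 0)"
  proof (rule shift_coeffs_zero[OF xs graded_sub_zero graded_sub_carrier _ e], simp, rule notI)
    fix P assume P: "relevant P" "set xs \<subseteq> P" "in_supp {\<zero>\<^bsub>M\<^esub>} (carrier M) P"
    obtain K where K: "stable M (carrier R) K" "\<forall>p\<in>P. \<forall>m\<in>carrier M. p \<odot>\<^bsub>M\<^esub> m \<in> K" "in_supp K (carrier M) P"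
      using support_nakayama[OF _ P(3)] P(1) by (auto simp: relevant_def)
    have "seq_sub xs \<subseteq> K" by (rule seq_sub_le[OF K(1)]) (use K(2) P(2) in blast)
    then have "in_supp (seq_sub xs) (carrier M) P" using in_supp_mono[OF K(3) order_refl] by blast
    then show False using empty P(1) by (auto simp: supp_set_def)
  qed
  then have "e (0 + type_of js) = 0" unfolding shift_def by metis
  then show False using pos by simp
qed

end

section \<open>Quotient modules and their localizations\<close>

context noetherian_graded_module
begin

abbreviation coset :: "'c set \<Rightarrow> 'c \<Rightarrow> 'c set" where
  "coset N m \<equiv> N +>\<^bsub>M\<^esub> m"

lemma coset_eq_iff:
  assumes N: "stable M (carrier R) N" and m: "m \<in> carrier M" "m' \<in> carrier M"
  shows "coset N m = coset N m' \<longleftrightarrow> m \<ominus>\<^bsub>M\<^esub> m' \<in> N"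
proof -
  have sub: "subgroup N (add_monoid M)" using N by (simp add: stable_def additive_subgroup_def)
  have le: "N \<subseteq> carrier M" by (rule stableD(1)[OF N])
  have d: "m \<ominus>\<^bsub>M\<^esub> m' \<in> carrier M" using m by simp
  show ?thesis
  proof
    assume "coset N m = coset N m'"
    then have "coset N (m \<ominus>\<^bsub>M\<^esub> m') = N" using M.a_coset_add_inv2[OF _ m le] by (simp add: M.minus_eq)
    then show "m \<ominus>\<^bsub>M\<^esub> m' \<in> N" using M.a_coset_join1[OF _ d sub] by blast
  next
    assume "m \<ominus>\<^bsub>M\<^esub> m' \<in> N"
    then have "coset N (m \<ominus>\<^bsub>M\<^esub> m') = N" using M.a_coset_join2[OF d sub] by blast
    then show "coset N m = coset N m'" using M.a_coset_add_inv1[OF _ m le] by (simp add: M.minus_eq)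
  qed
qed

lemma uminus_zero [simp]: "\<ominus>\<^bsub>M\<^esub> \<zero>\<^bsub>M\<^esub> = \<zero>\<^bsub>M\<^esub>"
  by (rule M.minus_equality) simp_all

lemma coset_zero: "stable M (carrier R) N \<Longrightarrow> coset N \<zero>\<^bsub>M\<^esub> = N"
  using M.a_coset_add_zero stableD(1) by blast

lemma coset_eq_zero_iff:
  "stable M (carrier R) N \<Longrightarrow> m \<in> carrier M \<Longrightarrow> coset N m = N \<longleftrightarrow> m \<in> N"
  using coset_eq_iff[of N m "\<zero>\<^bsub>M\<^esub>"] by (simp add: coset_zero M.minus_eq)

lemma quotient_carrier: "carrier (quotient_module M N) = coset N ` carrier M"
  by (auto simp: quotient_module_def A_RCOSETS_def')

lemma quotient_zero: "zero (quotient_module M N) = N"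
  by (simp add: quotient_module_def)

lemma quotient_smult:
  assumes N: "stable M (carrier R) N" and s: "s \<in> carrier R" and m: "m \<in> carrier M"
  shows "s \<odot>\<^bsub>quotient_module M N\<^esub> coset N m = coset N (s \<odot>\<^bsub>M\<^esub> m)"
proof -
  have "coset N (s \<odot>\<^bsub>M\<^esub> x) = coset N (s \<odot>\<^bsub>M\<^esub> m)" if "x \<in> coset N m" for x
  proof -
    obtain h where h: "h \<in> N" "x = h \<oplus>\<^bsub>M\<^esub> m" using \<open>x \<in> coset N m\<close> by (auto simp: a_r_coset_def')
    have hc: "h \<in> carrier M" by (rule stableD(3)[OF N h(1)])
    have "s \<odot>\<^bsub>M\<^esub> x \<ominus>\<^bsub>M\<^esub> s \<odot>\<^bsub>M\<^esub> m = s \<odot>\<^bsub>M\<^esub> h"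
      using h(2) hc s m by (simp add: smult_r_distr M.minus_eq M.a_assoc M.r_neg)
    then show ?thesis
      using coset_eq_iff[OF N, of "s \<odot>\<^bsub>M\<^esub> x" "s \<odot>\<^bsub>M\<^esub> m"] stableD(7)[OF N s h(1)] h(2) hc s m by simp
  qed
  moreover have "\<zero>\<^bsub>M\<^esub> \<oplus>\<^bsub>M\<^esub> m \<in> coset N m" using stableD(2)[OF N] by (auto simp: a_r_coset_def')
  ultimately have "(\<Union>x\<in>coset N m. coset N (s \<odot>\<^bsub>M\<^esub> x)) = coset N (s \<odot>\<^bsub>M\<^esub> m)" by blast
  then show ?thesis by (simp add: quotient_module_def)
qed

text \<open>If each \<open>m\<close> is carried into \<open>N\<close> by some \<open>t \<notin> P\<close>, then every fraction \<open>m / s\<close> equals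
  \<open>0 / 1\<close>. Otherwise \<open>m / 1\<close> differs from \<open>0 / 1\<close> for an \<open>m\<close> that no element outside \<open>P\<close>
  carries into \<open>N\<close>.\<close>

lemma localization_nonzero_iff:
  assumes N: "stable M (carrier R) N" and P: "primeideal P R"
  shows "carrier (localized_module R (quotient_module M N) P) \<noteq>
      {zero (localized_module R (quotient_module M N) P)} \<longleftrightarrow> in_supp N (carrier M) P"
proof -
  let ?Mq = "quotient_module M N"
  let ?rel = "fraction_rel R ?Mq P"
  note n = stableD[OF N] and pf = primeideal_facts[OF P]
  have one: "\<one> \<in> carrier R - P" using pf(2) by simp
  have mult: "a \<otimes> b \<in> carrier R - P" if "a \<in> carrier R - P" "b \<in> carrier R - P" for a b
    using pf(8)[of a b] that by auto
  have rel: "((coset N m, s), (coset N m', s')) \<in> ?rel \<longleftrightarrow>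
      s \<in> carrier R - P \<and> s' \<in> carrier R - P \<and>
      (\<exists>u\<in>carrier R - P. u \<odot>\<^bsub>M\<^esub> (s' \<odot>\<^bsub>M\<^esub> m) \<ominus>\<^bsub>M\<^esub> u \<odot>\<^bsub>M\<^esub> (s \<odot>\<^bsub>M\<^esub> m') \<in> N)"
    if m: "m \<in> carrier M" "m' \<in> carrier M" for m m' s s'
  proof (cases "s \<in> carrier R - P \<and> s' \<in> carrier R - P")
    case True
    have "u \<odot>\<^bsub>?Mq\<^esub> (s' \<odot>\<^bsub>?Mq\<^esub> coset N m) = u \<odot>\<^bsub>?Mq\<^esub> (s \<odot>\<^bsub>?Mq\<^esub> coset N m') \<longleftrightarrow>
        u \<odot>\<^bsub>M\<^esub> (s' \<odot>\<^bsub>M\<^esub> m) \<ominus>\<^bsub>M\<^esub> u \<odot>\<^bsub>M\<^esub> (s \<odot>\<^bsub>M\<^esub> m') \<in> N" if "u \<in> carrier R - P" for u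
      using True that m by (simp add: quotient_smult[OF N] coset_eq_iff[OF N])
    then show ?thesis
      using True m by (auto simp: fraction_rel_def quotient_carrier)
  qed (auto simp: fraction_rel_def)
  have rel_carrier: "y \<in> carrier ?Mq \<times> (carrier R - P)" if "(x, y) \<in> ?rel" for x y
    using that by (auto simp: fraction_rel_def)
  have carr: "carrier (localized_module R ?Mq P) = (carrier ?Mq \<times> (carrier R - P)) // ?rel"
    and zero: "zero (localized_module R ?Mq P) = ?rel `` {(coset N \<zero>\<^bsub>M\<^esub>, \<one>)}"
    by (simp_all add: localized_module_def quotient_zero coset_zero[OF N])
  have zin: "(coset N \<zero>\<^bsub>M\<^esub>, \<one>) \<in> carrier ?Mq \<times> (carrier R - P)"
    using one by (auto simp: quotient_carrier)
  show ?thesis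
  proof
    assume ne: "carrier (localized_module R ?Mq P) \<noteq> {zero (localized_module R ?Mq P)}"
    show "in_supp N (carrier M) P"
    proof (rule ccontr)
      assume no: "\<not> in_supp N (carrier M) P"
      have "?rel `` {(coset N m, s)} = ?rel `` {(coset N \<zero>\<^bsub>M\<^esub>, \<one>)}"
        if m: "m \<in> carrier M" and s: "s \<in> carrier R - P" for m s
      proof -
        obtain t where t: "t \<in> carrier R - P" "t \<odot>\<^bsub>M\<^esub> m \<in> N"
          using no m unfolding in_supp_def conductor_def by blast
        have tm: "(t \<otimes> a) \<odot>\<^bsub>M\<^esub> m \<in> N" if "a \<in> carrier R" for a
        proof -
          have "(t \<otimes> a) \<odot>\<^bsub>M\<^esub> m = a \<odot>\<^bsub>M\<^esub> (t \<odot>\<^bsub>M\<^esub> m)"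
            using t(1) that m R.m_comm by (metis DiffD1 smult_assoc1)
          then show ?thesis using n(7)[OF that t(2)] by simp
        qed
        have same: "((coset N m, s), (coset N m', s')) \<in> ?rel \<longleftrightarrow> ((coset N \<zero>\<^bsub>M\<^esub>, \<one>), (coset N m', s')) \<in> ?rel"
          if m': "m' \<in> carrier M" and s': "s' \<in> carrier R - P" for m' s'
        proof
          assume "((coset N m, s), (coset N m', s')) \<in> ?rel"
          then obtain u where u: "u \<in> carrier R - P"
            "u \<odot>\<^bsub>M\<^esub> (s' \<odot>\<^bsub>M\<^esub> m) \<ominus>\<^bsub>M\<^esub> u \<odot>\<^bsub>M\<^esub> (s \<odot>\<^bsub>M\<^esub> m') \<in> N" using rel[OF m m'] by blast
          let ?d = "u \<odot>\<^bsub>M\<^esub> (s' \<odot>\<^bsub>M\<^esub> m) \<ominus>\<^bsub>M\<^esub> u \<odot>\<^bsub>M\<^esub> (s \<odot>\<^bsub>M\<^esub> m')"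
          let ?w = "t \<otimes> (u \<otimes> s)"
          have w: "?w \<in> carrier R - P" using mult t(1) u(1) s by blast
          have "t \<odot>\<^bsub>M\<^esub> ?d = (t \<otimes> (u \<otimes> s')) \<odot>\<^bsub>M\<^esub> m \<ominus>\<^bsub>M\<^esub> ?w \<odot>\<^bsub>M\<^esub> m'"
            using t(1) u(1) s s' m m' by (simp add: M.minus_eq smult_r_distr smult_r_minus smult_assoc1)
          moreover have "t \<odot>\<^bsub>M\<^esub> ?d \<in> N" using n(7)[OF _ u(2)] t(1) by blast
          moreover have "(t \<otimes> (u \<otimes> s')) \<odot>\<^bsub>M\<^esub> m \<in> N" using tm u(1) s' by simp
          ultimately have "(t \<otimes> (u \<otimes> s')) \<odot>\<^bsub>M\<^esub> m \<ominus>\<^bsub>M\<^esub> ((t \<otimes> (u \<otimes> s')) \<odot>\<^bsub>M\<^esub> m \<ominus>\<^bsub>M\<^esub> ?w \<odot>\<^bsub>M\<^esub> m') \<in> N"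
            using n(6) by simp
          moreover have "(t \<otimes> (u \<otimes> s')) \<odot>\<^bsub>M\<^esub> m \<ominus>\<^bsub>M\<^esub> ((t \<otimes> (u \<otimes> s')) \<odot>\<^bsub>M\<^esub> m \<ominus>\<^bsub>M\<^esub> ?w \<odot>\<^bsub>M\<^esub> m') = ?w \<odot>\<^bsub>M\<^esub> m'"
            using t(1) u(1) s s' m m' w
            by (simp add: M.minus_eq M.minus_add M.a_assoc[symmetric] M.r_neg)
          ultimately have "?w \<odot>\<^bsub>M\<^esub> m' \<in> N" by simp
          then have "\<ominus>\<^bsub>M\<^esub> (?w \<odot>\<^bsub>M\<^esub> m') \<in> N" by (rule n(5))
          moreover have "?w \<odot>\<^bsub>M\<^esub> (s' \<odot>\<^bsub>M\<^esub> \<zero>\<^bsub>M\<^esub>) \<ominus>\<^bsub>M\<^esub> ?w \<odot>\<^bsub>M\<^esub> (\<one> \<odot>\<^bsub>M\<^esub> m') = \<ominus>\<^bsub>M\<^esub> (?w \<odot>\<^bsub>M\<^esub> m')"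
            using w s' m' by (simp add: M.minus_eq)
          ultimately show "((coset N \<zero>\<^bsub>M\<^esub>, \<one>), (coset N m', s')) \<in> ?rel"
            using rel[OF M.zero_closed m', of \<one> s'] one s' w by metis
        next
          assume "((coset N \<zero>\<^bsub>M\<^esub>, \<one>), (coset N m', s')) \<in> ?rel"
          then obtain w where w: "w \<in> carrier R - P"
            "w \<odot>\<^bsub>M\<^esub> (s' \<odot>\<^bsub>M\<^esub> \<zero>\<^bsub>M\<^esub>) \<ominus>\<^bsub>M\<^esub> w \<odot>\<^bsub>M\<^esub> (\<one> \<odot>\<^bsub>M\<^esub> m') \<in> N"
            using rel[OF M.zero_closed m'] by blast
          then have "\<ominus>\<^bsub>M\<^esub> (w \<odot>\<^bsub>M\<^esub> m') \<in> N" using s' m' by (simp add: M.minus_eq)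
          then have "\<ominus>\<^bsub>M\<^esub> (\<ominus>\<^bsub>M\<^esub> (w \<odot>\<^bsub>M\<^esub> m')) \<in> N" by (rule n(5))
          then have wm: "w \<odot>\<^bsub>M\<^esub> m' \<in> N" using w(1) m' by simp
          have tw: "t \<otimes> w \<in> carrier R - P" using mult t(1) w(1) by blast
          have "(t \<otimes> w) \<odot>\<^bsub>M\<^esub> (s' \<odot>\<^bsub>M\<^esub> m) = (t \<otimes> (w \<otimes> s')) \<odot>\<^bsub>M\<^esub> m"
            using t(1) w(1) s' m by (simp add: smult_assoc1)
          then have a: "(t \<otimes> w) \<odot>\<^bsub>M\<^esub> (s' \<odot>\<^bsub>M\<^esub> m) \<in> N" using tm w(1) s' by simp
          have "(t \<otimes> w) \<odot>\<^bsub>M\<^esub> (s \<odot>\<^bsub>M\<^esub> m') = (t \<otimes> s) \<odot>\<^bsub>M\<^esub> (w \<odot>\<^bsub>M\<^esub> m')"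
            using t(1) w(1) s m' by (simp add: smult_assoc1[symmetric] R.m_ac)
          moreover have "(t \<otimes> s) \<odot>\<^bsub>M\<^esub> (w \<odot>\<^bsub>M\<^esub> m') \<in> N" using n(7)[OF _ wm] t(1) s by simp
          ultimately have "(t \<otimes> w) \<odot>\<^bsub>M\<^esub> (s \<odot>\<^bsub>M\<^esub> m') \<in> N" by simp
          then have "(t \<otimes> w) \<odot>\<^bsub>M\<^esub> (s' \<odot>\<^bsub>M\<^esub> m) \<ominus>\<^bsub>M\<^esub> (t \<otimes> w) \<odot>\<^bsub>M\<^esub> (s \<odot>\<^bsub>M\<^esub> m') \<in> N" by (rule n(6)[OF a])
          then show "((coset N m, s), (coset N m', s')) \<in> ?rel" using rel[OF m m'] s s' tw by blast
        qed
        show ?thesis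
        proof (rule Set.set_eqI)
          fix y
          show "y \<in> ?rel `` {(coset N m, s)} \<longleftrightarrow> y \<in> ?rel `` {(coset N \<zero>\<^bsub>M\<^esub>, \<one>)}"
          proof (cases "y \<in> carrier ?Mq \<times> (carrier R - P)")
            case True
            then obtain m' s' where y: "y = (coset N m', s')" "m' \<in> carrier M" "s' \<in> carrier R - P"
              by (auto simp: quotient_carrier)
            show ?thesis unfolding y(1) Image_singleton_iff by (rule same[OF y(2,3)])
          next
            case False
            then show ?thesis unfolding Image_singleton_iff using rel_carrier by metis
          qed
        qed
      qed
      then have "?rel `` {y} = ?rel `` {(coset N \<zero>\<^bsub>M\<^esub>, \<one>)}" if y: "y \<in> carrier ?Mq \<times> (carrier R - P)" for y
      proof -
        obtain m s where "y = (coset N m, s)" "m \<in> carrier M" "s \<in> carrier R - P"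
          using y by (auto simp: quotient_carrier)
        then show ?thesis using \<open>\<And>m s. \<lbrakk>m \<in> carrier M; s \<in> carrier R - P\<rbrakk> \<Longrightarrow>
          ?rel `` {(coset N m, s)} = ?rel `` {(coset N \<zero>\<^bsub>M\<^esub>, \<one>)}\<close> by metis
      qed
      then have "(carrier ?Mq \<times> (carrier R - P)) // ?rel = {?rel `` {(coset N \<zero>\<^bsub>M\<^esub>, \<one>)}}"
        using zin unfolding quotient_def by blast
      then show False using ne carr zero by simp
    qed
  next
    assume "in_supp N (carrier M) P"
    then obtain m where m: "m \<in> carrier M" "conductor N m \<subseteq> P" by (auto simp: in_supp_def)
    have "(coset N m, \<one>) \<in> carrier ?Mq \<times> (carrier R - P)" using m(1) one by (auto simp: quotient_carrier)
    then have in_carr: "?rel `` {(coset N m, \<one>)} \<in> (carrier ?Mq \<times> (carrier R - P)) // ?rel" by (rule quotientI)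
    have "?rel `` {(coset N m, \<one>)} \<noteq> ?rel `` {(coset N \<zero>\<^bsub>M\<^esub>, \<one>)}"
    proof
      assume eq: "?rel `` {(coset N m, \<one>)} = ?rel `` {(coset N \<zero>\<^bsub>M\<^esub>, \<one>)}"
      have "\<one> \<odot>\<^bsub>M\<^esub> (\<one> \<odot>\<^bsub>M\<^esub> \<zero>\<^bsub>M\<^esub>) \<ominus>\<^bsub>M\<^esub> \<one> \<odot>\<^bsub>M\<^esub> (\<one> \<odot>\<^bsub>M\<^esub> \<zero>\<^bsub>M\<^esub>) \<in> N"
        using n(2) by (simp add: M.minus_eq)
      then have "((coset N \<zero>\<^bsub>M\<^esub>, \<one>), (coset N \<zero>\<^bsub>M\<^esub>, \<one>)) \<in> ?rel"
        using rel[OF M.zero_closed M.zero_closed, of \<one> \<one>] one by metis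
      then have "((coset N m, \<one>), (coset N \<zero>\<^bsub>M\<^esub>, \<one>)) \<in> ?rel" using eq by blast
      then obtain u where u: "u \<in> carrier R - P"
        "u \<odot>\<^bsub>M\<^esub> (\<one> \<odot>\<^bsub>M\<^esub> m) \<ominus>\<^bsub>M\<^esub> u \<odot>\<^bsub>M\<^esub> (\<one> \<odot>\<^bsub>M\<^esub> \<zero>\<^bsub>M\<^esub>) \<in> N" using rel[OF m(1) M.zero_closed] by blast
      then have "u \<odot>\<^bsub>M\<^esub> m \<in> N" using m(1) by (simp add: M.minus_eq)
      then show False using u(1) m(2) by (auto simp: conductor_def)
    qed
    then show "carrier (localized_module R ?Mq P) \<noteq> {zero (localized_module R ?Mq P)}"
      unfolding carr zero using in_carr by (metis singletonD)
  qed
qed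

text \<open>A relevant prime misses an element of degree \<open>(1, \<dots>, 1)\<close>. Conversely, if \<open>R\<^sub>j \<subseteq> P\<close>, then
  all components of an element of \<open>R\<^sub>+\<^sub>+\<close> have positive degree in direction \<open>j\<close> and lie in
  \<open>P\<close>.\<close>

lemma multi_proj_iff: "P \<in> multi_proj R RG \<longleftrightarrow> relevant P"
proof -
  have "irrelevant R RG \<subseteq> P \<longleftrightarrow> (\<exists>j. RG (unit_vec j) \<subseteq> P)" if P: "primeideal P R" "graded_ideal P"
  proof
    assume irr: "irrelevant R RG \<subseteq> P"
    show "\<exists>j. RG (unit_vec j) \<subseteq> P"
    proof (rule ccontr)
      assume "\<nexists>j. RG (unit_vec j) \<subseteq> P"
      then have pr: "relevant P" using P by (simp add: relevant_def)
      obtain y where y: "y \<in> RG (\<lambda>_. 1)" "y \<notin> P" using relevant_piece[OF pr] by blast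
      have yc: "y \<in> carrier R" by (rule RG.piece(3)[OF y(1)])
      have "RG.cmp y n \<noteq> \<zero> \<longrightarrow> (\<lambda>_. 1) \<le> n" for n using RG.cmp_piece[OF y(1)] by simp
      then have "y \<in> irrelevant R RG" using RG.decomposition_iff[OF yc] yc unfolding irrelevant_def by blast
      then show False using irr y(2) by blast
    qed
  next
    assume "\<exists>j. RG (unit_vec j) \<subseteq> P"
    then obtain j where j: "RG (unit_vec j) \<subseteq> P" by blast
    show "irrelevant R RG \<subseteq> P"
    proof
      fix x assume "x \<in> irrelevant R RG"
      then obtain f where x: "x \<in> carrier R" "decomposition R RG x f" "\<forall>n. f n \<noteq> \<zero> \<longrightarrow> (\<lambda>_. 1) \<le> n"
        by (auto simp: irrelevant_def)
      have f: "f = RG.cmp x" using RG.decomposition_iff[OF x(1)] x(2) by blast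
      have "RG.cmp x n \<in> P" for n
      proof (cases "RG.cmp x n = \<zero>")
        case True
        then show ?thesis using primeideal_facts(3)[OF P(1)] by simp
      next
        case False
        then have "(\<lambda>_. 1) \<le> n" using x(3) f by blast
        then have "n j > 0" using le_funD[of "\<lambda>_. 1" n j] by simp
        then show ?thesis using gen[OF P j] RG.cmp_in[OF x(1)] by blast
      qed
      moreover have "additive_subgroup P R" using P(2) ideal.axioms(1) by (auto simp: graded_ideal_def)
      ultimately show "x \<in> P" using RG.in_subgroup_if_cmp_in[OF _ x(1)] by blast
    qed
  qed
  then show ?thesis unfolding multi_proj_def relevant_def graded_ideal_iff_homogeneous by blast
qed

lemma supp_pp_quotient:
  assumes "stable M (carrier R) N"
  shows "supp_pp R RG (quotient_module M N) = supp_set N"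
  unfolding supp_pp_def supp_set_def multi_proj_iff
  using localization_nonzero_iff[OF assms] by (auto simp: relevant_def)

lemma filter_regular_quotient:
  assumes N: "stable M (carrier R) N" and a: "a \<in> RG k"
  shows "filter_regular RG (quotient_module M N) (quotient_grading M N MG) a \<longleftrightarrow> filter_reg N a"
proof -
  have ac: "a \<in> carrier R" by (rule RG.piece(3)[OF a])
  have "{m \<in> carrier (quotient_module M N). a \<odot>\<^bsub>quotient_module M N\<^esub> m = zero (quotient_module M N)} \<inter>
      quotient_grading M N MG n = {zero (quotient_module M N)} \<longleftrightarrow> (\<forall>m\<in>MG n. a \<odot>\<^bsub>M\<^esub> m \<in> N \<longrightarrow> m \<in> N)" for n
  proof -
    let ?Z = "{m \<in> carrier (quotient_module M N). a \<odot>\<^bsub>quotient_module M N\<^esub> m = zero (quotient_module M N)}"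
    have mem: "coset N m \<in> ?Z \<longleftrightarrow> a \<odot>\<^bsub>M\<^esub> m \<in> N" if "m \<in> carrier M" for m
      using that ac by (simp add: quotient_carrier quotient_zero quotient_smult[OF N] coset_eq_zero_iff[OF N])
    have "?Z \<inter> quotient_grading M N MG n = coset N ` {m \<in> MG n. a \<odot>\<^bsub>M\<^esub> m \<in> N}"
      using mem MG.piece(3) unfolding quotient_grading_def by blast
    moreover have "coset N ` {m \<in> MG n. a \<odot>\<^bsub>M\<^esub> m \<in> N} = {N} \<longleftrightarrow> (\<forall>m\<in>MG n. a \<odot>\<^bsub>M\<^esub> m \<in> N \<longrightarrow> m \<in> N)"
    proof -
      have "\<zero>\<^bsub>M\<^esub> \<in> {m \<in> MG n. a \<odot>\<^bsub>M\<^esub> m \<in> N}" using MG.piece(2) stableD(2)[OF N] ac by simp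
      then have "coset N ` {m \<in> MG n. a \<odot>\<^bsub>M\<^esub> m \<in> N} = {N} \<longleftrightarrow> (\<forall>m\<in>{m \<in> MG n. a \<odot>\<^bsub>M\<^esub> m \<in> N}. coset N m = N)" by blast
      also have "\<dots> \<longleftrightarrow> (\<forall>m\<in>{m \<in> MG n. a \<odot>\<^bsub>M\<^esub> m \<in> N}. m \<in> N)"
        by (rule ball_cong[OF refl]) (use coset_eq_zero_iff[OF N] MG.piece(3) in blast)
      finally show ?thesis by blast
    qed
    ultimately show ?thesis by (simp add: quotient_zero)
  qed
  then show ?thesis unfolding filter_regular_def filter_reg_def using a by auto
qed

lemma seq_submodule_eq:
  assumes xs: "of_degrees xs js"
  shows "seq_submodule R M xs = seq_sub xs"
proof
  let ?T = "{x \<odot>\<^bsub>M\<^esub> m | x m. x \<in> set xs \<and> m \<in> carrier M}"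
  have ge: "x \<odot>\<^bsub>M\<^esub> m \<in> seq_sub xs" if "x \<in> set xs" "m \<in> carrier M" for x m
    using xs that(1)
  proof (induction xs arbitrary: js rule: rev_induct)
    case (snoc y xs)
    then obtain js' j where js: "of_degrees xs js'" "y \<in> RG (unit_vec j)"
      by (auto simp: list_all2_append1 list_all2_Cons1)
    note g = graded_sub_addmul[OF graded_sub_seq_sub[OF js(1)] js(2)]
    show ?case
    proof (cases "x = y")
      case True
      then show ?thesis using g(3) \<open>m \<in> carrier M\<close> by (auto simp: seq_sub_snoc)
    next
      case False
      then have "x \<odot>\<^bsub>M\<^esub> m \<in> seq_sub xs" using snoc.IH[OF js(1)] snoc.prems(2) by simp
      then show ?thesis using g(2) by (auto simp: seq_sub_snoc)
    qed
  qed simp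
  have "?T \<subseteq> seq_sub xs" using ge by blast
  then show "seq_submodule R M xs \<subseteq> seq_sub xs"
    unfolding seq_submodule_def span_def
    using graded_sub_stable[OF graded_sub_seq_sub[OF xs]] by (intro hull_minimal) (simp_all add: submodule_iff_stable)
  have le: "?T \<subseteq> carrier M"
  proof -
    have "set xs \<subseteq> carrier R"
      using xs RG.piece(3) by (induction rule: list_all2_induct) auto
    then show ?thesis by auto
  qed
  show "seq_sub xs \<subseteq> seq_submodule R M xs"
    unfolding seq_submodule_def span_def hull_def
  proof (rule Inter_greatest)
    fix K assume "K \<in> {t. submodule t R M \<and> ?T \<subseteq> t}"
    then have K: "stable M (carrier R) K" "?T \<subseteq> K" by (auto simp: submodule_iff_stable)
    show "seq_sub xs \<subseteq> K" by (rule seq_sub_le[OF K(1)]) (use K(2) in blast)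
  qed
qed

lemma dim_supp_quotient_by_seq:
  assumes xs: "of_degrees xs js"
  shows "dim_supp R RG (quotient_by_seq R M xs) = chain_dim (supp_set (seq_sub xs))"
  unfolding dim_supp_def seq_submodule_eq[OF xs]
  using supp_pp_quotient[OF graded_sub_stable[OF graded_sub_seq_sub[OF xs]]] by simp

lemma filter_regular_seq_iff:
  assumes xs: "of_degrees xs js"
  shows "filter_regular_seq R RG M MG xs \<longleftrightarrow> filter_reg_seq xs"
proof -
  have "filter_regular RG (quotient_by_seq R M (take i xs))
      (quotient_grading M (seq_submodule R M (take i xs)) MG) (xs ! i) \<longleftrightarrow> filter_reg (seq_sub (take i xs)) (xs ! i)"
    if i: "i < length xs" for i
  proof -
    have t: "of_degrees (take i xs) (take i js)" using xs by (rule list_all2_takeI)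
    have "xs ! i \<in> RG (unit_vec (js ! i))" by (rule list_all2_nthD[OF xs i])
    then show ?thesis
      unfolding seq_submodule_eq[OF t] by (rule filter_regular_quotient[OF graded_sub_stable[OF graded_sub_seq_sub[OF t]]])
  qed
  then show ?thesis by (simp add: filter_regular_seq_def filter_reg_seq_def)
qed

lemma of_type_iff: "of_type RG k xs \<longleftrightarrow> (\<exists>js. of_degrees xs js \<and> type_of js = k)"
  by (simp add: of_type_def fun_eq_iff type_of_count)

text \<open>Each of the conditions on dimensions is equivalent to \<open>e k > 0\<close>. A filter-regular sequence
  of type \<open>k\<close> is a mixed multiplicity system, since its dimension is at most \<open>0\<close>.\<close>

theorem positivity_equivalences:
  assumes e: "has_coeffs {\<zero>\<^bsub>M\<^esub>} (carrier M) e" and def: "\<And>h. h > k \<Longrightarrow> e h = 0"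
  defines "dimq \<equiv> \<lambda>xs. dim_supp R RG (quotient_by_seq R M xs)"
  shows "(e k > 0 \<longleftrightarrow> (\<forall>xs. mixed_mult_system R RG M k xs \<longrightarrow> dimq xs = 0)) \<and>
    ((\<forall>xs. mixed_mult_system R RG M k xs \<longrightarrow> dimq xs = 0) \<longleftrightarrow>
      (\<forall>xs. filter_regular_seq R RG M MG xs \<and> of_type RG k xs \<longrightarrow> dimq xs = 0)) \<and>
    ((\<forall>xs. filter_regular_seq R RG M MG xs \<and> of_type RG k xs \<longrightarrow> dimq xs = 0) \<longleftrightarrow>
      (\<exists>xs. filter_regular_seq R RG M MG xs \<and> of_type RG k xs \<and> dimq xs = 0))"
proof -
  have filter_reg: "dimq xs \<le> 0 \<and> (dimq xs = 0 \<longleftrightarrow> e k > 0)"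
    if fr: "filter_regular_seq R RG M MG xs" and ty: "of_type RG k xs" for xs
  proof -
    obtain js where js: "of_degrees xs js" "type_of js = k" using ty of_type_iff by blast
    have "filter_reg_seq xs" using fr filter_regular_seq_iff[OF js(1)] by simp
    then show ?thesis
      using filter_reg_seq_dim[OF e _ js(1), unfolded js(2), OF def] dim_supp_quotient_by_seq[OF js(1)]
      by (simp add: dimq_def)
  qed
  have mixed: "dimq xs = 0" if pos: "e k > 0" and mm: "mixed_mult_system R RG M k xs" for xs
  proof -
    obtain js where js: "of_degrees xs js" "type_of js = k"
      using mm of_type_iff unfolding mixed_mult_system_def by blast
    have "chain_dim (supp_set (seq_sub xs)) \<le> 0"
      using mm dim_supp_quotient_by_seq[OF js(1)] by (simp add: mixed_mult_system_def)
    then show ?thesis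
      using mixed_system_support[OF e js(1)] pos js(2) chain_dim_eq_0 dim_supp_quotient_by_seq[OF js(1)]
      unfolding dimq_def by metis
  qed
  have ex: "\<exists>xs. filter_regular_seq R RG M MG xs \<and> of_type RG k xs"
  proof -
    obtain js where js: "type_of js = k" using type_of_surj by blast
    obtain xs where "of_degrees xs js" "filter_reg_seq xs" using filter_reg_seq_exists by blast
    then show ?thesis using js filter_regular_seq_iff of_type_iff by blast
  qed
  have mms: "mixed_mult_system R RG M k xs" if "filter_regular_seq R RG M MG xs" "of_type RG k xs" for xs
    using filter_reg[OF that] that(2) by (simp add: mixed_mult_system_def dimq_def)
  show ?thesis using filter_reg mixed ex mms by blast
qed

end

section \<open>Standard graded algebras over an Artinian local ring\<close>

context algebra
begin

definition unit_map :: "'a \<Rightarrow> 'c" where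
  "unit_map a = a \<odot>\<^bsub>M\<^esub> \<one>\<^bsub>M\<^esub>"

lemma unit_map_hom: "ring_hom_cring R M unit_map"
proof (intro ring_hom_cring.intro ring_hom_cring_axioms.intro R_cring M_cring ring_hom_memI)
  show "unit_map (x \<otimes> y) = unit_map x \<otimes>\<^bsub>M\<^esub> unit_map y" if "x \<in> carrier R" "y \<in> carrier R" for x y
    using that by (simp add: unit_map_def smult_assoc1 smult_assoc2)
qed (simp_all add: unit_map_def smult_l_distr)

lemma scalars_eq: "scalars R M = unit_map ` carrier R"
  by (simp add: scalars_def unit_map_def)

end

lemma stable_ring_module_subring:
  fixes S (structure)
  assumes S: "cring S" and h: "ring_hom_cring A S h"
  shows "stable (ring_module S) (h ` carrier A) (h ` carrier A)"
proof -
  interpret cring S by fact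
  interpret Sm: module S "ring_module S" by (rule module_ring_module)
  interpret h: ring_hom_cring A S h by fact
  have "stable (ring_module S) (h ` carrier A) ((\<lambda>a. h a \<odot>\<^bsub>ring_module S\<^esub> \<one>) ` carrier A)"
    by (rule Sm.stable_cyclic[OF h]) simp
  then show ?thesis by simp
qed

lemma (in module) span_mono_carrier:
  assumes "span R M T = carrier M" "T \<subseteq> E" "E \<subseteq> carrier M" shows "span R M E = carrier M"
proof
  show "span R M E \<subseteq> carrier M"
    unfolding span_def using assms(3) carrier_is_submodule by (intro hull_minimal)
  show "carrier M \<subseteq> span R M E" using assms(1) hull_mono[OF assms(2)] unfolding span_def by blast
qed

locale standard_graded_module =
  art: artinian_local_ring A \<mm> + alg: standard_graded_algebra A S SG + fgm: fg_graded_module S SG M MG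
  for A :: "('a, 'c) ring_scheme" and \<mm> :: "'a set"
    and S :: "('a, 's, 'e) module_scheme" and SG :: "('i::finite \<Rightarrow> nat) \<Rightarrow> 's set"
    and M :: "('s, 'm, 'f) module_scheme" and MG :: "('i \<Rightarrow> nat) \<Rightarrow> 'm set" +
  assumes inf_residue: "infinite (carrier (A Quot \<mm>))"
begin

abbreviation X :: "'s set" where "X \<equiv> scalars A S"

sublocale gm: graded_module S M SG MG
  by unfold_locales
    (use alg.S_direct_sum fgm.M_direct_sum alg.S_mult fgm.M_smult in \<open>simp_all add: plus_fun_def\<close>)

lemma S_cring: "cring S"
  by (rule alg.M_cring)

lemma S_semiring: "semiring S"
  by unfold_locales

lemma hom: "ring_hom_cring A S alg.unit_map"
  by (rule alg.unit_map_hom)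

lemma finite_length_A: "fin_len (ring_module A) (carrier A) {\<zero>\<^bsub>A\<^esub>} (carrier A)"
  by (rule artinian_ring.artinian_finite_length) (unfold_locales, rule art.artinian)

lemma X_carrier: "X \<subseteq> carrier S"
  unfolding alg.scalars_eq using ring_hom_cring.hom_closed[OF hom] ring_hom_closed ring_hom_cring.homh[OF hom] by fast

lemma X_degree_0: "X \<subseteq> SG 0"
  using gm.one_in_RG0 submodule.smult_closed[OF alg.S_submodule[of 0]] by (auto simp: scalars_def)

text \<open>Finitely many generators span a module of finite length over \<open>A\<close>, and the finitely many
  algebra generators of \<open>S\<close> are adjoined as operators by the basis theorem.\<close>

lemma noetherian:
  assumes N: "module S N" and T: "finite T" "T \<subseteq> carrier N" "span S N T = carrier N"
  shows "acc N (carrier S) (carrier N)"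
proof -
  interpret N: module S N by fact
  obtain E where E: "stable N (alg.unit_map ` carrier A) E" "fin_len N (alg.unit_map ` carrier A) {\<zero>\<^bsub>N\<^esub>} E" "T \<subseteq> E"
    using N.fin_len_of_finite[OF hom finite_length_A T(1,2)] by blast
  obtain U where U: "finite U" "U \<subseteq> carrier S" "generate_ring S (X \<union> U) = carrier S"
    using alg.S_finitely_generated by blast
  show ?thesis
    by (rule N.acc_of_finitely_generated[OF X_carrier U, of E])
      (use E N.fin_len_imp_acc N.span_mono_carrier[OF T(3) E(3)] N.stableD(1)[OF E(1)] in \<open>simp_all add: alg.scalars_eq\<close>)
qed

lemma acc_M: "acc M (carrier S) (carrier M)"
  using fgm.M_finitely_generated noetherian[OF fgm.module_axioms] by blast

lemma acc_S: "acc (ring_module S) (carrier S) (carrier S)"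
proof -
  interpret Sm: module S "ring_module S" by (rule cring.module_ring_module[OF S_cring])
  have "span S (ring_module S) {\<one>\<^bsub>S\<^esub>} = carrier (ring_module S)"
  proof
    show "span S (ring_module S) {\<one>\<^bsub>S\<^esub>} \<subseteq> carrier (ring_module S)"
      unfolding span_def using Sm.carrier_is_submodule by (intro hull_minimal) simp_all
    show "carrier (ring_module S) \<subseteq> span S (ring_module S) {\<one>\<^bsub>S\<^esub>}"
      unfolding span_def hull_def
    proof (intro subsetI InterI)
      fix x K assume x: "x \<in> carrier (ring_module S)" and "K \<in> {t. submodule t S (ring_module S) \<and> {\<one>\<^bsub>S\<^esub>} \<subseteq> t}"
      then have K: "submodule K S (ring_module S)" "\<one>\<^bsub>S\<^esub> \<in> K" by auto
      then have "x \<otimes>\<^bsub>S\<^esub> \<one>\<^bsub>S\<^esub> \<in> K" using submodule.smult_closed[OF K(1), of x "\<one>\<^bsub>S\<^esub>"] x by simp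
      then show "x \<in> K" using x by simp
    qed
  qed
  then have "acc (ring_module S) (carrier S) (carrier (ring_module S))"
    by (intro noetherian[OF Sm.module_axioms, of "{\<one>\<^bsub>S\<^esub>}"]) simp_all
  then show ?thesis by simp
qed

text \<open>Since \<open>S\<close> is generated by the scalars and the pieces \<open>S\<^sub>i\<close>, a multiplicative family of subgroups
  of the graded pieces that contains these generators is everything.\<close>

lemma standard_family_eq:
  assumes sub: "\<And>n. additive_subgroup (W n) S" and le: "\<And>n. W n \<subseteq> SG n"
    and sc: "X \<subseteq> W 0" and gens: "\<And>i. SG (unit_vec i) \<subseteq> W (unit_vec i)"
    and mult: "\<And>m n x y. x \<in> W m \<Longrightarrow> y \<in> W n \<Longrightarrow> x \<otimes>\<^bsub>S\<^esub> y \<in> W (m + n)"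
  shows "W n = SG n"
proof -
  interpret SS: graded_module S "ring_module S" SG SG by (rule gm.graded_ring_module)
  note W = additive_subgroup.zero_closed[OF sub] additive_subgroup.a_closed[OF sub] additive_subgroup.a_inv_closed[OF sub]
  have one: "\<one>\<^bsub>S\<^esub> \<in> W 0"
  proof -
    have "\<one>\<^bsub>S\<^esub> = \<one>\<^bsub>A\<^esub> \<odot>\<^bsub>S\<^esub> \<one>\<^bsub>S\<^esub>" by simp
    then have "\<one>\<^bsub>S\<^esub> \<in> X" unfolding scalars_def using art.one_closed by (metis imageI)
    then show ?thesis using sc by blast
  qed
  have from_piece: "gm.RG.cmp x n \<in> W n" if "x \<in> W k" for x k n
  proof -
    have "x \<in> SG k" using that le by blast
    then show ?thesis using gm.RG.cmp_piece[of x k] that W(1) by (cases "n = k") simp_all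
  qed
  have "x \<in> carrier S \<and> (\<forall>n. gm.RG.cmp x n \<in> W n)" if "x \<in> generate_ring S (X \<union> (\<Union>i. SG (unit_vec i)))" for x
    using that
  proof (induction rule: generate_ring.induct)
    case one
    then show ?case using from_piece[OF one] \<open>\<one>\<^bsub>S\<^esub> \<in> W 0\<close> from_piece by auto
  next
    case (incl h)
    then obtain k where k: "h \<in> W k" using sc gens by blast
    then show ?case using from_piece le gm.RG.piece(3) by blast
  next
    case (a_inv h)
    then show ?case using W(3) by (simp add: gm.RG.cmp_uminus)
  next
    case (eng_add x y)
    then show ?case using W(2) by (simp add: gm.RG.cmp_add)
  next
    case (eng_mult x y)
    then have x: "x \<in> carrier S" "\<And>n. gm.RG.cmp x n \<in> W n" and y: "y \<in> carrier S" "\<And>n. gm.RG.cmp y n \<in> W n" by auto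
    have xc: "gm.RG.cmp x i \<in> carrier S" for i by (rule gm.RG.cmp_carrier[OF x(1)])
    let ?F = "{n. gm.RG.cmp x n \<noteq> \<zero>\<^bsub>S\<^esub>}"
    have F: "finite ?F" by (rule gm.RG.finite_support[OF x(1)])
    have "x \<otimes>\<^bsub>S\<^esub> y = (\<Oplus>\<^bsub>S\<^esub>i\<in>?F. gm.RG.cmp x i) \<otimes>\<^bsub>S\<^esub> y" using gm.RG.finsum_cmp[OF x(1) F] by simp
    also have "\<dots> = (\<Oplus>\<^bsub>S\<^esub>i\<in>?F. gm.RG.cmp x i \<otimes>\<^bsub>S\<^esub> y)" using F y(1) xc by (simp add: semiring.finsum_ldistr[OF S_semiring])
    finally have eq: "x \<otimes>\<^bsub>S\<^esub> y = (\<Oplus>\<^bsub>S\<^esub>i\<in>?F. gm.RG.cmp x i \<otimes>\<^bsub>S\<^esub> y)" .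
    have "gm.RG.cmp (x \<otimes>\<^bsub>S\<^esub> y) n \<in> W n" for n
    proof -
      have "gm.RG.cmp (x \<otimes>\<^bsub>S\<^esub> y) n = (\<Oplus>\<^bsub>S\<^esub>i\<in>?F. gm.RG.cmp (gm.RG.cmp x i \<otimes>\<^bsub>S\<^esub> y) n)"
        unfolding eq by (rule gm.RG.cmp_finsum[OF F]) (use xc y(1) in simp)
      moreover have "gm.RG.cmp (gm.RG.cmp x i \<otimes>\<^bsub>S\<^esub> y) n \<in> W n" for i
      proof (cases "i \<le> n")
        case True
        then have "gm.RG.cmp (gm.RG.cmp x i \<otimes>\<^bsub>S\<^esub> y) n = gm.RG.cmp x i \<otimes>\<^bsub>S\<^esub> gm.RG.cmp y (n - i)"
          using SS.component_smult_left[OF gm.RG.cmp_in[OF x(1), of i], of y n] y(1) by (simp add: gm.component_ring_module)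
        then show ?thesis using mult[OF x(2) y(2), of i "n - i"] deg_add_diff[OF True] by simp
      next
        case False
        then have "gm.RG.cmp (gm.RG.cmp x i \<otimes>\<^bsub>S\<^esub> y) n = \<zero>\<^bsub>S\<^esub>"
          using SS.component_smult_left[OF gm.RG.cmp_in[OF x(1), of i], of y n] y(1) by (simp add: gm.component_ring_module)
        then show ?thesis using W(1) by simp
      qed
      then have "(\<Oplus>\<^bsub>S\<^esub>i\<in>?F. gm.RG.cmp (gm.RG.cmp x i \<otimes>\<^bsub>S\<^esub> y) n) \<in> W n"
        by (rule gm.RG.finsum_in_subgroup[OF sub])
      ultimately show ?thesis by simp
    qed
    then show ?case using x(1) y(1) by simp
  qed
  then have all: "gm.RG.cmp x n \<in> W n" if "x \<in> carrier S" for x n using alg.S_standard that by blast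
  show ?thesis
  proof
    show "SG n \<subseteq> W n"
    proof
      fix x assume x: "x \<in> SG n"
      then have xc: "x \<in> carrier S" by (rule gm.RG.piece(3))
      show "x \<in> W n" using all[OF xc, of n] gm.RG.cmp_self[OF xc, of n] x by simp
    qed
  qed (rule le)
qed

lemma SG_subgroup: "additive_subgroup (SG n) S"
  using alg.S_direct_sum by (simp add: direct_sum_def)

lemma X_subring: "stable (ring_module S) X X"
  using stable_ring_module_subring[OF S_cring hom] by (simp add: alg.scalars_eq)

lemma deg_add_eq_0: "(m + n :: 'i \<Rightarrow> nat) = 0 \<longleftrightarrow> m = 0 \<and> n = 0"
  by (auto simp: fun_eq_iff plus_fun_apply zero_fun_apply)

lemma degree_0_scalars: "SG 0 = X"
proof -
  interpret Sm: module S "ring_module S" by (rule cring.module_ring_module[OF S_cring])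
  have "(\<lambda>n. if n = 0 then X else SG n) 0 = SG 0"
  proof (rule standard_family_eq[where W = "\<lambda>n. if n = 0 then X else SG n"])
    have "additive_subgroup X S"
      using X_subring by (simp add: stable_def additive_subgroup_def subgroup_def m_inv_def)
    then show "additive_subgroup (if n = 0 then X else SG n) S" for n using SG_subgroup by simp
    show "(if n = 0 then X else SG n) \<subseteq> SG n" for n using X_degree_0 by simp
    have "unit_vec i \<noteq> (0 :: 'i \<Rightarrow> nat)" for i
      by (metis unit_vec_def zero_fun_apply zero_neq_one)
    then show "SG (unit_vec i) \<subseteq> (if unit_vec i = 0 then X else SG (unit_vec i))" for i by simp
    show "x \<otimes>\<^bsub>S\<^esub> y \<in> (if m + n = 0 then X else SG (m + n))"
      if x: "x \<in> (if m = 0 then X else SG m)" and y: "y \<in> (if n = 0 then X else SG n)" for m n x y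
    proof (cases "m + n = 0")
      case True
      then have "x \<in> X" "y \<in> X" using x y by (auto simp: deg_add_eq_0)
      then show ?thesis using Sm.stableD(7)[OF X_subring] True by simp
    next
      case False
      have "x \<in> SG m" "y \<in> SG n" using x y X_degree_0 by (auto split: if_splits)
      then have "x \<otimes>\<^bsub>S\<^esub> y \<in> SG (m + n)" by (rule gm.R_mult)
      then show ?thesis using False by (simp only: if_False)
    qed
  qed simp
  then show ?thesis by simp
qed

text \<open>The pieces of degree positive in direction \<open>j\<close>, cut down to \<open>P\<close>, together with all other
  pieces form a multiplicative family that contains the generators.\<close>

lemma prime_contains_pieces:
  assumes P: "primeideal P S" and j: "SG (unit_vec j) \<subseteq> P" and n: "n j > 0"
  shows "SG n \<subseteq> P"
proof -
  interpret primeideal P S by fact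
  have "(\<lambda>n. if n j > 0 then SG n \<inter> P else SG n) n = SG n"
  proof (rule standard_family_eq[where W = "\<lambda>n. if n j > 0 then SG n \<inter> P else SG n"])
    have "additive_subgroup (SG n \<inter> P) S" for n
    proof -
      interpret s: additive_subgroup "SG n" S by (rule SG_subgroup)
      show ?thesis
        by (intro additive_subgroupI subgroup.intro) (use s.a_subset in \<open>auto simp: a_inv_def[symmetric]\<close>)
    qed
    then show "additive_subgroup (if n j > 0 then SG n \<inter> P else SG n) S" for n using SG_subgroup by simp
    show "(if n j > 0 then SG n \<inter> P else SG n) \<subseteq> SG n" for n by simp
    show "X \<subseteq> (if 0 < (0 :: 'i \<Rightarrow> nat) j then SG 0 \<inter> P else SG 0)" using X_degree_0 by (simp add: zero_fun_apply)
    show "SG (unit_vec i) \<subseteq> (if 0 < (unit_vec i :: 'i \<Rightarrow> nat) j then SG (unit_vec i) \<inter> P else SG (unit_vec i))" for i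
      using j by (cases "i = j") (auto simp: unit_vec_def)
    show "x \<otimes>\<^bsub>S\<^esub> y \<in> (if 0 < (m + n) j then SG (m + n) \<inter> P else SG (m + n))"
      if x: "x \<in> (if 0 < m j then SG m \<inter> P else SG m)" and y: "y \<in> (if 0 < n j then SG n \<inter> P else SG n)" for m n x y
    proof -
      have xy: "x \<in> SG m" "y \<in> SG n" using x y by (auto split: if_splits)
      have c: "x \<in> carrier S" "y \<in> carrier S" using gm.RG.piece(3) xy by auto
      have "x \<otimes>\<^bsub>S\<^esub> y \<in> P" if "0 < (m + n) j"
      proof -
        have "0 < m j \<or> 0 < n j" using that by (simp add: plus_fun_apply)
        then show ?thesis using x y c I_l_closed I_r_closed by auto
      qed
      then show ?thesis using gm.R_mult[OF xy] by simp
    qed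
  qed
  then show ?thesis using n by auto
qed

text \<open>Each piece is noetherian over the scalars: a subgroup \<open>H\<close> of \<open>M\<^sub>n\<close> stable under \<open>S\<^sub>0\<close> is recovered
  as the degree \<open>n\<close> part of the \<open>S\<close>-submodule of all elements whose component in degree \<open>n\<close> lies in \<open>H\<close>
  and whose components outside degrees \<open>\<ge> n\<close> vanish.\<close>

lemma stable_extension:
  assumes H: "stable M X H" "H \<subseteq> MG n"
  shows "stable M (carrier S) {y \<in> carrier M. gm.MG.cmp y n \<in> H \<and> (\<forall>j. \<not> n \<le> j \<longrightarrow> gm.MG.cmp y j = \<zero>\<^bsub>M\<^esub>)}"
    (is "stable M (carrier S) ?W")
proof (rule fgm.stableI)
  note h = fgm.stableD[OF H(1)]
  show "?W \<subseteq> carrier M" by blast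
  show "\<zero>\<^bsub>M\<^esub> \<in> ?W" using h(2) by (simp add: gm.MG.cmp_zero)
  show add: "x \<oplus>\<^bsub>M\<^esub> y \<in> ?W" if "x \<in> ?W" "y \<in> ?W" for x y
    using that h(4) by (simp add: gm.MG.cmp_add)
  show "\<ominus>\<^bsub>M\<^esub> x \<in> ?W" if "x \<in> ?W" for x
    using that h(5) fgm.M.minus_equality[of "\<zero>\<^bsub>M\<^esub>" "\<zero>\<^bsub>M\<^esub>"] by (simp add: gm.MG.cmp_uminus)
  fix s y assume s: "s \<in> carrier S" and y: "y \<in> ?W"
  have yc: "y \<in> carrier M" using y by blast
  show "s \<odot>\<^bsub>M\<^esub> y \<in> ?W"
    using s
  proof (induction s rule: gm.RG.homogeneous_induct)
    case (piece k s)
    have sc: "s \<in> carrier S" by (rule gm.RG.piece(3)[OF piece])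
    have c: "gm.MG.cmp (s \<odot>\<^bsub>M\<^esub> y) j = (if k \<le> j then s \<odot>\<^bsub>M\<^esub> gm.MG.cmp y (j - k) else \<zero>\<^bsub>M\<^esub>)" for j
      by (rule gm.component_smult_left[OF piece yc])
    have "gm.MG.cmp (s \<odot>\<^bsub>M\<^esub> y) n \<in> H"
    proof (cases "k = 0")
      case True
      then have "s \<in> X" using piece degree_0_scalars by simp
      moreover have "n - k = n" using True by (simp add: fun_eq_iff minus_apply zero_fun_apply)
      moreover have "k \<le> n" using True by (simp add: le_fun_def zero_fun_apply)
      ultimately show ?thesis using c[of n] h(7) y by simp
    next
      case False
      have "\<not> n \<le> n - k" if "k \<le> n"
      proof
        assume "n \<le> n - k"
        then have "n i \<le> n i - k i" for i by (simp add: le_fun_def minus_apply)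
        moreover have "k i \<le> n i" for i using that by (simp add: le_fun_def)
        ultimately have "k i = 0" for i by (metis cancel_comm_monoid_add_class.diff_cancel diff_diff_cancel diff_is_0_eq)
        then show False using False by (simp add: fun_eq_iff zero_fun_apply)
      qed
      then show ?thesis using c[of n] y h(2) sc by auto
    qed
    moreover have "gm.MG.cmp (s \<odot>\<^bsub>M\<^esub> y) j = \<zero>\<^bsub>M\<^esub>" if j: "\<not> n \<le> j" for j
    proof -
      have "\<not> n \<le> j - k" using j order_trans[of n "j - k" j] by (auto simp: le_fun_def minus_apply)
      then show ?thesis using c[of j] y sc by auto
    qed
    ultimately show ?case using sc yc by simp
  next
    case (add s t)
    have "(s \<oplus>\<^bsub>S\<^esub> t) \<odot>\<^bsub>M\<^esub> y = s \<odot>\<^bsub>M\<^esub> y \<oplus>\<^bsub>M\<^esub> t \<odot>\<^bsub>M\<^esub> y"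
      by (rule fgm.smult_l_distr[OF add.hyps yc])
    then show ?case using \<open>\<And>x y. x \<in> ?W \<Longrightarrow> y \<in> ?W \<Longrightarrow> x \<oplus>\<^bsub>M\<^esub> y \<in> ?W\<close>[OF add.IH] by simp
  qed
qed

lemma acc_piece: "acc M X (MG n)"
  unfolding acc_def
proof (intro allI impI)
  fix f :: "nat \<Rightarrow> 'm set"
  assume f: "\<forall>i. stable M X (f i) \<and> f i \<subseteq> MG n \<and> f i \<subseteq> f (Suc i)"
  define W where "W = (\<lambda>H. {y \<in> carrier M. gm.MG.cmp y n \<in> H \<and> (\<forall>j. \<not> n \<le> j \<longrightarrow> gm.MG.cmp y j = \<zero>\<^bsub>M\<^esub>)})"
  have piece: "W (f i) \<inter> MG n = f i" for i
  proof
    show "W (f i) \<inter> MG n \<subseteq> f i"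
    proof
      fix y assume y: "y \<in> W (f i) \<inter> MG n"
      then have "gm.MG.cmp y n = y" using gm.MG.cmp_self[of y n] by (simp add: W_def)
      then show "y \<in> f i" using y by (auto simp: W_def)
    qed
    show "f i \<subseteq> W (f i) \<inter> MG n"
    proof
      fix y assume y: "y \<in> f i"
      then have yn: "y \<in> MG n" using f by blast
      then show "y \<in> W (f i) \<inter> MG n"
        using y gm.MG.cmp_piece[OF yn] gm.MG.piece(3)[OF yn] by (auto simp: W_def)
    qed
  qed
  have "\<exists>i. \<forall>m\<ge>i. W (f m) = W (f i)"
  proof (rule accD[OF acc_M])
    show "stable M (carrier S) (W (f i))" for i unfolding W_def by (rule stable_extension) (use f in auto)
    show "W (f i) \<subseteq> carrier M" for i by (auto simp: W_def)
    show "W (f i) \<subseteq> W (f (Suc i))" for i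
    proof -
      have "f i \<subseteq> f (Suc i)" using f by blast
      then show ?thesis by (auto simp: W_def)
    qed
  qed
  then show "\<exists>i. \<forall>m\<ge>i. f m = f i" using piece by metis
qed

lemma fin_len_piece: "fin_len M X {\<zero>\<^bsub>M\<^esub>} (MG n)"
  using fgm.fin_len_of_acc[OF hom finite_length_A, of "MG n"] gm.stable_degree[OF X_degree_0] acc_piece by (simp add: alg.scalars_eq)

text \<open>Let \<open>x\<close> avoid all primes but \<open>P\<close>, and let \<open>u \<in> S\<^sub>j\<close> lie outside \<open>P\<close>. The elements
  \<open>x + b u\<close> are tried with \<open>b\<close> in an infinite set of scalars whose differences lie in no
  prime. Two of them in the same prime would force \<open>u\<close>, and then \<open>x\<close>, into this prime, so
  each prime excludes at most one \<open>b\<close>.\<close>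

lemma prime_avoidance:
  assumes "finite \<P>" "\<And>P. P \<in> \<P> \<Longrightarrow> primeideal P S \<and> \<not> SG (unit_vec j) \<subseteq> P"
  shows "\<exists>x\<in>SG (unit_vec j). \<forall>P\<in>\<P>. x \<notin> P"
proof -
  interpret h: ring_hom_cring A S alg.unit_map by (rule hom)
  obtain B where B: "infinite B" "B \<subseteq> carrier A"
    "\<And>P a b. \<lbrakk>ideal P A; \<one>\<^bsub>A\<^esub> \<notin> P; \<And>a b. \<lbrakk>a \<in> carrier A; b \<in> carrier A; a \<otimes>\<^bsub>A\<^esub> b \<in> P\<rbrakk> \<Longrightarrow> a \<in> P \<or> b \<in> P;
      a \<in> B; b \<in> B; a \<noteq> b\<rbrakk> \<Longrightarrow> a \<ominus>\<^bsub>A\<^esub> b \<notin> P"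
    using art.infinite_separated_set[OF inf_residue] by blast
  have diff: "alg.unit_map (a \<ominus>\<^bsub>A\<^esub> b) \<notin> P" if P: "primeideal P S" and ab: "a \<in> B" "b \<in> B" "a \<noteq> b" for P a b
  proof -
    interpret P: primeideal P S by (rule P)
    let ?Q = "{a \<in> carrier A. alg.unit_map a \<in> P}"
    have "ideal ?Q A"
    proof (intro idealI art.ring_axioms subgroup.intro)
      show "inv\<^bsub>add_monoid A\<^esub> x \<in> ?Q" if "x \<in> ?Q" for x
        using that P.a_inv_closed by (simp add: a_inv_def[symmetric])
    qed (use P.I_l_closed P.I_r_closed in auto)
    moreover have "\<one>\<^bsub>A\<^esub> \<notin> ?Q" using P.one_imp_carrier P.I_notcarr by auto
    moreover have "a \<in> ?Q \<or> b \<in> ?Q" if "a \<in> carrier A" "b \<in> carrier A" "a \<otimes>\<^bsub>A\<^esub> b \<in> ?Q" for a b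
      using that P.I_prime[of "alg.unit_map a" "alg.unit_map b"] by simp
    ultimately have "a \<ominus>\<^bsub>A\<^esub> b \<notin> ?Q" using B(3)[OF _ _ _ ab] by blast
    then show ?thesis using ab(1,2) B(2) by (auto simp: a_minus_def)
  qed
  show ?thesis
    using assms
  proof (induction \<P> rule: finite_induct)
    case empty
    then show ?case using gm.RG.piece(2) by blast
  next
    case (insert P \<P>)
    obtain x where x: "x \<in> SG (unit_vec j)" "\<forall>Q\<in>\<P>. x \<notin> Q" using insert.IH insert.prems by blast
    obtain u where u: "u \<in> SG (unit_vec j)" "u \<notin> P" using insert.prems by blast
    have c: "x \<in> carrier S" "u \<in> carrier S" using gm.RG.piece(3) x u by auto
    show ?case
    proof (cases "x \<in> P")
      case False
      then show ?thesis using x by blast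
    next
      case True
      let ?v = "\<lambda>b. x \<oplus>\<^bsub>S\<^esub> alg.unit_map b \<otimes>\<^bsub>S\<^esub> u"
      have bad: "finite {b \<in> B. ?v b \<in> Q}" if Q: "Q \<in> insert P \<P>" for Q
      proof -
        have pQ: "primeideal Q S" using insert.prems Q by blast
        interpret Q: primeideal Q S by (rule pQ)
        have "a = b" if a: "a \<in> B" "?v a \<in> Q" and b: "b \<in> B" "?v b \<in> Q" for a b
        proof (rule ccontr)
          assume ne: "a \<noteq> b"
          have abc: "a \<in> carrier A" "b \<in> carrier A" using a b B(2) by auto
          let ?a = "alg.unit_map a" and ?b = "alg.unit_map b"
          have cc: "?a \<in> carrier S" "?b \<in> carrier S" using abc by auto
          have "?v a \<oplus>\<^bsub>S\<^esub> \<ominus>\<^bsub>S\<^esub> ?v b \<in> Q" using a(2) b(2) by blast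
          moreover have "?v a \<oplus>\<^bsub>S\<^esub> \<ominus>\<^bsub>S\<^esub> ?v b = alg.unit_map (a \<ominus>\<^bsub>A\<^esub> b) \<otimes>\<^bsub>S\<^esub> u"
          proof -
            have "alg.unit_map (a \<ominus>\<^bsub>A\<^esub> b) = ?a \<oplus>\<^bsub>S\<^esub> \<ominus>\<^bsub>S\<^esub> ?b" using abc by (simp add: a_minus_def)
            moreover have "?v a \<oplus>\<^bsub>S\<^esub> \<ominus>\<^bsub>S\<^esub> ?v b = (?a \<oplus>\<^bsub>S\<^esub> \<ominus>\<^bsub>S\<^esub> ?b) \<otimes>\<^bsub>S\<^esub> u"
              using cc c by algebra
            ultimately show ?thesis by simp
          qed
          ultimately have "alg.unit_map (a \<ominus>\<^bsub>A\<^esub> b) \<otimes>\<^bsub>S\<^esub> u \<in> Q" by simp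
          moreover have "alg.unit_map (a \<ominus>\<^bsub>A\<^esub> b) \<in> carrier S" using abc by (simp add: a_minus_def)
          ultimately have uQ: "u \<in> Q" using Q.I_prime[OF _ c(2)] diff[OF pQ a(1) b(1) ne] by metis
          then have "?a \<otimes>\<^bsub>S\<^esub> u \<in> Q" using Q.I_l_closed cc by blast
          then have "?v a \<oplus>\<^bsub>S\<^esub> \<ominus>\<^bsub>S\<^esub> (?a \<otimes>\<^bsub>S\<^esub> u) \<in> Q" using a(2) by blast
          moreover have "?v a \<oplus>\<^bsub>S\<^esub> \<ominus>\<^bsub>S\<^esub> (?a \<otimes>\<^bsub>S\<^esub> u) = x" using cc c by algebra
          ultimately have "x \<in> Q" by simp
          then show False using Q x(2) u(2) uQ by blast
        qed
        then have "\<exists>b. {b \<in> B. ?v b \<in> Q} \<subseteq> {b}" by blast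
        then show ?thesis using finite_subset by blast
      qed
      then have "finite (\<Union>Q\<in>insert P \<P>. {b \<in> B. ?v b \<in> Q})" using insert.hyps(1) by blast
      then have "\<not> B \<subseteq> (\<Union>Q\<in>insert P \<P>. {b \<in> B. ?v b \<in> Q})" using B(1) finite_subset by blast
      then obtain b where b: "b \<in> B" "\<forall>Q\<in>insert P \<P>. ?v b \<notin> Q" by blast
      have "alg.unit_map b \<in> SG 0" using b(1) B(2) X_degree_0 by (auto simp: alg.scalars_eq)
      then have "alg.unit_map b \<otimes>\<^bsub>S\<^esub> u \<in> SG (unit_vec j)" using gm.R_mult[of _ 0 u "unit_vec j"] u(1) by simp
      then have "?v b \<in> SG (unit_vec j)" using gm.RG.piece(4)[OF x(1)] by blast
      then show ?thesis using b(2) by blast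
    qed
  qed
qed

sublocale ng: noetherian_graded_module S M SG MG X
proof
  show "SG n \<subseteq> P" if "primeideal P S" "gm.graded_ideal P" "SG (unit_vec j) \<subseteq> P" "0 < n j" for P j n
    by (rule prime_contains_pieces[of P j n, OF that(1,3,4)])
  show "\<exists>x\<in>SG (unit_vec j). \<forall>P\<in>\<P>. x \<notin> P"
    if "finite \<P>" "\<And>P. P \<in> \<P> \<Longrightarrow> primeideal P S \<and> \<not> SG (unit_vec j) \<subseteq> P" for \<P> j
    by (rule prime_avoidance[OF that])
qed (rule X_degree_0 fin_len_piece acc_M acc_S)+

text \<open>The \<open>A\<close>-submodules of the piece \<open>M\<^sub>n\<close> are exactly its stable subgroups. The inverse inside
  the restricted record has to be identified with the inverse in \<open>M\<close>.\<close>

lemma hilbert_fun_eq: "hilbert_fun A S M MG n = enat (ng.piece_len {\<zero>\<^bsub>M\<^esub>} (carrier M) n)"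
proof -
  let ?H = "scalar_restriction S M (MG n)"
  have sub: "subgroup (MG n) (add_monoid M)"
    using fgm.M_direct_sum by (simp add: direct_sum_def additive_subgroup_def)
  have inv: "inv\<^bsub>add_monoid ?H\<^esub> x = \<ominus>\<^bsub>M\<^esub> x" if x: "x \<in> MG n" for x
  proof -
    have "inv\<^bsub>add_monoid ?H\<^esub> x = inv\<^bsub>(add_monoid M)\<lparr>carrier := MG n\<rparr>\<^esub> x"
      by (simp add: m_inv_def scalar_restriction_def)
    also have "\<dots> = inv\<^bsub>add_monoid M\<^esub> x"
      using group.m_inv_consistent[OF fgm.M.a_group sub x] by simp
    finally show ?thesis by (simp add: a_inv_def)
  qed
  have "submodule N A ?H \<longleftrightarrow> stable M X N \<and> N \<subseteq> MG n" for N
  proof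
    assume N: "submodule N A ?H"
    interpret N: submodule N A ?H by (rule N)
    have le: "N \<subseteq> MG n" using N.subset by (simp add: scalar_restriction_def)
    have "stable M X N"
    proof (rule fgm.stableI)
      show "N \<subseteq> carrier M" using le gm.MG.piece(1) by blast
      show "\<zero>\<^bsub>M\<^esub> \<in> N" using N.one_closed by (simp add: scalar_restriction_def)
      show "x \<oplus>\<^bsub>M\<^esub> y \<in> N" if "x \<in> N" "y \<in> N" for x y
        using N.m_closed[OF that] by (simp add: scalar_restriction_def)
      show "\<ominus>\<^bsub>M\<^esub> x \<in> N" if "x \<in> N" for x
      proof -
        have xn: "x \<in> MG n" using that le by blast
        have "inv\<^bsub>add_monoid ?H\<^esub> x \<in> N" by (rule N.m_inv_closed[OF that])
        then show ?thesis unfolding inv[OF xn] .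
      qed
      show "a \<odot>\<^bsub>M\<^esub> x \<in> N" if "a \<in> X" "x \<in> N" for a x
        using that N.smult_closed[of _ x] by (auto simp: scalars_def scalar_restriction_def)
    qed
    then show "stable M X N \<and> N \<subseteq> MG n" using le by simp
  next
    assume N: "stable M X N \<and> N \<subseteq> MG n"
    then have s: "stable M X N" by simp
    note d = fgm.stableD[OF s]
    show "submodule N A ?H"
    proof (intro submodule.intro subgroup.intro submodule_axioms.intro)
      show "N \<subseteq> carrier (add_monoid ?H)" using N by (simp add: scalar_restriction_def)
      show "x \<otimes>\<^bsub>add_monoid ?H\<^esub> y \<in> N" if "x \<in> N" "y \<in> N" for x y
        using d(4)[OF that] by (simp add: scalar_restriction_def)
      show "\<one>\<^bsub>add_monoid ?H\<^esub> \<in> N" using d(2) by (simp add: scalar_restriction_def)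
      show "inv\<^bsub>add_monoid ?H\<^esub> x \<in> N" if "x \<in> N" for x
      proof -
        have xn: "x \<in> MG n" using that N by blast
        show ?thesis unfolding inv[OF xn] by (rule d(5)[OF that])
      qed
      show "a \<odot>\<^bsub>?H\<^esub> x \<in> N" if "a \<in> carrier A" "x \<in> N" for a x
        using d(7)[of "a \<odot>\<^bsub>S\<^esub> \<one>\<^bsub>S\<^esub>" x] that by (auto simp: scalars_def scalar_restriction_def)
    qed
  qed
  then have fam: "{N. submodule N A ?H} = between M X ({\<zero>\<^bsub>M\<^esub>} \<inter> MG n) (carrier M \<inter> MG n)"
  proof -
    have "stable M X N \<and> N \<subseteq> MG n \<longleftrightarrow> stable M X N \<and> {\<zero>\<^bsub>M\<^esub>} \<inter> MG n \<subseteq> N \<and> N \<subseteq> carrier M \<inter> MG n" for N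
      using fgm.stableD(2)[of X N] gm.MG.piece(1)[of n] by blast
    then show ?thesis using \<open>\<And>N. submodule N A ?H \<longleftrightarrow> stable M X N \<and> N \<subseteq> MG n\<close>
      unfolding between_def by simp
  qed
  let ?C = "chain_lengths (between M X ({\<zero>\<^bsub>M\<^esub>} \<inter> MG n) (carrier M \<inter> MG n))"
  have fin: "finite ?C"
    using ng.fin_piece[OF gm.graded_sub_zero, of n "carrier M"] by (simp add: fin_len_def)
  have ne: "?C \<noteq> {}"
    using zero_in_chain_lengths[of "{\<zero>\<^bsub>M\<^esub>} \<inter> MG n" "between M X ({\<zero>\<^bsub>M\<^esub>} \<inter> MG n) (carrier M \<inter> MG n)"]
      ng.stable_piece[OF gm.graded_sub_zero, of n] by (auto simp: between_def)
  have "Sup (enat ` ?C) = Max (enat ` ?C)" using fin ne by (simp add: Sup_enat_def)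
  also have "\<dots> = enat (Max ?C)"
    using mono_Max_commute[of enat ?C] fin ne by (simp add: mono_def)
  finally show ?thesis by (simp add: hilbert_fun_def module_length_def fam ng.piece_len_def len_def)
qed

lemma is_hilbert_coeffs_iff: "is_hilbert_coeffs A S M MG e \<longleftrightarrow> ng.has_coeffs {\<zero>\<^bsub>M\<^esub>} (carrier M) e"
  by (simp add: is_hilbert_coeffs_def ng.has_coeffs_def hilbert_fun_eq)

lemma hilbert_coeff: "ng.has_coeffs {\<zero>\<^bsub>M\<^esub>} (carrier M) (hilbert_coeff A S M MG)"
proof -
  obtain e where e: "ng.has_coeffs {\<zero>\<^bsub>M\<^esub>} (carrier M) e"
    using ng.has_coeffs_exist[OF gm.graded_sub_zero gm.graded_sub_carrier] by auto
  have "hilbert_coeff A S M MG = e"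
    unfolding hilbert_coeff_def is_hilbert_coeffs_iff
    by (rule the_equality[where P = "ng.has_coeffs {\<zero>\<^bsub>M\<^esub>} (carrier M)", OF e]) (rule ng.has_coeffs_unique[OF _ e])
  then show ?thesis using e by simp
qed

end

theorem corollary2p16:
  fixes A :: "('a, 'c) ring_scheme" and \<mm> :: "'a set"
    and S :: "('a, 's, 'e) module_scheme" and SG :: "('d::finite \<Rightarrow> nat) \<Rightarrow> 's set"
    and M :: "('s, 'm, 'f) module_scheme" and MG :: "('d \<Rightarrow> nat) \<Rightarrow> 'm set"
    and k :: "'d \<Rightarrow> nat"
  assumes "artinian_local_ring A \<mm>"
    and "infinite (carrier (A Quot \<mm>))"
    and "standard_graded_algebra A S SG"
    and "fg_graded_module S SG M MG"
    and "mixed_mult_defined A S M MG k"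
  shows "(hilbert_coeff A S M MG k > 0
        \<longleftrightarrow> (\<forall>xs. mixed_mult_system S SG M k xs \<longrightarrow>
              dim_supp S SG (quotient_by_seq S M xs) = 0))
    \<and> ((\<forall>xs. mixed_mult_system S SG M k xs \<longrightarrow>
              dim_supp S SG (quotient_by_seq S M xs) = 0)
        \<longleftrightarrow> (\<forall>xs. filter_regular_seq S SG M MG xs \<and> of_type SG k xs \<longrightarrow>
              dim_supp S SG (quotient_by_seq S M xs) = 0))
    \<and> ((\<forall>xs. filter_regular_seq S SG M MG xs \<and> of_type SG k xs \<longrightarrow>
              dim_supp S SG (quotient_by_seq S M xs) = 0)
        \<longleftrightarrow> (\<exists>xs. filter_regular_seq S SG M MG xs \<and> of_type SG k xs \<and>
              dim_supp S SG (quotient_by_seq S M xs) = 0))"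
proof -
  interpret standard_graded_module A \<mm> S SG M MG
    by (intro standard_graded_module.intro standard_graded_module_axioms.intro assms)
  show ?thesis
    by (rule ng.positivity_equivalences[OF hilbert_coeff]) (use assms(5) in \<open>simp add: mixed_mult_defined_def\<close>)
qed

end
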